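(* Let $\varphi:(M,g)\to(N,h)$ be an isometric immersion into a Riemannian manifold $(N,h)$ whose Ricci curvature is non-positive, with $\dim M=\dim N-1$, and assume that $\overline\nabla^\perp_X\tau(\varphi)=0$ for every $C^\infty$ vector field $X$ on $M$. Then, if $\varphi$ is biharmonic, it is harmonic.
   Context: Let $\nabla,\nabla^h$ be the Levi-Civita connections of $(M,g)$ and $(N,h)$, $\overline\nabla$ the induced connection on $\varphi^{-1}TN$, and $\overline\nabla^\perp$ the normal connection on the normal bundle $T^\perp M$. The second fundamental form is $B_\varphi(X,Y)=\overline\nabla_X(d\varphi(Y))-d\varphi(\nabla_XY)$ and the tension field is $\tau(\varphi)=\sum_{i}B_\varphi(e_i,e_i)$ for a local orthonormal frame field $\{e_i\}$ of $(M,g)$. The curvature tensor is $R^h(U,V)W=\nabla^h_U\nabla^h_VW-\nabla^h_V\nabla^h_UW-\nabla^h_{[U,V]}W$, and the Ricci transform is $\rho^h(u)=\sum_iR^h(u,e_i')e_i'$ with $\{e_i'\}$ an orthonormal basis of $T_yN$; non-positive Ricci curvature means $h(\rho^h(u),u)\le0$ for all $u$. The bitension field is $\tau_2(\varphi)=\overline\Delta\tau(\varphi)-\sum_{i}R^h(\tau(\varphi),d\varphi(e_i))d\varphi(e_i)$, where $\overline\Delta V=-\sum_{i}\{\overline\nabla_{e_i}\overline\nabla_{e_i}V-\overline\nabla_{\nabla_{e_i}e_i}V\}$. The map $\varphi$ is harmonic if $\tau(\varphi)=0$ and biharmonic if $\tau_2(\varphi)=0$. *)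

theory Defs
  imports "HOL-Analysis.Analysis" "HOL-Library.Function_Algebras"
begin

section \<open>Smooth functions between Euclidean spaces\<close>

text \<open>Only meant for open \<^term>\<open>S\<close> and finite-dimensional domains, where differentiability
  together with \<open>C\<^sup>k\<close> directional derivatives in all directions is \<open>C\<close> of order \<open>k + 1\<close>.\<close>

primrec Ck_on :: "nat \<Rightarrow> 'a::real_normed_vector set \<Rightarrow> ('a \<Rightarrow> 'b::real_normed_vector) \<Rightarrow> bool" where
  "Ck_on 0 S f \<longleftrightarrow> continuous_on S f"
| "Ck_on (Suc k) S f \<longleftrightarrow>
     (\<forall>x\<in>S. f differentiable (at x)) \<and> (\<forall>v. Ck_on k S (\<lambda>x. frechet_derivative f (at x) v))"

definition smooth_on :: "'a::real_normed_vector set \<Rightarrow> ('a \<Rightarrow> 'b::real_normed_vector) \<Rightarrow> bool" where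
  "smooth_on S f \<longleftrightarrow> (\<forall>k. Ck_on k S f)"


section \<open>Smooth manifolds\<close>

text \<open>The points of a manifold are the elements of \<^term>\<open>topspace (mtop M)\<close>, and its dimension is
  that of the model space \<open>'e\<close>. A chart is a pair of its domain and the coordinate map, which is
  only relevant on the domain. The atlas need not be maximal.\<close>

type_synonym ('a, 'e) chart = "'a set \<times> ('a \<Rightarrow> 'e)"

record ('a, 'e) manifold =
  mtop :: "'a topology"
  atlas :: "('a, 'e) chart set"

definition is_chart :: "'a topology \<Rightarrow> ('a, 'e::euclidean_space) chart \<Rightarrow> bool" where
  "is_chart T c \<longleftrightarrow> (case c of (U, \<psi>) \<Rightarrow>
     openin T U \<and> open (\<psi> ` U) \<and>
     homeomorphic_map (subtopology T U) (top_of_set (\<psi> ` U)) \<psi>)"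

definition smooth_manifold :: "('a, 'e::euclidean_space) manifold \<Rightarrow> bool" where
  "smooth_manifold M \<longleftrightarrow>
     Hausdorff_space (mtop M) \<and> second_countable (mtop M) \<and>
     (\<forall>c\<in>atlas M. is_chart (mtop M) c) \<and>
     (\<Union>(U, \<psi>)\<in>atlas M. U) = topspace (mtop M) \<and>
     (\<forall>(U, \<psi>)\<in>atlas M. \<forall>(V, \<theta>)\<in>atlas M. smooth_on (\<psi> ` (U \<inter> V)) (\<theta> \<circ> inv_into U \<psi>))"

definition mdim :: "('a, 'e::euclidean_space) manifold \<Rightarrow> nat" where
  "mdim M = DIM('e)"

definition smooth_fun_on :: "('a, 'e::euclidean_space) manifold \<Rightarrow> 'a set \<Rightarrow> ('a \<Rightarrow> real) \<Rightarrow> bool" where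
  "smooth_fun_on M W f \<longleftrightarrow> (\<forall>(U, \<psi>)\<in>atlas M. smooth_on (\<psi> ` (U \<inter> W)) (f \<circ> inv_into U \<psi>))"

definition smooth_near :: "('a, 'e::euclidean_space) manifold \<Rightarrow> 'a \<Rightarrow> ('a \<Rightarrow> real) \<Rightarrow> bool" where
  "smooth_near M p f \<longleftrightarrow> (\<exists>W. openin (mtop M) W \<and> p \<in> W \<and> smooth_fun_on M W f)"

definition smooth_map ::
  "('a, 'e::euclidean_space) manifold \<Rightarrow> ('b, 'f::euclidean_space) manifold \<Rightarrow> ('a \<Rightarrow> 'b) \<Rightarrow> bool" where
  "smooth_map M N \<phi> \<longleftrightarrow>
     continuous_map (mtop M) (mtop N) \<phi> \<and>
     (\<forall>(U, \<psi>)\<in>atlas M. \<forall>(V, \<theta>)\<in>atlas N.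
        smooth_on (\<psi> ` (U \<inter> \<phi> -` V)) (\<theta> \<circ> \<phi> \<circ> inv_into U \<psi>))"


section \<open>Tangent vectors and vector fields\<close>

text \<open>A tangent vector at \<open>p\<close> is a directional derivative acting on the functions that are smooth
  near \<open>p\<close>. As functions are total in HOL, it is set to \<open>0\<close> on all other functions, so that equality
  of tangent vectors is plain equality. Addition, zero, difference and finite sums of tangent vectors
  are the pointwise operations on functions.\<close>

type_synonym 'a tvec = "('a \<Rightarrow> real) \<Rightarrow> real"
type_synonym 'a vfield = "'a \<Rightarrow> 'a tvec"

definition vscale :: "real \<Rightarrow> 'a tvec \<Rightarrow> 'a tvec" (infixr "\<cdot>\<^sub>v" 75) where
  "a \<cdot>\<^sub>v v = (\<lambda>f. a * v f)"

definition chart_vec ::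
  "('a, 'e::euclidean_space) manifold \<Rightarrow> ('a, 'e) chart \<Rightarrow> 'a \<Rightarrow> 'e \<Rightarrow> 'a tvec" where
  "chart_vec M c p \<xi> = (case c of (U, \<psi>) \<Rightarrow> (\<lambda>f.
     if smooth_near M p f then frechet_derivative (f \<circ> inv_into U \<psi>) (at (\<psi> p)) \<xi> else 0))"

definition tangent_space :: "('a, 'e::euclidean_space) manifold \<Rightarrow> 'a \<Rightarrow> 'a tvec set" where
  "tangent_space M p = {chart_vec M c p \<xi> | c \<xi>. c \<in> atlas M \<and> p \<in> fst c}"

text \<open>Smooth sections over the open set \<open>W\<close> of \<open>TM\<close>, and of \<open>\<phi>\<^sup>-\<^sup>1TN\<close>. Values outside \<open>W\<close> are
  arbitrary.\<close>

definition vector_fields :: "('a, 'e::euclidean_space) manifold \<Rightarrow> 'a set \<Rightarrow> 'a vfield set" where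
  "vector_fields M W = {X.
     (\<forall>p\<in>W. X p \<in> tangent_space M p) \<and>
     (\<forall>W' f. openin (mtop M) W' \<and> W' \<subseteq> W \<and> smooth_fun_on M W' f \<longrightarrow>
        smooth_fun_on M W' (\<lambda>p. X p f))}"

definition sections_along ::
  "('a, 'e::euclidean_space) manifold \<Rightarrow> ('b, 'f::euclidean_space) manifold \<Rightarrow> ('a \<Rightarrow> 'b) \<Rightarrow>
   'a set \<Rightarrow> ('a \<Rightarrow> 'b tvec) set" where
  "sections_along M N \<phi> W = {V.
     (\<forall>p\<in>W. V p \<in> tangent_space N (\<phi> p)) \<and>
     (\<forall>W' f. openin (mtop N) W' \<and> smooth_fun_on N W' f \<longrightarrow>
        smooth_fun_on M (W \<inter> \<phi> -` W') (\<lambda>p. V p f))}"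

definition bracket ::
  "('a, 'e::euclidean_space) manifold \<Rightarrow> 'a vfield \<Rightarrow> 'a vfield \<Rightarrow> 'a vfield" where
  "bracket M X Y = (\<lambda>p f.
     if smooth_near M p f then X p (\<lambda>q. Y q f) - Y p (\<lambda>q. X q f) else 0)"

definition differential ::
  "('b, 'f::euclidean_space) manifold \<Rightarrow> ('a \<Rightarrow> 'b) \<Rightarrow> 'a \<Rightarrow> 'a tvec \<Rightarrow> 'b tvec" where
  "differential N \<phi> p v = (\<lambda>f. if smooth_near N (\<phi> p) f then v (f \<circ> \<phi>) else 0)"

definition pushforward ::
  "('b, 'f::euclidean_space) manifold \<Rightarrow> ('a \<Rightarrow> 'b) \<Rightarrow> 'a vfield \<Rightarrow> 'a \<Rightarrow> 'b tvec" where
  "pushforward N \<phi> X = (\<lambda>p. differential N \<phi> p (X p))"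


section \<open>Riemannian metrics and isometric immersions\<close>

type_synonym 'a metric_field = "'a \<Rightarrow> 'a tvec \<Rightarrow> 'a tvec \<Rightarrow> real"

definition riemannian_metric ::
  "('a, 'e::euclidean_space) manifold \<Rightarrow> 'a metric_field \<Rightarrow> bool" where
  "riemannian_metric M g \<longleftrightarrow>
     (\<forall>p\<in>topspace (mtop M). \<forall>u\<in>tangent_space M p. \<forall>v\<in>tangent_space M p.
        g p u v = g p v u \<and>
        (\<forall>w\<in>tangent_space M p. g p (u + v) w = g p u w + g p v w) \<and>
        (\<forall>a. g p (a \<cdot>\<^sub>v u) v = a * g p u v) \<and>
        (u \<noteq> 0 \<longrightarrow> g p u u > 0)) \<and>
     (\<forall>W X Y. openin (mtop M) W \<and> X \<in> vector_fields M W \<and> Y \<in> vector_fields M W \<longrightarrow>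
        smooth_fun_on M W (\<lambda>p. g p (X p) (Y p)))"

definition riemannian_manifold ::
  "('a, 'e::euclidean_space) manifold \<Rightarrow> 'a metric_field \<Rightarrow> bool" where
  "riemannian_manifold M g \<longleftrightarrow> smooth_manifold M \<and> riemannian_metric M g"

definition isometric_immersion ::
  "('a, 'e::euclidean_space) manifold \<Rightarrow> 'a metric_field \<Rightarrow>
   ('b, 'f::euclidean_space) manifold \<Rightarrow> 'b metric_field \<Rightarrow> ('a \<Rightarrow> 'b) \<Rightarrow> bool" where
  "isometric_immersion M g N h \<phi> \<longleftrightarrow>
     smooth_map M N \<phi> \<and>
     (\<forall>p\<in>topspace (mtop M).
        inj_on (differential N \<phi> p) (tangent_space M p) \<and>
        (\<forall>u\<in>tangent_space M p. \<forall>v\<in>tangent_space M p.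
           h (\<phi> p) (differential N \<phi> p u) (differential N \<phi> p v) = g p u v))"

definition orthonormal_basis_at ::
  "('a, 'e::euclidean_space) manifold \<Rightarrow> 'a metric_field \<Rightarrow> 'a \<Rightarrow> (nat \<Rightarrow> 'a tvec) \<Rightarrow> bool" where
  "orthonormal_basis_at M g p e \<longleftrightarrow>
     (\<forall>i<mdim M. e i \<in> tangent_space M p) \<and>
     (\<forall>i<mdim M. \<forall>j<mdim M. g p (e i) (e j) = (if i = j then 1 else 0))"

definition orthonormal_frame_on ::
  "('a, 'e::euclidean_space) manifold \<Rightarrow> 'a metric_field \<Rightarrow> 'a set \<Rightarrow> (nat \<Rightarrow> 'a vfield) \<Rightarrow> bool" where
  "orthonormal_frame_on M g W E \<longleftrightarrow>
     (\<forall>i<mdim M. E i \<in> vector_fields M W) \<and>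
     (\<forall>p\<in>W. orthonormal_basis_at M g p (\<lambda>i. E i p))"

text \<open>Some smooth orthonormal frame field defined near \<open>p\<close>, and some orthonormal basis at \<open>p\<close>. The
  traces below do not depend on the choice.\<close>

definition frame_near ::
  "('a, 'e::euclidean_space) manifold \<Rightarrow> 'a metric_field \<Rightarrow> 'a \<Rightarrow> nat \<Rightarrow> 'a vfield" where
  "frame_near M g p =
     (SOME E. \<exists>W. openin (mtop M) W \<and> p \<in> W \<and> orthonormal_frame_on M g W E)"

definition basis_at ::
  "('a, 'e::euclidean_space) manifold \<Rightarrow> 'a metric_field \<Rightarrow> 'a \<Rightarrow> nat \<Rightarrow> 'a tvec" where
  "basis_at M g p = (SOME e. orthonormal_basis_at M g p e)"


section \<open>Connections\<close>

text \<open>A connection on a vector bundle over \<open>M\<close>, given by its smooth sections \<open>\<Gamma> W\<close> over the open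
  sets \<open>W\<close>. Since connections are local operators, one total function \<open>D\<close> can act on the sections
  over all open sets at once; its values are constrained only where the arguments are smooth.\<close>

definition is_connection ::
  "('a, 'e::euclidean_space) manifold \<Rightarrow> ('a set \<Rightarrow> ('a \<Rightarrow> 'b tvec) set) \<Rightarrow>
   ('a vfield \<Rightarrow> ('a \<Rightarrow> 'b tvec) \<Rightarrow> 'a \<Rightarrow> 'b tvec) \<Rightarrow> bool" where
  "is_connection M \<Gamma> D \<longleftrightarrow>
     (\<forall>W. openin (mtop M) W \<longrightarrow>
       (\<forall>X\<in>vector_fields M W. \<forall>V\<in>\<Gamma> W.
          D X V \<in> \<Gamma> W \<and>
          (\<forall>X'\<in>vector_fields M W. \<forall>p\<in>W. D (\<lambda>q. X q + X' q) V p = D X V p + D X' V p) \<and>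
          (\<forall>V'\<in>\<Gamma> W. \<forall>p\<in>W. D X (\<lambda>q. V q + V' q) p = D X V p + D X V' p) \<and>
          (\<forall>f. smooth_fun_on M W f \<longrightarrow> (\<forall>p\<in>W.
             D (\<lambda>q. f q \<cdot>\<^sub>v X q) V p = f p \<cdot>\<^sub>v D X V p \<and>
             D X (\<lambda>q. f q \<cdot>\<^sub>v V q) p = X p f \<cdot>\<^sub>v V p + f p \<cdot>\<^sub>v D X V p))))"

definition levi_civita ::
  "('a, 'e::euclidean_space) manifold \<Rightarrow> 'a metric_field \<Rightarrow>
   ('a vfield \<Rightarrow> 'a vfield \<Rightarrow> 'a vfield) \<Rightarrow> bool" where
  "levi_civita M g D \<longleftrightarrow>
     is_connection M (vector_fields M) D \<and>
     (\<forall>W. openin (mtop M) W \<longrightarrow>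
       (\<forall>X\<in>vector_fields M W. \<forall>Y\<in>vector_fields M W. \<forall>p\<in>W.
          D X Y p - D Y X p = bracket M X Y p \<and>
          (\<forall>Z\<in>vector_fields M W.
             X p (\<lambda>q. g q (Y q) (Z q)) = g p (D X Y p) (Z p) + g p (Y p) (D X Z p))))"

text \<open>The connection on \<open>\<phi>\<^sup>-\<^sup>1TN\<close> induced by the connection \<open>Dh\<close> of \<open>N\<close> is determined by
  \<open>D\<^sub>X (Y \<circ> \<phi>) = Dh\<^bsub>d\<phi>(X)\<^esub> Y\<close>, where the subscript on the right is a tangent vector, represented
  by any vector field \<open>Z\<close> taking this value.\<close>

definition induced_connection ::
  "('a, 'e::euclidean_space) manifold \<Rightarrow> ('b, 'f::euclidean_space) manifold \<Rightarrow> ('a \<Rightarrow> 'b) \<Rightarrow>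
   ('b vfield \<Rightarrow> 'b vfield \<Rightarrow> 'b vfield) \<Rightarrow>
   ('a vfield \<Rightarrow> ('a \<Rightarrow> 'b tvec) \<Rightarrow> 'a \<Rightarrow> 'b tvec) \<Rightarrow> bool" where
  "induced_connection M N \<phi> Dh D \<longleftrightarrow>
     is_connection M (sections_along M N \<phi>) D \<and>
     (\<forall>W W' X Y Z. openin (mtop M) W \<and> openin (mtop N) W' \<and> X \<in> vector_fields M W \<and>
        Y \<in> vector_fields N W' \<and> Z \<in> vector_fields N W' \<longrightarrow>
        (\<forall>p\<in>W \<inter> \<phi> -` W'. differential N \<phi> p (X p) = Z (\<phi> p) \<longrightarrow>
           D X (Y \<circ> \<phi>) p = Dh Z Y (\<phi> p)))"

definition normal_space ::
  "('a, 'e::euclidean_space) manifold \<Rightarrow> ('b, 'f::euclidean_space) manifold \<Rightarrow> 'b metric_field \<Rightarrow>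
   ('a \<Rightarrow> 'b) \<Rightarrow> 'a \<Rightarrow> 'b tvec set" where
  "normal_space M N h \<phi> p = {w \<in> tangent_space N (\<phi> p).
     \<forall>v\<in>tangent_space M p. h (\<phi> p) w (differential N \<phi> p v) = 0}"

definition normal_part ::
  "('a, 'e::euclidean_space) manifold \<Rightarrow> ('b, 'f::euclidean_space) manifold \<Rightarrow> 'b metric_field \<Rightarrow>
   ('a \<Rightarrow> 'b) \<Rightarrow> 'a \<Rightarrow> 'b tvec \<Rightarrow> 'b tvec" where
  "normal_part M N h \<phi> p w =
     (THE z. z \<in> normal_space M N h \<phi> p \<and>
        (\<exists>v\<in>tangent_space M p. w = differential N \<phi> p v + z))"

definition normal_connection ::
  "('a, 'e::euclidean_space) manifold \<Rightarrow> ('b, 'f::euclidean_space) manifold \<Rightarrow> 'b metric_field \<Rightarrow>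
   ('a \<Rightarrow> 'b) \<Rightarrow> ('a vfield \<Rightarrow> ('a \<Rightarrow> 'b tvec) \<Rightarrow> 'a \<Rightarrow> 'b tvec) \<Rightarrow>
   'a vfield \<Rightarrow> ('a \<Rightarrow> 'b tvec) \<Rightarrow> 'a \<Rightarrow> 'b tvec" where
  "normal_connection M N h \<phi> D X V = (\<lambda>p. normal_part M N h \<phi> p (D X V p))"


section \<open>Curvature\<close>

definition curvature ::
  "('a, 'e::euclidean_space) manifold \<Rightarrow> ('a vfield \<Rightarrow> 'a vfield \<Rightarrow> 'a vfield) \<Rightarrow>
   'a vfield \<Rightarrow> 'a vfield \<Rightarrow> 'a vfield \<Rightarrow> 'a vfield" where
  "curvature M D U V W = (\<lambda>p. D U (D V W) p - D V (D U W) p - D (bracket M U V) W p)"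

text \<open>Some vector field that is smooth near \<open>p\<close> and takes the value \<open>v\<close> at \<open>p\<close>. The curvature is
  tensorial, so the choice of the extensions does not matter.\<close>

definition extension :: "('a, 'e::euclidean_space) manifold \<Rightarrow> 'a \<Rightarrow> 'a tvec \<Rightarrow> 'a vfield" where
  "extension M p v =
     (SOME X. \<exists>W. openin (mtop M) W \<and> p \<in> W \<and> X \<in> vector_fields M W \<and> X p = v)"

definition curvature_at ::
  "('a, 'e::euclidean_space) manifold \<Rightarrow> ('a vfield \<Rightarrow> 'a vfield \<Rightarrow> 'a vfield) \<Rightarrow> 'a \<Rightarrow>
   'a tvec \<Rightarrow> 'a tvec \<Rightarrow> 'a tvec \<Rightarrow> 'a tvec" where
  "curvature_at M D p u v w =
     curvature M D (extension M p u) (extension M p v) (extension M p w) p"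

definition ricci_transform ::
  "('a, 'e::euclidean_space) manifold \<Rightarrow> 'a metric_field \<Rightarrow>
   ('a vfield \<Rightarrow> 'a vfield \<Rightarrow> 'a vfield) \<Rightarrow> 'a \<Rightarrow> 'a tvec \<Rightarrow> 'a tvec" where
  "ricci_transform M g D p u =
     (\<Sum>i<mdim M. curvature_at M D p u (basis_at M g p i) (basis_at M g p i))"

definition nonpositive_ricci ::
  "('a, 'e::euclidean_space) manifold \<Rightarrow> 'a metric_field \<Rightarrow>
   ('a vfield \<Rightarrow> 'a vfield \<Rightarrow> 'a vfield) \<Rightarrow> bool" where
  "nonpositive_ricci M g D \<longleftrightarrow>
     (\<forall>p\<in>topspace (mtop M). \<forall>u\<in>tangent_space M p. g p (ricci_transform M g D p u) u \<le> 0)"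


section \<open>Harmonic and biharmonic maps\<close>

text \<open>Below, \<open>Dg\<close>, \<open>Dh\<close> and \<open>D\<close> are the connections of \<open>M\<close>, of \<open>N\<close> and of \<open>\<phi>\<^sup>-\<^sup>1TN\<close>.\<close>

definition second_fundamental_form ::
  "('b, 'f::euclidean_space) manifold \<Rightarrow> ('a \<Rightarrow> 'b) \<Rightarrow> ('a vfield \<Rightarrow> 'a vfield \<Rightarrow> 'a vfield) \<Rightarrow>
   ('a vfield \<Rightarrow> ('a \<Rightarrow> 'b tvec) \<Rightarrow> 'a \<Rightarrow> 'b tvec) \<Rightarrow> 'a vfield \<Rightarrow> 'a vfield \<Rightarrow> 'a \<Rightarrow> 'b tvec" where
  "second_fundamental_form N \<phi> Dg D X Y =
     (\<lambda>p. D X (pushforward N \<phi> Y) p - pushforward N \<phi> (Dg X Y) p)"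

definition tension ::
  "('a, 'e::euclidean_space) manifold \<Rightarrow> 'a metric_field \<Rightarrow> ('b, 'f::euclidean_space) manifold \<Rightarrow>
   ('a \<Rightarrow> 'b) \<Rightarrow> ('a vfield \<Rightarrow> 'a vfield \<Rightarrow> 'a vfield) \<Rightarrow>
   ('a vfield \<Rightarrow> ('a \<Rightarrow> 'b tvec) \<Rightarrow> 'a \<Rightarrow> 'b tvec) \<Rightarrow> 'a \<Rightarrow> 'b tvec" where
  "tension M g N \<phi> Dg D = (\<lambda>p. let E = frame_near M g p in
     \<Sum>i<mdim M. second_fundamental_form N \<phi> Dg D (E i) (E i) p)"

definition rough_laplacian ::
  "('a, 'e::euclidean_space) manifold \<Rightarrow> 'a metric_field \<Rightarrow>
   ('a vfield \<Rightarrow> 'a vfield \<Rightarrow> 'a vfield) \<Rightarrow> ('a vfield \<Rightarrow> ('a \<Rightarrow> 'b tvec) \<Rightarrow> 'a \<Rightarrow> 'b tvec) \<Rightarrow>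
   ('a \<Rightarrow> 'b tvec) \<Rightarrow> 'a \<Rightarrow> 'b tvec" where
  "rough_laplacian M g Dg D V = (\<lambda>p. let E = frame_near M g p in
     - (\<Sum>i<mdim M. D (E i) (D (E i) V) p - D (Dg (E i) (E i)) V p))"

definition bitension ::
  "('a, 'e::euclidean_space) manifold \<Rightarrow> 'a metric_field \<Rightarrow> ('b, 'f::euclidean_space) manifold \<Rightarrow>
   ('a \<Rightarrow> 'b) \<Rightarrow> ('a vfield \<Rightarrow> 'a vfield \<Rightarrow> 'a vfield) \<Rightarrow> ('b vfield \<Rightarrow> 'b vfield \<Rightarrow> 'b vfield) \<Rightarrow>
   ('a vfield \<Rightarrow> ('a \<Rightarrow> 'b tvec) \<Rightarrow> 'a \<Rightarrow> 'b tvec) \<Rightarrow> 'a \<Rightarrow> 'b tvec" where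
  "bitension M g N \<phi> Dg Dh D = (\<lambda>p. let E = frame_near M g p; \<tau> = tension M g N \<phi> Dg D in
     rough_laplacian M g Dg D \<tau> p -
     (\<Sum>i<mdim M. curvature_at N Dh (\<phi> p) (\<tau> p)
        (pushforward N \<phi> (E i) p) (pushforward N \<phi> (E i) p)))"

definition harmonic ::
  "('a, 'e::euclidean_space) manifold \<Rightarrow> 'a metric_field \<Rightarrow> ('b, 'f::euclidean_space) manifold \<Rightarrow>
   ('a \<Rightarrow> 'b) \<Rightarrow> ('a vfield \<Rightarrow> 'a vfield \<Rightarrow> 'a vfield) \<Rightarrow>
   ('a vfield \<Rightarrow> ('a \<Rightarrow> 'b tvec) \<Rightarrow> 'a \<Rightarrow> 'b tvec) \<Rightarrow> bool" where
  "harmonic M g N \<phi> Dg D \<longleftrightarrow> (\<forall>p\<in>topspace (mtop M). tension M g N \<phi> Dg D p = 0)"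

definition biharmonic ::
  "('a, 'e::euclidean_space) manifold \<Rightarrow> 'a metric_field \<Rightarrow> ('b, 'f::euclidean_space) manifold \<Rightarrow>
   ('a \<Rightarrow> 'b) \<Rightarrow> ('a vfield \<Rightarrow> 'a vfield \<Rightarrow> 'a vfield) \<Rightarrow> ('b vfield \<Rightarrow> 'b vfield \<Rightarrow> 'b vfield) \<Rightarrow>
   ('a vfield \<Rightarrow> ('a \<Rightarrow> 'b tvec) \<Rightarrow> 'a \<Rightarrow> 'b tvec) \<Rightarrow> bool" where
  "biharmonic M g N \<phi> Dg Dh D \<longleftrightarrow> (\<forall>p\<in>topspace (mtop M). bitension M g N \<phi> Dg Dh D p = 0)"

end

theory Submission
  imports Defs
begin

text \<open>The tension field \<open>\<tau>\<close> is normal, and \<open>D\<^sub>X \<tau>\<close> is tangential for every \<open>X\<close> because \<open>\<tau>\<close> is parallel in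
  the normal bundle. Differentiating \<open>\<langle>D\<^sub>X \<tau>, \<tau>\<rangle> = 0\<close> shows that the rough Laplacian of \<open>\<tau>\<close> paired with \<open>\<tau>\<close>
  is the sum of the \<open>|D \<tau>|\<^sup>2\<close> over an orthonormal frame. Where \<open>\<tau> \<noteq> 0\<close>, the vector \<open>\<tau> / |\<tau>|\<close> completes the
  image of the frame to an orthonormal basis of the tangent space of \<open>N\<close>, and \<open>R(\<tau>, \<tau>) = 0\<close>, so biharmonicity
  identifies this sum with \<open>\<langle>Ric \<tau>, \<tau>\<rangle> \<le> 0\<close>. Hence \<open>D \<tau> = 0\<close>, and differentiating \<open>\<langle>d\<phi> E, \<tau>\<rangle> = 0\<close> along the
  frame fields \<open>E\<close> gives \<open>|\<tau>|\<^sup>2 = 0\<close>.\<close>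

section \<open>Smooth functions on Euclidean spaces\<close>

text \<open>The obstacle is that the objects are choices or total functions. \<open>D\<close> is
  constrained only on smooth arguments and no locality is assumed for it;
  \<open>frame_near M g p\<close> may change with \<open>p\<close>; \<open>curvature_at\<close> and
  \<open>ricci_transform\<close> rest on chosen extensions and bases. Tensoriality, and the
  independence of traces from the basis, remove these choices: one frame can be kept on a whole
  neighbourhood, where \<open>\<tau>\<close> can be differentiated, and the Ricci trace can be taken
  in a basis adapted to \<open>\<tau>\<close>. Parallelism is assumed along globally defined fields,
  while frames exist only locally; a cutoff function realises every tangent vector by a global
  field. The induced connection is specified only on fields pulled back from \<open>N\<close>, so
  its compatibility with \<open>h\<close> and its symmetry are derived in a coordinate frame of
  \<open>N\<close>. Codimension one enters at a single place: the curvature trace in the bitension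
  runs over the directions of \<open>M\<close>, the Ricci trace over exactly one more, and that one
  is spanned by \<open>\<tau>\<close>. The argument is a contradiction at one point with
  \<open>\<tau> p \<noteq> 0\<close>.\<close>

lemma frechet_derivative_eq:
  "(f has_derivative f') (at x) \<Longrightarrow> frechet_derivative f (at x) = f'"
  using frechet_derivative_at by metis

text \<open>\<open>frechet_derivative\<close> is a choice among all derivatives, and both functions
  have the same ones at \<open>x\<close>. The choices therefore agree even if no derivative
  exists.\<close>

lemma frechet_derivative_cong_open:
  assumes "open S" "x \<in> S" "\<And>y. y \<in> S \<Longrightarrow> f y = g y"
  shows "f differentiable (at x) \<longleftrightarrow> g differentiable (at x)"
    and "frechet_derivative f (at x) = frechet_derivative g (at x)"
proof -
  have "(f has_derivative f') (at x) \<longleftrightarrow> (g has_derivative f') (at x)" for f'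
    using assms has_derivative_transform_within_open[of f f' x UNIV S g]
      has_derivative_transform_within_open[of g f' x UNIV S f] by auto
  then show "f differentiable (at x) \<longleftrightarrow> g differentiable (at x)"
    and "frechet_derivative f (at x) = frechet_derivative g (at x)"
    by (auto simp: differentiable_def frechet_derivative_def)
qed

lemma Ck_on_cong:
  assumes "open S" "\<And>x. x \<in> S \<Longrightarrow> f x = g x"
  shows "Ck_on k S f \<longleftrightarrow> Ck_on k S g"
  using assms(2)
proof (induction k arbitrary: f g)
  case 0
  then show ?case by (simp cong: continuous_on_cong)
next
  case (Suc k)
  have d: "f differentiable (at x) \<longleftrightarrow> g differentiable (at x)"
    "frechet_derivative f (at x) = frechet_derivative g (at x)" if "x \<in> S" for x
    using frechet_derivative_cong_open[OF \<open>open S\<close> that Suc.prems] by auto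
  have "Ck_on k S (\<lambda>x. frechet_derivative f (at x) v) \<longleftrightarrow>
      Ck_on k S (\<lambda>x. frechet_derivative g (at x) v)" for v
    by (rule Suc.IH) (simp add: d)
  then show ?case by (simp add: d)
qed

lemma Ck_on_subset: "Ck_on k S f \<Longrightarrow> T \<subseteq> S \<Longrightarrow> Ck_on k T f"
  by (induction k arbitrary: f) (auto intro: continuous_on_subset)

lemma Ck_on_SucD: "Ck_on (Suc k) S f \<Longrightarrow> Ck_on k S f"
proof (induction k arbitrary: f)
  case 0
  then show ?case
    by (auto intro!: continuous_at_imp_continuous_on differentiable_imp_continuous_within)
qed auto

lemma Ck_on_local:
  assumes "\<And>x. x \<in> S \<Longrightarrow> \<exists>T. open T \<and> x \<in> T \<and> Ck_on k T f"
  shows "Ck_on k S f"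
  using assms
proof (induction k arbitrary: f)
  case 0
  then show ?case
    by (auto intro!: continuous_at_imp_continuous_on simp: continuous_on_eq_continuous_at)
      (metis continuous_on_eq_continuous_at)
next
  case (Suc k)
  have "f differentiable (at x)" if "x \<in> S" for x
    using Suc.prems[OF that] by auto
  moreover have "Ck_on k S (\<lambda>x. frechet_derivative f (at x) v)" for v
    by (rule Suc.IH) (use Suc.prems in \<open>fastforce\<close>)
  ultimately show ?case by simp
qed

lemma Ck_on_const: "Ck_on k S (\<lambda>x. c)"
proof (induction k arbitrary: c)
  case (Suc k)
  have "frechet_derivative (\<lambda>x. c) (at x) = (\<lambda>v. 0)" for x :: 'a and c :: 'b
    by (rule frechet_derivative_eq) simp
  then show ?case using Suc by simp
qed simp

lemma Ck_on_add:
  assumes "Ck_on k S f" "Ck_on k S g" "open S"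
  shows "Ck_on k S (\<lambda>x. f x + g x)"
  using assms(1,2)
proof (induction k arbitrary: f g)
  case 0
  then show ?case by (simp add: continuous_on_add)
next
  case (Suc k)
  have d: "frechet_derivative (\<lambda>x. f x + g x) (at x) =
      (\<lambda>v. frechet_derivative f (at x) v + frechet_derivative g (at x) v)" if "x \<in> S" for x
    by (rule frechet_derivative_eq)
      (use Suc.prems that in \<open>auto intro!: has_derivative_add simp: frechet_derivative_works[symmetric]\<close>)
  have "Ck_on k S (\<lambda>x. frechet_derivative (\<lambda>x. f x + g x) (at x) v)" for v
    by (subst Ck_on_cong[OF \<open>open S\<close>]) (use Suc d in auto)
  then show ?case using Suc.prems by auto
qed

lemma Ck_on_bilinear:
  assumes "bounded_bilinear B" "open S" "Ck_on k S f" "Ck_on k S g"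
  shows "Ck_on k S (\<lambda>x. B (f x) (g x))"
  using assms(3,4)
proof (induction k arbitrary: f g)
  case 0
  then show ?case by (simp add: bounded_bilinear.continuous_on[OF assms(1)])
next
  case (Suc k)
  have D: "((\<lambda>x. B (f x) (g x)) has_derivative
      (\<lambda>v. B (f x) (frechet_derivative g (at x) v) + B (frechet_derivative f (at x) v) (g x))) (at x)"
    if "x \<in> S" for x
    by (rule bounded_bilinear.FDERIV[OF assms(1)])
      (use Suc.prems that in \<open>auto simp: frechet_derivative_works[symmetric]\<close>)
  \<comment> \<open>Each term of the product rule leaves one factor undifferentiated, so the factors
    themselves are needed at order \<open>k\<close> too.\<close>
  have fg: "Ck_on k S f" "Ck_on k S g" using Suc.prems Ck_on_SucD by blast+
  have "Ck_on k S (\<lambda>x. frechet_derivative (\<lambda>x. B (f x) (g x)) (at x) v)" for v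
    by (subst Ck_on_cong[OF \<open>open S\<close>, OF fun_cong[OF frechet_derivative_eq[OF D]]])
      (use Suc.prems assms(2) in \<open>auto intro!: Ck_on_add Suc.IH fg\<close>)
  then show ?case using D by (auto simp: differentiable_def)
qed

lemma Ck_on_sum:
  assumes "open S" "\<And>i. i \<in> I \<Longrightarrow> Ck_on k S (f i)"
  shows "Ck_on k S (\<lambda>x. \<Sum>i\<in>I. f i x)"
  using assms(2)
proof (induction I rule: infinite_finite_induct)
  case (insert i I)
  then show ?case by (simp, intro Ck_on_add assms(1)) auto
qed (simp_all add: Ck_on_const)

text \<open>\<open>Ck_on\<close> sees derivatives in constant directions only, whereas the chain
  rule evaluates the derivative of \<open>f\<close> in the moving direction given by the derivative
  of \<open>g\<close>. Expanding that direction in the finite basis of the middle space yields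
  coefficients times derivatives of \<open>f\<close> in fixed directions.\<close>

lemma Ck_on_compose:
  fixes g :: "'a::real_normed_vector \<Rightarrow> 'b::euclidean_space" and f :: "'b \<Rightarrow> 'c::real_normed_vector"
  assumes "open S" "open T" "g ` S \<subseteq> T" "Ck_on k S g" "Ck_on k T f"
  shows "Ck_on k S (\<lambda>x. f (g x))"
  using assms(4,5)
proof (induction k arbitrary: f)
  case 0
  then show ?case using assms(3) by (auto intro: continuous_on_compose2)
next
  case (Suc k)
  have D: "((\<lambda>x. f (g x)) has_derivative
      (\<lambda>v. frechet_derivative f (at (g x)) (frechet_derivative g (at x) v))) (at x)"
    if "x \<in> S" for x
    by (rule has_derivative_compose)
      (use Suc.prems that assms(3) in \<open>auto simp: frechet_derivative_works[symmetric] image_subset_iff\<close>)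
  have e: "frechet_derivative (\<lambda>x. f (g x)) (at x) v =
      (\<Sum>b\<in>Basis. (frechet_derivative g (at x) v \<bullet> b) *\<^sub>R frechet_derivative f (at (g x)) b)"
    if "x \<in> S" for x v
  proof -
    have "f differentiable (at (g x))" using Suc.prems that assms(3) by auto
    then have lin: "linear (frechet_derivative f (at (g x)))"
      by (rule linear_frechet_derivative)
    show ?thesis
      unfolding frechet_derivative_eq[OF D[OF that]]
      by (subst euclidean_representation[of "frechet_derivative g (at x) v", symmetric])
        (simp only: linear_sum[OF lin] linear_cmul[OF lin])
  qed
  have g: "Ck_on k S g" using Suc.prems(1) by (rule Ck_on_SucD)
  have "Ck_on k S (\<lambda>x. frechet_derivative (\<lambda>x. f (g x)) (at x) v)" for v
  proof (subst Ck_on_cong[OF \<open>open S\<close> e], assumption)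
    show "Ck_on k S (\<lambda>x. \<Sum>b\<in>Basis. (frechet_derivative g (at x) v \<bullet> b) *\<^sub>R
        frechet_derivative f (at (g x)) b)"
      by (intro Ck_on_sum Ck_on_bilinear[OF bounded_bilinear_scaleR]
          Ck_on_bilinear[OF bounded_bilinear_inner] Ck_on_const \<open>open S\<close> Suc.IH[OF g])
        (use Suc.prems in auto)
  qed
  then show ?case using D by (auto simp: differentiable_def)
qed

lemma Ck_on_bounded_linear:
  assumes "bounded_linear f"
  shows "Ck_on k S f"
proof (cases k)
  case 0
  then show ?thesis using assms by (simp add: linear_continuous_on)
next
  case (Suc j)
  have "frechet_derivative f (at x) = f" for x
    by (intro frechet_derivative_eq bounded_linear_imp_has_derivative assms)
  then show ?thesis
    using Suc by (simp add: Ck_on_const bounded_linear_imp_differentiable[OF assms])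
qed

lemma Ck_on_real_derivative:
  fixes f f' :: "real \<Rightarrow> real"
  assumes "open S" "\<And>x. x \<in> S \<Longrightarrow> (f has_real_derivative f' x) (at x)" "Ck_on k S f'"
  shows "Ck_on (Suc k) S f"
proof -
  have d: "(f has_derivative (\<lambda>v. f' x * v)) (at x)" if "x \<in> S" for x
    using assms(2)[OF that] by (simp add: has_field_derivative_def)
  have "Ck_on k S (\<lambda>x. frechet_derivative f (at x) v)" for v
    by (subst Ck_on_cong[OF assms(1), OF fun_cong[OF frechet_derivative_eq[OF d]]])
      (auto intro: Ck_on_bilinear[OF bounded_bilinear_mult] assms Ck_on_const)
  then show ?thesis using d by (auto simp: differentiable_def)
qed

text \<open>Real exponents make the family closed under differentiation up to constants, so one
  induction with \<open>a\<close> arbitrary covers it. The case \<open>a = - 1 / 2\<close> later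
  normalises vector fields.\<close>

lemma Ck_on_powr: "Ck_on k {0<..} (\<lambda>x::real. x powr a)"
proof (induction k arbitrary: a)
  case 0
  then show ?case by (auto intro!: continuous_intros)
next
  case (Suc k)
  show ?case
    by (rule Ck_on_real_derivative[where f' = "\<lambda>x. a * x powr (a - 1)"])
      (auto intro!: Ck_on_bilinear[OF bounded_bilinear_mult] Suc Ck_on_const has_real_derivative_powr)
qed

section \<open>A smooth cutoff function supported in a ball\<close>

definition flat :: "nat \<Rightarrow> real \<Rightarrow> real" where
  "flat n t = (if t > 0 then exp (- inverse t) * inverse t ^ n else 0)"

lemma flat_tendsto_0: "((\<lambda>t. flat n t) \<longlongrightarrow> 0) (at 0)"
proof -
  have "((\<lambda>x. inverse x ^ n / exp (inverse x)) \<longlongrightarrow> (0::real)) (at_right 0)"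
    by (rule filterlim_compose[OF tendsto_power_div_exp_0 filterlim_inverse_at_top_right])
  then have "((\<lambda>t. flat n t) \<longlongrightarrow> 0) (at_right 0)"
    by (rule Lim_transform_eventually)
      (auto simp: eventually_at_right_field flat_def exp_minus field_simps intro!: exI[of _ 1])
  moreover have "((\<lambda>t. flat n t) \<longlongrightarrow> 0) (at_left 0)"
    by (rule Lim_transform_eventually[OF tendsto_const])
      (auto simp: eventually_at_left_field flat_def intro!: exI[of _ "-1"])
  ultimately show ?thesis by (simp add: filterlim_split_at_real)
qed

text \<open>The factor \<open>inverse t ^ n\<close> makes the family closed under differentiation.
  This is the purpose of the index: smoothness of \<open>flat 0\<close> alone would not be
  inductive.\<close>

lemma flat_deriv:
  "(flat n has_real_derivative flat (n + 2) t - real n * flat (Suc n) t) (at t)"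
proof -
  consider "t < 0" | "t = 0" | "t > 0" by linarith
  then show ?thesis
  proof cases
    case 1
    have "((\<lambda>t. 0) has_real_derivative 0) (at t)" by simp
    then have "(flat n has_real_derivative 0) (at t)"
      by (rule has_field_derivative_transform_within_open[of _ _ _ "{..<0}"])
        (use 1 in \<open>auto simp: flat_def\<close>)
    then show ?thesis using 1 by (simp add: flat_def)
  next
    case 2
    \<comment> \<open>As \<open>flat n 0 = 0\<close>, the difference quotient of
      \<open>flat n\<close> at \<open>0\<close> is \<open>flat (Suc n)\<close>, whose limit is
      known.\<close>
    have "((\<lambda>y. (flat n y - flat n 0) / (y - 0)) \<longlongrightarrow> 0) (at 0)"
      using flat_tendsto_0[of "Suc n"]
      by (rule Lim_transform_eventually) (auto simp: flat_def divide_inverse intro!: always_eventually)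
    then show ?thesis using 2 by (simp add: has_field_derivative_iff flat_def)
  next
    case 3
    have "((\<lambda>t. exp (- inverse t) * inverse t ^ n) has_real_derivative
        flat (n + 2) t - real n * flat (Suc n) t) (at t)"
      using 3 by (auto intro!: derivative_eq_intros simp: flat_def power2_eq_square)
        (cases n; auto simp: field_simps)
    then show ?thesis
      by (rule has_field_derivative_transform_within_open[of _ _ _ "{0<..}"])
        (use 3 in \<open>auto simp: flat_def\<close>)
  qed
qed

lemma Ck_on_flat: "Ck_on k UNIV (flat n)"
proof (induction k arbitrary: n)
  case 0
  show ?case
    using DERIV_continuous[OF flat_deriv] by (auto intro: continuous_at_imp_continuous_on)
next
  case (Suc k)
  have "Ck_on k UNIV (\<lambda>t. flat (n + 2) t + (- real n) * flat (Suc n) t)"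
    by (intro Ck_on_add Ck_on_bilinear[OF bounded_bilinear_mult] Ck_on_const Suc open_UNIV)
  then show ?case
    by (intro Ck_on_real_derivative[OF _ flat_deriv]) simp_all
qed

text \<open>The squared distance, unlike the distance, is smooth at the centre. For
  \<open>r > 0\<close> the argument of \<open>flat 0\<close> is positive exactly in the open
  ball.\<close>

definition bump :: "'e::euclidean_space \<Rightarrow> real \<Rightarrow> 'e \<Rightarrow> real" where
  "bump a r x = flat 0 (r\<^sup>2 - (x - a) \<bullet> (x - a))"

lemma bump_center: "r > 0 \<Longrightarrow> bump a r a > 0"
  by (simp add: bump_def flat_def)

lemma bump_outside: "x \<notin> ball a r \<Longrightarrow> r > 0 \<Longrightarrow> bump a r x = 0"
  using power_mono[of r "norm (x - a)" 2]
  by (simp add: bump_def flat_def dist_norm norm_minus_commute[of a] power2_norm_eq_inner)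

lemma smooth_on_bump: "smooth_on S (bump a r)"
proof -
  have *: "Ck_on k UNIV (\<lambda>x. x + - a)" for k
    by (intro Ck_on_add Ck_on_const Ck_on_bounded_linear bounded_linear_ident open_UNIV)
  have "Ck_on k UNIV (\<lambda>x. r\<^sup>2 + (- 1) * ((x + - a) \<bullet> (x + - a)))" for k
    by (intro Ck_on_add Ck_on_const Ck_on_bilinear[OF bounded_bilinear_mult]
        Ck_on_bilinear[OF bounded_bilinear_inner] * open_UNIV)
  from Ck_on_compose[OF open_UNIV open_UNIV _ this Ck_on_flat]
  have "Ck_on k UNIV (bump a r)" for k by (simp add: bump_def[abs_def])
  then show ?thesis unfolding smooth_on_def using Ck_on_subset by blast
qed

lemma smooth_on_cong:
  "open S \<Longrightarrow> (\<And>x. x \<in> S \<Longrightarrow> f x = g x) \<Longrightarrow> smooth_on S f \<longleftrightarrow> smooth_on S g"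
  unfolding smooth_on_def using Ck_on_cong by blast

lemma smooth_on_subset: "smooth_on S f \<Longrightarrow> T \<subseteq> S \<Longrightarrow> smooth_on T f"
  unfolding smooth_on_def using Ck_on_subset by blast

lemma smooth_on_local:
  assumes "\<And>x. x \<in> S \<Longrightarrow> \<exists>T. open T \<and> x \<in> T \<and> smooth_on T f"
  shows "smooth_on S f"
  unfolding smooth_on_def
proof (intro allI Ck_on_local)
  fix k x assume "x \<in> S"
  then show "\<exists>T. open T \<and> x \<in> T \<and> Ck_on k T f"
    using assms unfolding smooth_on_def by meson
qed

lemma smooth_on_const: "smooth_on S (\<lambda>x. c)"
  by (simp add: smooth_on_def Ck_on_const)

lemma smooth_on_add:
  "open S \<Longrightarrow> smooth_on S f \<Longrightarrow> smooth_on S g \<Longrightarrow> smooth_on S (\<lambda>x. f x + g x)"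
  by (simp add: smooth_on_def Ck_on_add)

lemma smooth_on_mult:
  fixes f g :: "'a::real_normed_vector \<Rightarrow> real"
  shows "open S \<Longrightarrow> smooth_on S f \<Longrightarrow> smooth_on S g \<Longrightarrow> smooth_on S (\<lambda>x. f x * g x)"
  by (simp add: smooth_on_def Ck_on_bilinear[OF bounded_bilinear_mult])

lemma smooth_on_compose:
  fixes g :: "'a::real_normed_vector \<Rightarrow> 'b::euclidean_space"
  shows "open S \<Longrightarrow> open T \<Longrightarrow> g ` S \<subseteq> T \<Longrightarrow> smooth_on S g \<Longrightarrow> smooth_on T f \<Longrightarrow>
    smooth_on S (\<lambda>x. f (g x))"
  unfolding smooth_on_def using Ck_on_compose by blast

lemma smooth_on_bounded_linear: "bounded_linear f \<Longrightarrow> smooth_on S f"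
  by (simp add: smooth_on_def Ck_on_bounded_linear)

lemma smooth_on_powr: "smooth_on {0<..} (\<lambda>x::real. x powr a)"
  by (simp add: smooth_on_def Ck_on_powr)

lemma smooth_on_imp_differentiable: "smooth_on S f \<Longrightarrow> x \<in> S \<Longrightarrow> f differentiable (at x)"
  unfolding smooth_on_def by (metis Ck_on.simps(2))

lemma smooth_on_imp_continuous_on: "smooth_on S f \<Longrightarrow> continuous_on S f"
  unfolding smooth_on_def by (metis Ck_on.simps(1))

lemma smooth_on_frechet_derivative:
  "smooth_on S f \<Longrightarrow> smooth_on S (\<lambda>x. frechet_derivative f (at x) v)"
  unfolding smooth_on_def by (metis Ck_on.simps(2))


section \<open>Tangent vectors and vector fields on a manifold\<close>

lemma vscale_apply: "(a \<cdot>\<^sub>v v) f = a * v f"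
  by (simp add: vscale_def)

lemma sum_tvec_apply: "(\<Sum>i\<in>I. V i) f = (\<Sum>i\<in>I. V i f)" for V :: "'i \<Rightarrow> 'a tvec"
  by (induction I rule: infinite_finite_induct) simp_all

lemmas tvec_apply = vscale_apply sum_tvec_apply plus_fun_apply zero_fun_apply minus_apply uminus_apply

lemma vscale_simps [simp]:
  "0 \<cdot>\<^sub>v v = 0" "1 \<cdot>\<^sub>v v = v" "a \<cdot>\<^sub>v (0 :: 'a tvec) = 0" "a \<cdot>\<^sub>v b \<cdot>\<^sub>v v = (a * b) \<cdot>\<^sub>v v"
  by (auto simp: fun_eq_iff tvec_apply)

lemma vscale_algebra:
  "a \<cdot>\<^sub>v (u + v) = a \<cdot>\<^sub>v u + a \<cdot>\<^sub>v v" "a \<cdot>\<^sub>v (u - v) = a \<cdot>\<^sub>v u - a \<cdot>\<^sub>v v"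
  "(a + b) \<cdot>\<^sub>v u = a \<cdot>\<^sub>v u + b \<cdot>\<^sub>v u" "(a - b) \<cdot>\<^sub>v u = a \<cdot>\<^sub>v u - b \<cdot>\<^sub>v u"
  by (auto simp: fun_eq_iff tvec_apply algebra_simps)

lemma vscale_sum: "a \<cdot>\<^sub>v (\<Sum>i\<in>I. V i) = (\<Sum>i\<in>I. a \<cdot>\<^sub>v V i)"
  by (auto simp: fun_eq_iff tvec_apply sum_distrib_left)

lemma vscale_sum_left: "(\<Sum>i\<in>I. a i) \<cdot>\<^sub>v v = (\<Sum>i\<in>I. a i \<cdot>\<^sub>v v)"
  by (auto simp: fun_eq_iff tvec_apply sum_distrib_right)

text \<open>The components of a tangent vector are its values on the coordinate functions, so
  \<open>coord \<psi>\<close> inverts \<open>chart_vec M (U, \<psi>) p\<close> on the tangent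
  space.\<close>

definition coord :: "('a \<Rightarrow> 'e::euclidean_space) \<Rightarrow> 'a tvec \<Rightarrow> 'e" where
  "coord \<psi> v = (\<Sum>b\<in>Basis. v (\<lambda>q. \<psi> q \<bullet> b) *\<^sub>R b)"

locale smooth_mfd =
  fixes M :: "('a, 'e::euclidean_space) manifold"
  assumes smooth_manifold: "smooth_manifold M"
begin

section \<open>Charts and their topology\<close>

lemma chart_open: "(U, \<psi>) \<in> atlas M \<Longrightarrow> openin (mtop M) U"
  and chart_open_image: "(U, \<psi>) \<in> atlas M \<Longrightarrow> open (\<psi> ` U)"
  and chart_homeomorphic:
    "(U, \<psi>) \<in> atlas M \<Longrightarrow> homeomorphic_map (subtopology (mtop M) U) (top_of_set (\<psi> ` U)) \<psi>"
  using smooth_manifold by (auto simp: smooth_manifold_def is_chart_def)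

lemma chart_subset: "(U, \<psi>) \<in> atlas M \<Longrightarrow> U \<subseteq> topspace (mtop M)"
  using chart_open openin_subset by blast

lemma chart_at:
  assumes "p \<in> topspace (mtop M)" obtains U \<psi> where "(U, \<psi>) \<in> atlas M" "p \<in> U"
  using smooth_manifold assms unfolding smooth_manifold_def by blast

lemma chart_inj: "(U, \<psi>) \<in> atlas M \<Longrightarrow> inj_on \<psi> U"
  using homeomorphic_imp_injective_map[OF chart_homeomorphic] chart_subset
  by (metis inf.absorb2 topspace_subtopology)

lemma chart_inv: "(U, \<psi>) \<in> atlas M \<Longrightarrow> q \<in> U \<Longrightarrow> inv_into U \<psi> (\<psi> q) = q"
  using chart_inj by simp

lemma chart_image_open:
  assumes "(U, \<psi>) \<in> atlas M" "openin (mtop M) W"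
  shows "open (\<psi> ` (U \<inter> W))"
proof -
  have "openin (subtopology (mtop M) U) (U \<inter> W)"
    using assms(2) by (simp add: openin_subtopology_Int2)
  then have "openin (top_of_set (\<psi> ` U)) (\<psi> ` (U \<inter> W))"
    using homeomorphic_imp_open_map[OF chart_homeomorphic[OF assms(1)]] by (simp add: open_map_def)
  then show ?thesis
    using chart_open_image[OF assms(1)] openin_open_trans by blast
qed

lemma chart_vimage_open:
  assumes "(U, \<psi>) \<in> atlas M" "open S"
  shows "openin (mtop M) {q \<in> U. \<psi> q \<in> S}"
proof -
  have "continuous_map (subtopology (mtop M) U) (top_of_set (\<psi> ` U)) \<psi>"
    using chart_homeomorphic[OF assms(1)] homeomorphic_imp_continuous_map by blast
  moreover have "openin (top_of_set (\<psi> ` U)) (\<psi> ` U \<inter> S)"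
    using assms(2) by (simp add: openin_open_Int)
  ultimately have "openin (subtopology (mtop M) U)
      {q \<in> topspace (subtopology (mtop M) U). \<psi> q \<in> \<psi> ` U \<inter> S}"
    by (rule openin_continuous_map_preimage)
  moreover have "{q \<in> topspace (subtopology (mtop M) U). \<psi> q \<in> \<psi> ` U \<inter> S} = {q \<in> U. \<psi> q \<in> S}"
    using chart_subset[OF assms(1)] by auto
  ultimately show ?thesis
    using chart_open[OF assms(1)] by (simp add: openin_open_subtopology)
qed

lemma transition_smooth:
  "(U, \<psi>) \<in> atlas M \<Longrightarrow> (V, \<theta>) \<in> atlas M \<Longrightarrow> smooth_on (\<psi> ` (U \<inter> V)) (\<theta> \<circ> inv_into U \<psi>)"
  using smooth_manifold by (auto simp: smooth_manifold_def)

section \<open>Smooth functions on a manifold\<close>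

lemma smooth_fun_onI:
  "(\<And>U \<psi>. (U, \<psi>) \<in> atlas M \<Longrightarrow> smooth_on (\<psi> ` (U \<inter> W)) (\<lambda>x. f (inv_into U \<psi> x))) \<Longrightarrow>
    smooth_fun_on M W f"
  by (auto simp: smooth_fun_on_def comp_def)

lemma smooth_fun_onD:
  "smooth_fun_on M W f \<Longrightarrow> (U, \<psi>) \<in> atlas M \<Longrightarrow> smooth_on (\<psi> ` (U \<inter> W)) (\<lambda>x. f (inv_into U \<psi> x))"
  by (auto simp: smooth_fun_on_def comp_def)

lemma smooth_fun_on_cong:
  assumes "openin (mtop M) W" "\<And>q. q \<in> W \<Longrightarrow> f q = g q"
  shows "smooth_fun_on M W f \<longleftrightarrow> smooth_fun_on M W g"
proof -
  have "smooth_on (\<psi> ` (U \<inter> W)) (\<lambda>x. f (inv_into U \<psi> x)) \<longleftrightarrow>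
      smooth_on (\<psi> ` (U \<inter> W)) (\<lambda>x. g (inv_into U \<psi> x))" if c: "(U, \<psi>) \<in> atlas M" for U \<psi>
    by (rule smooth_on_cong[OF chart_image_open[OF c assms(1)]])
      (use assms(2) chart_inv[OF c] in auto)
  then show ?thesis by (auto simp: smooth_fun_on_def comp_def)
qed

lemma smooth_fun_on_subset: "smooth_fun_on M W f \<Longrightarrow> W' \<subseteq> W \<Longrightarrow> smooth_fun_on M W' f"
  by (rule smooth_fun_onI) (metis Int_mono image_mono order_refl smooth_fun_onD smooth_on_subset)

lemma smooth_fun_on_local:
  assumes "\<And>p. p \<in> W \<Longrightarrow> \<exists>W'. openin (mtop M) W' \<and> p \<in> W' \<and> smooth_fun_on M W' f"
  shows "smooth_fun_on M W f"
proof (intro smooth_fun_onI smooth_on_local)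
  fix U \<psi> x assume c: "(U, \<psi>) \<in> atlas M" and "x \<in> \<psi> ` (U \<inter> W)"
  then obtain q where q: "q \<in> U" "q \<in> W" "x = \<psi> q" by blast
  then obtain W' where "openin (mtop M) W'" "q \<in> W'" "smooth_fun_on M W' f" using assms by blast
  then show "\<exists>T. open T \<and> x \<in> T \<and> smooth_on T (\<lambda>x. f (inv_into U \<psi> x))"
    using q c by (intro exI[of _ "\<psi> ` (U \<inter> W')"]) (auto simp: chart_image_open smooth_fun_onD)
qed

lemma smooth_fun_on_const: "smooth_fun_on M W (\<lambda>q. c)"
  by (intro smooth_fun_onI smooth_on_const)

lemma smooth_fun_on_add:
  "openin (mtop M) W \<Longrightarrow> smooth_fun_on M W f \<Longrightarrow> smooth_fun_on M W g \<Longrightarrow>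
    smooth_fun_on M W (\<lambda>q. f q + g q)"
  by (rule smooth_fun_onI) (auto intro!: smooth_on_add chart_image_open dest: smooth_fun_onD)

lemma smooth_fun_on_mult:
  "openin (mtop M) W \<Longrightarrow> smooth_fun_on M W f \<Longrightarrow> smooth_fun_on M W g \<Longrightarrow>
    smooth_fun_on M W (\<lambda>q. f q * g q)"
  by (rule smooth_fun_onI) (auto intro!: smooth_on_mult chart_image_open dest: smooth_fun_onD)

lemma smooth_fun_on_compose:
  assumes "openin (mtop M) W" "smooth_fun_on M W f" "open S" "f ` W \<subseteq> S" "smooth_on S F"
  shows "smooth_fun_on M W (\<lambda>q. F (f q))"
proof (intro smooth_fun_onI)
  fix U \<psi> assume c: "(U, \<psi>) \<in> atlas M"
  show "smooth_on (\<psi> ` (U \<inter> W)) (\<lambda>x. F (f (inv_into U \<psi> x)))"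
    by (rule smooth_on_compose[OF chart_image_open[OF c assms(1)] assms(3) _ smooth_fun_onD[OF assms(2) c] assms(5)])
      (use assms(4) chart_inv[OF c] in auto)
qed

lemma smooth_fun_on_chart:
  assumes c: "(U, \<psi>) \<in> atlas M" and W: "openin (mtop M) W" "W \<subseteq> U"
    and S: "open S" "\<psi> ` W \<subseteq> S" "smooth_on S F"
  shows "smooth_fun_on M W (\<lambda>q. F (\<psi> q))"
proof (intro smooth_fun_onI)
  fix V \<theta> assume d: "(V, \<theta>) \<in> atlas M"
  have t: "smooth_on (\<theta> ` (V \<inter> W)) (\<lambda>x. \<psi> (inv_into V \<theta> x))"
    using smooth_on_subset[OF transition_smooth[OF d c], of "\<theta> ` (V \<inter> W)"] W(2) by (auto simp: comp_def)
  show "smooth_on (\<theta> ` (V \<inter> W)) (\<lambda>x. F (\<psi> (inv_into V \<theta> x)))"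
    by (rule smooth_on_compose[OF chart_image_open[OF d W(1)] S(1) _ t S(3)])
      (use S(2) chart_inv[OF d] in auto)
qed

lemma smooth_fun_on_coordinate:
  assumes c: "(U, \<psi>) \<in> atlas M"
  shows "smooth_fun_on M U (\<lambda>q. \<psi> q \<bullet> b)"
  using smooth_fun_on_chart[OF c chart_open[OF c] subset_refl open_UNIV subset_UNIV
      smooth_on_bounded_linear[OF bounded_linear_inner_left]] .

text \<open>Serves to shrink a neighbourhood to where a squared length is positive. Continuity is
  available only in charts, so openness is shown in a chart image and pulled back.\<close>

lemma openin_positive:
  assumes W: "openin (mtop M) W" and f: "smooth_fun_on M W f"
  shows "openin (mtop M) {q \<in> W. f q > 0}"
proof (subst openin_subopen, safe)
  fix p assume p: "p \<in> W" "f p > 0"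
  then have "p \<in> topspace (mtop M)" using W openin_subset by blast
  then obtain U \<psi> where c: "(U, \<psi>) \<in> atlas M" "p \<in> U" by (rule chart_at)
  let ?S = "{x \<in> \<psi> ` (U \<inter> W). f (inv_into U \<psi> x) > 0}"
  have "continuous_on (\<psi> ` (U \<inter> W)) (\<lambda>x. f (inv_into U \<psi> x))"
    using smooth_fun_onD[OF f c(1)] by (rule smooth_on_imp_continuous_on)
  have "open ({x \<in> \<psi> ` (U \<inter> W). f (inv_into U \<psi> x) \<in> {0<..}})"
    using continuous_open_preimage[OF \<open>continuous_on _ _\<close> chart_image_open[OF c(1) W], of "{0<..}"]
    by (simp add: vimage_def Int_def)
  then have "open ?S" by simp
  then have T: "openin (mtop M) {q \<in> U. \<psi> q \<in> ?S}" by (rule chart_vimage_open[OF c(1)])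
  have sub: "q \<in> W \<and> f q > 0" if q: "q \<in> U" "\<psi> q \<in> ?S" for q
  proof -
    obtain q' where q': "q' \<in> U" "q' \<in> W" "\<psi> q = \<psi> q'" using q(2) by fast
    have "q = q'" using inj_onD[OF chart_inj[OF c(1)] q'(3) q(1) q'(1)] .
    then show ?thesis using q q'(2) by (simp add: chart_inv[OF c(1)])
  qed
  have "\<psi> p \<in> \<psi> ` (U \<inter> W)" using p(1) c(2) by blast
  then have "p \<in> {q \<in> U. \<psi> q \<in> ?S}" using p c by (simp add: chart_inv[OF c(1)])
  moreover have "{q \<in> U. \<psi> q \<in> ?S} \<subseteq> {q \<in> W. f q > 0}" using sub by blast
  ultimately show "\<exists>T. openin (mtop M) T \<and> p \<in> T \<and> T \<subseteq> {q \<in> W. f q > 0}" using T by meson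
qed

section \<open>Functions smooth near a point\<close>

lemma smooth_nearI: "openin (mtop M) W \<Longrightarrow> p \<in> W \<Longrightarrow> smooth_fun_on M W f \<Longrightarrow> smooth_near M p f"
  by (auto simp: smooth_near_def)

lemma smooth_near_const: "p \<in> topspace (mtop M) \<Longrightarrow> smooth_near M p (\<lambda>q. c)"
  by (rule smooth_nearI[OF openin_topspace _ smooth_fun_on_const])

lemma smooth_near_common:
  assumes "smooth_near M p f" "smooth_near M p g"
  obtains W where "openin (mtop M) W" "p \<in> W" "smooth_fun_on M W f" "smooth_fun_on M W g"
proof -
  obtain W W' where "openin (mtop M) W" "p \<in> W" "smooth_fun_on M W f"
    "openin (mtop M) W'" "p \<in> W'" "smooth_fun_on M W' g"
    using assms unfolding smooth_near_def by blast
  then show ?thesis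
    using that[of "W \<inter> W'"] by (auto intro: openin_Int smooth_fun_on_subset)
qed

lemma smooth_near_add:
  "smooth_near M p f \<Longrightarrow> smooth_near M p g \<Longrightarrow> smooth_near M p (\<lambda>q. f q + g q)"
  by (erule (1) smooth_near_common) (auto intro: smooth_nearI smooth_fun_on_add)

lemma smooth_near_mult:
  "smooth_near M p f \<Longrightarrow> smooth_near M p g \<Longrightarrow> smooth_near M p (\<lambda>q. f q * g q)"
  by (erule (1) smooth_near_common) (auto intro: smooth_nearI smooth_fun_on_mult)

lemma smooth_near_sum:
  "p \<in> topspace (mtop M) \<Longrightarrow> (\<And>i. i \<in> I \<Longrightarrow> smooth_near M p (f i)) \<Longrightarrow>
    smooth_near M p (\<lambda>q. \<Sum>i\<in>I. f i q)"
  by (induction I rule: infinite_finite_induct) (simp_all add: smooth_near_add smooth_near_const)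

text \<open>Tangent vectors take the default value \<open>0\<close> on functions that are not smooth
  near the point. For them to be local operators, smoothness near the point must itself be a local
  property.\<close>

lemma smooth_near_cong:
  assumes "openin (mtop M) W" "p \<in> W" "\<And>q. q \<in> W \<Longrightarrow> f q = g q"
  shows "smooth_near M p f \<longleftrightarrow> smooth_near M p g"
proof -
  have "smooth_near M p g" if sn: "smooth_near M p f" and eq: "\<And>q. q \<in> W \<Longrightarrow> f q = g q" for f g
  proof -
    obtain W' where W': "openin (mtop M) W'" "p \<in> W'" "smooth_fun_on M W' f"
      using sn unfolding smooth_near_def by blast
    then have "smooth_fun_on M (W \<inter> W') f" by (auto intro: smooth_fun_on_subset)
    then have "smooth_fun_on M (W \<inter> W') g"
      using eq assms(1) W' by (subst (asm) smooth_fun_on_cong[of _ f g]) (auto intro: openin_Int)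
    then show ?thesis using W' assms(1,2) by (auto intro!: smooth_nearI[of "W \<inter> W'"] openin_Int)
  qed
  from this[of f g] this[of g f] assms(3) show ?thesis by auto
qed

lemma smooth_near_differentiable:
  assumes "(U, \<psi>) \<in> atlas M" "p \<in> U" "smooth_near M p f"
  shows "(f \<circ> inv_into U \<psi>) differentiable (at (\<psi> p))"
proof -
  obtain W where "openin (mtop M) W" "p \<in> W" "smooth_fun_on M W f"
    using assms(3) unfolding smooth_near_def by blast
  then show ?thesis
    using smooth_on_imp_differentiable[OF smooth_fun_onD[OF _ assms(1)]] assms(2)
    by (auto simp: comp_def)
qed

section \<open>Tangent spaces in coordinates\<close>

lemma chart_vec_apply:
  "smooth_near M p f \<Longrightarrow>
    chart_vec M (U, \<psi>) p \<xi> f = frechet_derivative (f \<circ> inv_into U \<psi>) (at (\<psi> p)) \<xi>"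
  by (simp add: chart_vec_def)

lemma chart_vec_not_smooth: "\<not> smooth_near M p f \<Longrightarrow> chart_vec M c p \<xi> f = 0"
  by (simp add: chart_vec_def split: prod.splits)

lemma chart_vec_in_tangent: "(U, \<psi>) \<in> atlas M \<Longrightarrow> p \<in> U \<Longrightarrow> chart_vec M (U, \<psi>) p \<xi> \<in> tangent_space M p"
  unfolding tangent_space_def by force

text \<open>The chain rule for the transition map. \<open>tangent_space\<close> collects vectors
  from all charts around the point; converting components shows that one chart already provides all
  of them.\<close>

lemma chart_change:
  assumes c: "(U, \<psi>) \<in> atlas M" "p \<in> U" and d: "(V, \<theta>) \<in> atlas M" "p \<in> V"
  shows "chart_vec M (V, \<theta>) p \<eta> =
    chart_vec M (U, \<psi>) p (frechet_derivative (\<psi> \<circ> inv_into V \<theta>) (at (\<theta> p)) \<eta>)"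
proof
  fix f
  show "chart_vec M (V, \<theta>) p \<eta> f =
    chart_vec M (U, \<psi>) p (frechet_derivative (\<psi> \<circ> inv_into V \<theta>) (at (\<theta> p)) \<eta>) f"
  proof (cases "smooth_near M p f")
    case True
    let ?F = "f \<circ> inv_into U \<psi>" and ?t = "\<psi> \<circ> inv_into V \<theta>"
    have tp: "?t (\<theta> p) = \<psi> p" using d chart_inv by simp
    have dt: "?t differentiable (at (\<theta> p))"
      using smooth_on_imp_differentiable[OF transition_smooth[OF d(1) c(1)]] c d by blast
    have dF: "?F differentiable (at (?t (\<theta> p)))"
      unfolding tp by (rule smooth_near_differentiable[OF c True])
    have D: "((\<lambda>x. ?F (?t x)) has_derivative
        (\<lambda>v. frechet_derivative ?F (at (?t (\<theta> p))) (frechet_derivative ?t (at (\<theta> p)) v))) (at (\<theta> p))"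
      using dt dF unfolding frechet_derivative_works by (rule has_derivative_compose)
    have "frechet_derivative (f \<circ> inv_into V \<theta>) (at (\<theta> p)) =
        frechet_derivative (\<lambda>x. ?F (?t x)) (at (\<theta> p))"
      by (rule frechet_derivative_cong_open(2)[of "\<theta> ` (V \<inter> U)"])
        (use c d chart_inv in \<open>auto simp: chart_image_open chart_open\<close>)
    then show ?thesis
      by (simp only: chart_vec_apply[OF True] frechet_derivative_eq[OF D] tp)
  qed (simp add: chart_vec_not_smooth)
qed

lemma tangent_space_eq:
  assumes "(U, \<psi>) \<in> atlas M" "p \<in> U"
  shows "tangent_space M p = range (chart_vec M (U, \<psi>) p)"
proof
  show "tangent_space M p \<subseteq> range (chart_vec M (U, \<psi>) p)"
    unfolding tangent_space_def using chart_change[OF assms] by auto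
qed (use chart_vec_in_tangent[OF assms] in blast)

lemma chart_vec_linear:
  assumes c: "(U, \<psi>) \<in> atlas M" "p \<in> U"
  shows "chart_vec M (U, \<psi>) p (\<xi> + \<eta>) = chart_vec M (U, \<psi>) p \<xi> + chart_vec M (U, \<psi>) p \<eta>"
    and "chart_vec M (U, \<psi>) p (a *\<^sub>R \<xi>) = a \<cdot>\<^sub>v chart_vec M (U, \<psi>) p \<xi>"
    and "chart_vec M (U, \<psi>) p 0 = 0"
proof -
  have lin: "linear (frechet_derivative (f \<circ> inv_into U \<psi>) (at (\<psi> p)))" if "smooth_near M p f" for f
    using smooth_near_differentiable[OF c that] by (rule linear_frechet_derivative)
  have "chart_vec M (U, \<psi>) p (\<xi> + \<eta>) f = (chart_vec M (U, \<psi>) p \<xi> + chart_vec M (U, \<psi>) p \<eta>) f" for f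
    by (cases "smooth_near M p f")
      (simp_all add: chart_vec_apply chart_vec_not_smooth tvec_apply linear_add[OF lin])
  then show "chart_vec M (U, \<psi>) p (\<xi> + \<eta>) = chart_vec M (U, \<psi>) p \<xi> + chart_vec M (U, \<psi>) p \<eta>" by blast
  have scale: "chart_vec M (U, \<psi>) p (a *\<^sub>R \<xi>) f = (a \<cdot>\<^sub>v chart_vec M (U, \<psi>) p \<xi>) f" for f a
    by (cases "smooth_near M p f")
      (simp_all add: chart_vec_apply chart_vec_not_smooth tvec_apply linear_cmul[OF lin])
  then show "chart_vec M (U, \<psi>) p (a *\<^sub>R \<xi>) = a \<cdot>\<^sub>v chart_vec M (U, \<psi>) p \<xi>" by blast
  show "chart_vec M (U, \<psi>) p 0 = 0" using scale[of 0] by (auto simp: fun_eq_iff tvec_apply)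
qed

lemma chart_vec_sum:
  assumes c: "(U, \<psi>) \<in> atlas M" "p \<in> U"
  shows "chart_vec M (U, \<psi>) p (\<Sum>i\<in>I. a i *\<^sub>R \<xi> i) = (\<Sum>i\<in>I. a i \<cdot>\<^sub>v chart_vec M (U, \<psi>) p (\<xi> i))"
  by (induction I rule: infinite_finite_induct) (simp_all add: chart_vec_linear[OF c])

lemma smooth_near_coordinate:
  "(U, \<psi>) \<in> atlas M \<Longrightarrow> p \<in> U \<Longrightarrow> smooth_near M p (\<lambda>q. \<psi> q \<bullet> b)"
  by (rule smooth_nearI[OF chart_open _ smooth_fun_on_coordinate])

lemma chart_vec_coordinate:
  assumes c: "(U, \<psi>) \<in> atlas M" "p \<in> U"
  shows "chart_vec M (U, \<psi>) p \<xi> (\<lambda>q. \<psi> q \<bullet> b) = \<xi> \<bullet> b"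
proof -
  have "frechet_derivative ((\<lambda>q. \<psi> q \<bullet> b) \<circ> inv_into U \<psi>) (at (\<psi> p)) =
      frechet_derivative (\<lambda>x. x \<bullet> b) (at (\<psi> p))"
    by (rule frechet_derivative_cong_open(2)[OF chart_open_image[OF c(1)]])
      (use c in \<open>auto simp: f_inv_into_f\<close>)
  also have "\<dots> = (\<lambda>x. x \<bullet> b)"
    by (intro frechet_derivative_eq bounded_linear_imp_has_derivative bounded_linear_inner_left)
  finally show ?thesis by (simp add: chart_vec_apply smooth_near_coordinate[OF c])
qed

lemma coord_chart_vec:
  assumes c: "(U, \<psi>) \<in> atlas M" "p \<in> U"
  shows "coord \<psi> (chart_vec M (U, \<psi>) p \<xi>) = \<xi>"
  by (simp add: coord_def chart_vec_coordinate[OF c] euclidean_representation)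

lemma chart_vec_coord:
  assumes c: "(U, \<psi>) \<in> atlas M" "p \<in> U" and "v \<in> tangent_space M p"
  shows "chart_vec M (U, \<psi>) p (coord \<psi> v) = v"
  using assms(3) unfolding tangent_space_eq[OF c] by (auto simp: coord_chart_vec[OF c])

text \<open>The values on coordinate functions are the components in the chart, hence they separate
  tangent vectors.\<close>

lemma tangent_eqI:
  assumes c: "(U, \<psi>) \<in> atlas M" "p \<in> U" and "u \<in> tangent_space M p" "v \<in> tangent_space M p"
    and "\<And>b. b \<in> Basis \<Longrightarrow> u (\<lambda>q. \<psi> q \<bullet> b) = v (\<lambda>q. \<psi> q \<bullet> b)"
  shows "u = v"
proof -
  have "coord \<psi> u = coord \<psi> v" unfolding coord_def using assms(5) by simp
  then show ?thesis using chart_vec_coord[OF c] assms(3,4) by metis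
qed

lemma tangent_expand:
  assumes c: "(U, \<psi>) \<in> atlas M" "p \<in> U" and v: "v \<in> tangent_space M p"
  shows "v = (\<Sum>b\<in>Basis. v (\<lambda>q. \<psi> q \<bullet> b) \<cdot>\<^sub>v chart_vec M (U, \<psi>) p b)"
proof -
  have "v = chart_vec M (U, \<psi>) p (coord \<psi> v)" by (simp add: chart_vec_coord assms)
  then show ?thesis unfolding coord_def chart_vec_sum[OF c] .
qed

lemma tangent_point: "v \<in> tangent_space M p \<Longrightarrow> p \<in> topspace (mtop M)"
  unfolding tangent_space_def using chart_subset by fastforce

lemma tangentE:
  assumes "v \<in> tangent_space M p"
  obtains U \<psi> \<xi> where "(U, \<psi>) \<in> atlas M" "p \<in> U" "v = chart_vec M (U, \<psi>) p \<xi>"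
  using assms unfolding tangent_space_def by force

lemma tangent_zero: "p \<in> topspace (mtop M) \<Longrightarrow> 0 \<in> tangent_space M p"
  by (metis chart_at chart_vec_in_tangent chart_vec_linear(3))

lemma tangent_add:
  assumes "u \<in> tangent_space M p" "v \<in> tangent_space M p"
  shows "u + v \<in> tangent_space M p"
proof -
  obtain U \<psi> \<xi> where c: "(U, \<psi>) \<in> atlas M" "p \<in> U" and u: "u = chart_vec M (U, \<psi>) p \<xi>"
    using assms(1) by (rule tangentE)
  moreover obtain \<eta> where "v = chart_vec M (U, \<psi>) p \<eta>"
    using assms(2) unfolding tangent_space_eq[OF c] by blast
  ultimately show ?thesis
    using chart_vec_in_tangent[OF c] by (simp flip: chart_vec_linear(1)[OF c])
qed

lemma tangent_vscale:
  assumes "v \<in> tangent_space M p"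
  shows "a \<cdot>\<^sub>v v \<in> tangent_space M p"
proof -
  obtain U \<psi> \<xi> where c: "(U, \<psi>) \<in> atlas M" "p \<in> U" and v: "v = chart_vec M (U, \<psi>) p \<xi>"
    using assms by (rule tangentE)
  then show ?thesis
    using chart_vec_in_tangent[OF c] by (simp flip: chart_vec_linear(2)[OF c])
qed

lemma tangent_diff:
  assumes "u \<in> tangent_space M p" "v \<in> tangent_space M p"
  shows "u - v \<in> tangent_space M p"
proof -
  have "u - v = u + (-1) \<cdot>\<^sub>v v" by (auto simp: fun_eq_iff tvec_apply)
  then show ?thesis using assms by (metis tangent_add tangent_vscale)
qed

lemma tangent_sum:
  "p \<in> topspace (mtop M) \<Longrightarrow> (\<And>i. i \<in> I \<Longrightarrow> V i \<in> tangent_space M p) \<Longrightarrow>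
    (\<Sum>i\<in>I. V i) \<in> tangent_space M p"
  by (induction I rule: infinite_finite_induct) (simp_all add: tangent_add tangent_zero)

section \<open>Tangent vectors as local derivations\<close>

lemma tangent_apply_add:
  assumes v: "v \<in> tangent_space M p" and f: "smooth_near M p f" and g: "smooth_near M p g"
  shows "v (\<lambda>q. f q + g q) = v f + v g"
proof -
  obtain U \<psi> \<xi> where c: "(U, \<psi>) \<in> atlas M" "p \<in> U" and ve: "v = chart_vec M (U, \<psi>) p \<xi>"
    using v by (rule tangentE)
  have "frechet_derivative (\<lambda>x. (f \<circ> inv_into U \<psi>) x + (g \<circ> inv_into U \<psi>) x) (at (\<psi> p)) =
      (\<lambda>w. frechet_derivative (f \<circ> inv_into U \<psi>) (at (\<psi> p)) w +
        frechet_derivative (g \<circ> inv_into U \<psi>) (at (\<psi> p)) w)"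
    by (intro frechet_derivative_eq has_derivative_add frechet_derivative_works[THEN iffD1]
        smooth_near_differentiable[OF c] f g)
  moreover have "(\<lambda>q. f q + g q) \<circ> inv_into U \<psi> = (\<lambda>x. (f \<circ> inv_into U \<psi>) x + (g \<circ> inv_into U \<psi>) x)"
    by auto
  ultimately show ?thesis by (simp add: ve chart_vec_apply f g smooth_near_add del: comp_apply)
qed

lemma tangent_apply_mult:
  assumes v: "v \<in> tangent_space M p" and f: "smooth_near M p f" and g: "smooth_near M p g"
  shows "v (\<lambda>q. f q * g q) = f p * v g + v f * g p"
proof -
  obtain U \<psi> \<xi> where c: "(U, \<psi>) \<in> atlas M" "p \<in> U" and ve: "v = chart_vec M (U, \<psi>) p \<xi>"
    using v by (rule tangentE)
  have "frechet_derivative (\<lambda>x. (f \<circ> inv_into U \<psi>) x * (g \<circ> inv_into U \<psi>) x) (at (\<psi> p)) =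
      (\<lambda>w. (f \<circ> inv_into U \<psi>) (\<psi> p) * frechet_derivative (g \<circ> inv_into U \<psi>) (at (\<psi> p)) w +
        frechet_derivative (f \<circ> inv_into U \<psi>) (at (\<psi> p)) w * (g \<circ> inv_into U \<psi>) (\<psi> p))"
    by (intro frechet_derivative_eq has_derivative_mult frechet_derivative_works[THEN iffD1]
        smooth_near_differentiable[OF c] f g)
  moreover have "(\<lambda>q. f q * g q) \<circ> inv_into U \<psi> = (\<lambda>x. (f \<circ> inv_into U \<psi>) x * (g \<circ> inv_into U \<psi>) x)"
    by auto
  moreover have "(f \<circ> inv_into U \<psi>) (\<psi> p) = f p" "(g \<circ> inv_into U \<psi>) (\<psi> p) = g p"
    using c chart_inv by auto
  ultimately show ?thesis by (simp add: ve chart_vec_apply f g smooth_near_mult del: comp_apply)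
qed

lemma tangent_apply_const:
  assumes "v \<in> tangent_space M p"
  shows "v (\<lambda>q. c) = 0"
proof -
  have p: "p \<in> topspace (mtop M)" using assms by (rule tangent_point)
  obtain U \<psi> \<xi> where c: "(U, \<psi>) \<in> atlas M" "p \<in> U" and ve: "v = chart_vec M (U, \<psi>) p \<xi>"
    using assms by (rule tangentE)
  have "frechet_derivative ((\<lambda>q. c) \<circ> inv_into U \<psi>) (at (\<psi> p)) = (\<lambda>w. 0)"
    by (rule frechet_derivative_eq) (simp add: comp_def)
  then show ?thesis by (simp add: ve chart_vec_apply smooth_near_const[OF p])
qed

lemma tangent_apply_sum:
  assumes "v \<in> tangent_space M p" "\<And>i. i \<in> I \<Longrightarrow> smooth_near M p (f i)"
  shows "v (\<lambda>q. \<Sum>i\<in>I. f i q) = (\<Sum>i\<in>I. v (f i))"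
  using assms(2)
  by (induction I rule: infinite_finite_induct)
    (simp_all add: tangent_apply_const[OF assms(1)] tangent_apply_add[OF assms(1)]
      smooth_near_sum tangent_point[OF assms(1)])

text \<open>If the functions are smooth near \<open>p\<close>, their chart expressions have the same
  derivative; otherwise both values are the default \<open>0\<close>.\<close>

lemma tangent_apply_cong:
  assumes v: "v \<in> tangent_space M p" and W: "openin (mtop M) W" "p \<in> W" "\<And>q. q \<in> W \<Longrightarrow> f q = g q"
  shows "v f = v g"
proof -
  obtain U \<psi> \<xi> where c: "(U, \<psi>) \<in> atlas M" "p \<in> U" and ve: "v = chart_vec M (U, \<psi>) p \<xi>"
    using v by (rule tangentE)
  have "frechet_derivative (f \<circ> inv_into U \<psi>) (at (\<psi> p)) = frechet_derivative (g \<circ> inv_into U \<psi>) (at (\<psi> p))"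
    by (rule frechet_derivative_cong_open(2)[of "\<psi> ` (U \<inter> W)"])
      (use c W chart_inv in \<open>auto simp: chart_image_open\<close>)
  then show ?thesis
    using smooth_near_cong[OF W] by (cases "smooth_near M p f") (auto simp: ve chart_vec_apply chart_vec_not_smooth)
qed

section \<open>Smooth vector fields\<close>

lemma vector_fields_tangent: "X \<in> vector_fields M W \<Longrightarrow> p \<in> W \<Longrightarrow> X p \<in> tangent_space M p"
  by (simp add: vector_fields_def)

lemma vector_fields_smooth:
  "X \<in> vector_fields M W \<Longrightarrow> openin (mtop M) W' \<Longrightarrow> W' \<subseteq> W \<Longrightarrow> smooth_fun_on M W' f \<Longrightarrow>
    smooth_fun_on M W' (\<lambda>p. X p f)"
  by (simp add: vector_fields_def)

lemma vector_fields_subset: "X \<in> vector_fields M W \<Longrightarrow> W' \<subseteq> W \<Longrightarrow> X \<in> vector_fields M W'"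
  unfolding vector_fields_def by blast

lemma vector_fieldsI:
  assumes "\<And>p. p \<in> W \<Longrightarrow> X p \<in> tangent_space M p"
    and "\<And>W' f. openin (mtop M) W' \<Longrightarrow> W' \<subseteq> W \<Longrightarrow> smooth_fun_on M W' f \<Longrightarrow> smooth_fun_on M W' (\<lambda>p. X p f)"
  shows "X \<in> vector_fields M W"
  using assms by (simp add: vector_fields_def)

lemma vector_fields_cong:
  assumes "X \<in> vector_fields M W" "\<And>q. q \<in> W \<Longrightarrow> X q = Y q"
  shows "Y \<in> vector_fields M W"
proof (rule vector_fieldsI)
  show "Y p \<in> tangent_space M p" if "p \<in> W" for p
    using assms that vector_fields_tangent by metis
  show "smooth_fun_on M W' (\<lambda>p. Y p f)"
    if W': "openin (mtop M) W'" "W' \<subseteq> W" "smooth_fun_on M W' f" for W' f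
    by (subst smooth_fun_on_cong[of _ _ "\<lambda>p. X p f"])
      (use that assms(2) vector_fields_smooth[OF assms(1) W'] in auto)
qed

lemma vector_fields_local:
  assumes "\<And>p. p \<in> W \<Longrightarrow> \<exists>W'. openin (mtop M) W' \<and> p \<in> W' \<and> X \<in> vector_fields M W'"
  shows "X \<in> vector_fields M W"
proof (intro vector_fieldsI smooth_fun_on_local)
  show "X p \<in> tangent_space M p" if "p \<in> W" for p
    using assms that vector_fields_tangent by metis
  fix W1 f p assume W1: "openin (mtop M) W1" "W1 \<subseteq> W" "smooth_fun_on M W1 f" "p \<in> W1"
  then obtain W' where "openin (mtop M) W'" "p \<in> W'" "X \<in> vector_fields M W'" using assms by blast
  then show "\<exists>W'. openin (mtop M) W' \<and> p \<in> W' \<and> smooth_fun_on M W' (\<lambda>p. X p f)"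
    using W1 by (intro exI[of _ "W1 \<inter> W'"])
      (auto intro!: openin_Int vector_fields_smooth[of X W'] intro: smooth_fun_on_subset)
qed

lemma vector_fields_add:
  "X \<in> vector_fields M W \<Longrightarrow> Y \<in> vector_fields M W \<Longrightarrow> (\<lambda>q. X q + Y q) \<in> vector_fields M W"
  by (rule vector_fieldsI)
    (auto simp: tvec_apply intro!: tangent_add smooth_fun_on_add dest: vector_fields_tangent vector_fields_smooth)

lemma vector_fields_vscale:
  "X \<in> vector_fields M W \<Longrightarrow> smooth_fun_on M W f \<Longrightarrow> (\<lambda>q. f q \<cdot>\<^sub>v X q) \<in> vector_fields M W"
  by (rule vector_fieldsI)
    (auto simp: tvec_apply intro!: tangent_vscale smooth_fun_on_mult
      dest: vector_fields_tangent vector_fields_smooth intro: smooth_fun_on_subset)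

lemma vector_fields_zero: "openin (mtop M) W \<Longrightarrow> (\<And>q. q \<in> W \<Longrightarrow> X q = 0) \<Longrightarrow> X \<in> vector_fields M W"
  by (rule vector_fields_cong[of "\<lambda>q. 0"])
    (auto intro!: vector_fieldsI tangent_zero smooth_fun_on_const simp: tvec_apply dest: openin_subset)

lemma vector_fields_diff:
  assumes "X \<in> vector_fields M W" "Y \<in> vector_fields M W"
  shows "(\<lambda>q. X q - Y q) \<in> vector_fields M W"
  using vector_fields_add[OF assms(1) vector_fields_vscale[OF assms(2) smooth_fun_on_const[of _ "-1"]]]
  by (rule vector_fields_cong) (auto simp: fun_eq_iff tvec_apply)

lemma vector_fields_sum:
  "openin (mtop M) W \<Longrightarrow> (\<And>i. i \<in> I \<Longrightarrow> X i \<in> vector_fields M W) \<Longrightarrow>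
    (\<lambda>q. \<Sum>i\<in>I. X i q) \<in> vector_fields M W"
  by (induction I rule: infinite_finite_induct)
    (simp_all add: vector_fields_add vector_fields_zero)

text \<open>In the chart, the derivative of a smooth function in the constant direction
  \<open>\<xi>\<close> is again smooth. These coordinate fields form the local frames for all later
  expansions.\<close>

lemma chart_field:
  assumes c: "(U, \<psi>) \<in> atlas M"
  shows "(\<lambda>q. chart_vec M (U, \<psi>) q \<xi>) \<in> vector_fields M U"
proof (rule vector_fieldsI)
  fix W f assume W: "openin (mtop M) W" "W \<subseteq> U" "smooth_fun_on M W f"
  let ?F = "\<lambda>x. frechet_derivative (\<lambda>x. f (inv_into U \<psi> x)) (at x) \<xi>"
  have "smooth_fun_on M W (\<lambda>q. ?F (\<psi> q))"
    by (rule smooth_fun_on_chart[OF c W(1,2) chart_image_open[OF c W(1)] _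
          smooth_on_frechet_derivative[OF smooth_fun_onD[OF W(3) c]]]) (use W(2) in auto)
  then show "smooth_fun_on M W (\<lambda>p. chart_vec M (U, \<psi>) p \<xi> f)"
    by (subst smooth_fun_on_cong[OF W(1), of _ "\<lambda>q. ?F (\<psi> q)"])
      (use W in \<open>auto simp: chart_vec_apply smooth_nearI comp_def\<close>)
qed (use c chart_vec_in_tangent in blast)

lemma vector_field_through:
  assumes "v \<in> tangent_space M p"
  obtains U X where "openin (mtop M) U" "p \<in> U" "X \<in> vector_fields M U" "X p = v"
proof -
  obtain U \<psi> \<xi> where c: "(U, \<psi>) \<in> atlas M" "p \<in> U" and v: "v = chart_vec M (U, \<psi>) p \<xi>"
    using assms by (rule tangentE)
  show ?thesis by (rule that[OF chart_open[OF c(1)] c(2) chart_field[OF c(1)] v[symmetric]])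
qed

lemma extension_field:
  assumes "v \<in> tangent_space M p"
  obtains W where "openin (mtop M) W" "p \<in> W" "extension M p v \<in> vector_fields M W"
    "extension M p v p = v"
proof -
  have "\<exists>X W. openin (mtop M) W \<and> p \<in> W \<and> X \<in> vector_fields M W \<and> X p = v"
    using vector_field_through[OF assms] by metis
  then have "\<exists>W. openin (mtop M) W \<and> p \<in> W \<and> extension M p v \<in> vector_fields M W \<and> extension M p v p = v"
    unfolding extension_def by (rule someI_ex)
  then show ?thesis using that by blast
qed

text \<open>A coordinate field multiplied by a cutoff supported inside the chart extends by zero.
  Global fields are required because parallelism of the tension field is given only along fields on
  all of \<open>M\<close>.\<close>

lemma global_vector_field_through:
  assumes "v \<in> tangent_space M p"
  obtains X where "X \<in> vector_fields M (topspace (mtop M))" "X p = v"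
proof -
  obtain U \<psi> \<xi> where c: "(U, \<psi>) \<in> atlas M" "p \<in> U" and v: "v = chart_vec M (U, \<psi>) p \<xi>"
    using assms by (rule tangentE)
  have "\<psi> p \<in> \<psi> ` U" using c by simp
  then obtain r where r: "r > 0" "cball (\<psi> p) r \<subseteq> \<psi> ` U"
    using chart_open_image[OF c(1)] open_contains_cball by blast
  \<comment> \<open>The preimage of a closed ball is compact, hence closed in the Hausdorff space
    \<open>mtop M\<close>; so its complement is an open set on which the field can be zero.\<close>
  let ?K = "inv_into U \<psi> ` cball (\<psi> p) r"
  have KU: "?K \<subseteq> U" using r(2) by (auto intro: inv_into_into)
  \<comment> \<open>The homeomorphism comes with some continuous inverse \<open>\<kappa>\<close>; as
    it agrees with \<open>inv_into U \<psi>\<close> on the chart image, the latter is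
    continuous.\<close>
  obtain \<kappa> where \<kappa>: "homeomorphic_maps (subtopology (mtop M) U) (top_of_set (\<psi> ` U)) \<psi> \<kappa>"
    using chart_homeomorphic[OF c(1)] homeomorphic_map_maps by blast
  then have "continuous_map (top_of_set (\<psi> ` U)) (subtopology (mtop M) U) \<kappa>"
    by (simp add: homeomorphic_maps_def)
  moreover have "\<kappa> x = inv_into U \<psi> x" if "x \<in> \<psi> ` U" for x
    using that \<kappa> chart_subset[OF c(1)] by (auto simp: homeomorphic_maps_def chart_inv[OF c(1)])
  ultimately have "continuous_map (top_of_set (\<psi> ` U)) (subtopology (mtop M) U) (inv_into U \<psi>)"
    by (rule continuous_map_eq) simp
  then have "continuous_map (top_of_set (\<psi> ` U)) (mtop M) (inv_into U \<psi>)"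
    using continuous_map_into_fulltopology by blast
  moreover have "compactin (top_of_set (\<psi> ` U)) (cball (\<psi> p) r)"
    using r(2) by (simp add: compactin_subtopology)
  ultimately have "compactin (mtop M) ?K" using image_compactin by blast
  then have "closedin (mtop M) ?K"
    using smooth_manifold by (auto simp: smooth_manifold_def intro: compactin_imp_closedin)
  then have open_off: "openin (mtop M) (topspace (mtop M) - ?K)" by (simp add: closedin_def)
  define \<rho> where "\<rho> = (\<lambda>q. bump (\<psi> p) r (\<psi> q))"
  \<comment> \<open>The factor \<open>inverse (\<rho> p)\<close> restores the value \<open>v\<close>
    at \<open>p\<close>.\<close>
  define X where "X = (\<lambda>q. if q \<in> U then (inverse (\<rho> p) * \<rho> q) \<cdot>\<^sub>v chart_vec M (U, \<psi>) q \<xi> else 0)"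
  have rp: "\<rho> p > 0" unfolding \<rho>_def using r(1) by (rule bump_center)
  have "smooth_fun_on M U \<rho>"
    unfolding \<rho>_def
    by (rule smooth_fun_on_chart[OF c(1) chart_open[OF c(1)] subset_refl open_UNIV _ smooth_on_bump]) simp
  then have "(\<lambda>q. (inverse (\<rho> p) * \<rho> q) \<cdot>\<^sub>v chart_vec M (U, \<psi>) q \<xi>) \<in> vector_fields M U"
    by (intro vector_fields_vscale chart_field c(1) smooth_fun_on_mult smooth_fun_on_const
        chart_open[OF c(1)])
  then have XU: "X \<in> vector_fields M U" by (rule vector_fields_cong) (simp add: X_def)
  have "X q = 0" if "q \<notin> ?K" for q
  proof (cases "q \<in> U")
    case True
    have "\<psi> q \<notin> ball (\<psi> p) r"
    proof
      assume "\<psi> q \<in> ball (\<psi> p) r"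
      then have "inv_into U \<psi> (\<psi> q) \<in> ?K" using ball_subset_cball by blast
      with that True show False by (simp add: chart_inv[OF c(1)])
    qed
    then show ?thesis by (simp add: X_def \<rho>_def bump_outside r(1))
  qed (simp add: X_def)
  then have Xoff: "X \<in> vector_fields M (topspace (mtop M) - ?K)"
    by (intro vector_fields_zero open_off) auto
  \<comment> \<open>\<open>U\<close> and the complement of \<open>?K\<close> are open and cover
    \<open>M\<close>; the field is smooth on the first and zero on the second.\<close>
  have "X \<in> vector_fields M (topspace (mtop M))"
    by (rule vector_fields_local) (use XU Xoff KU open_off chart_open[OF c(1)] in blast)
  moreover have "X p = v" using c(2) rp by (simp add: X_def v)
  ultimately show ?thesis using that by blast
qed

text \<open>Near \<open>p\<close> the field is a combination of coordinate fields with smooth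
  coefficients, and linearity over functions takes these out with their values at \<open>p\<close>.
  \<open>W0\<close> stands for the region where the other arguments hidden in \<open>T\<close> are
  smooth, so that linearity is demanded only there.\<close>

lemma tensorial_expand:
  fixes T :: "'a vfield \<Rightarrow> 'c tvec"
  assumes add: "\<And>W X Y. openin (mtop M) W \<Longrightarrow> p \<in> W \<Longrightarrow> W \<subseteq> W0 \<Longrightarrow> X \<in> vector_fields M W \<Longrightarrow>
      Y \<in> vector_fields M W \<Longrightarrow> T (\<lambda>q. X q + Y q) = T X + T Y"
    and scale: "\<And>W X f. openin (mtop M) W \<Longrightarrow> p \<in> W \<Longrightarrow> W \<subseteq> W0 \<Longrightarrow> X \<in> vector_fields M W \<Longrightarrow>
      smooth_fun_on M W f \<Longrightarrow> T (\<lambda>q. f q \<cdot>\<^sub>v X q) = f p \<cdot>\<^sub>v T X"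
    and X: "openin (mtop M) W" "p \<in> W" "W \<subseteq> W0" "X \<in> vector_fields M W"
    and c: "(U, \<psi>) \<in> atlas M" "p \<in> U"
  shows "T X = (\<Sum>b\<in>Basis. X p (\<lambda>q. \<psi> q \<bullet> b) \<cdot>\<^sub>v T (\<lambda>q. chart_vec M (U, \<psi>) q b))"
proof -
  let ?W = "W \<inter> U" and ?F = "\<lambda>b q. chart_vec M (U, \<psi>) q b" and ?x = "\<lambda>b q. X q (\<lambda>q. \<psi> q \<bullet> b)"
  have W: "openin (mtop M) ?W" "p \<in> ?W" "?W \<subseteq> W0"
    using X c chart_open by (auto intro: openin_Int)
  have F: "?F b \<in> vector_fields M ?W" for b
    by (rule vector_fields_subset[OF chart_field[OF c(1)]]) simp
  have x: "smooth_fun_on M ?W (?x b)" for b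
    by (rule vector_fields_smooth[OF X(4) W(1)]) (auto intro: smooth_fun_on_subset smooth_fun_on_coordinate c)
  have null: "T Z = 0" if "\<And>q. q \<in> ?W \<Longrightarrow> Z q = 0" for Z
  proof -
    let ?\<chi> = "\<lambda>q. if q \<in> ?W then 0 else 1 :: real"
    have "smooth_fun_on M ?W ?\<chi>"
      by (subst smooth_fun_on_cong[OF W(1), of _ "\<lambda>q. 0"]) (auto intro: smooth_fun_on_const)
    from scale[OF W vector_fields_zero[OF W(1) that] this] W(2)
    have "T (\<lambda>q. ?\<chi> q \<cdot>\<^sub>v Z q) = 0" by simp
    moreover have "(\<lambda>q. ?\<chi> q \<cdot>\<^sub>v Z q) = Z" using that by auto
    ultimately show ?thesis by simp
  qed
  have sum: "T (\<lambda>q. \<Sum>b\<in>B. ?x b q \<cdot>\<^sub>v ?F b q) = (\<Sum>b\<in>B. ?x b p \<cdot>\<^sub>v T (?F b))" if "finite B" for B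
    using that
  proof (induction B)
    case empty
    then show ?case using null[of "\<lambda>q. 0"] by (simp only: sum.empty)
  next
    case (insert b B)
    have "T (\<lambda>q. ?x b q \<cdot>\<^sub>v ?F b q + (\<Sum>b\<in>B. ?x b q \<cdot>\<^sub>v ?F b q)) =
        T (\<lambda>q. ?x b q \<cdot>\<^sub>v ?F b q) + T (\<lambda>q. \<Sum>b\<in>B. ?x b q \<cdot>\<^sub>v ?F b q)"
      by (intro add[OF W] vector_fields_sum vector_fields_vscale F x W)
    also have "T (\<lambda>q. ?x b q \<cdot>\<^sub>v ?F b q) = ?x b p \<cdot>\<^sub>v T (?F b)"
      by (rule scale[OF W F x])
    finally show ?case using insert by simp
  qed
  let ?Y = "\<lambda>q. \<Sum>b\<in>Basis. ?x b q \<cdot>\<^sub>v ?F b q"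
  have eq: "X q = ?Y q" if "q \<in> ?W" for q
    using that vector_fields_tangent[OF X(4)] by (intro tangent_expand c(1)) auto
  have Y: "?Y \<in> vector_fields M ?W" by (intro vector_fields_sum vector_fields_vscale F x W)
  have Z: "(\<lambda>q. X q - ?Y q) \<in> vector_fields M ?W"
    by (rule vector_fields_zero[OF W(1)]) (use eq in simp)
  \<comment> \<open>\<open>X\<close> and \<open>?Y\<close> agree on \<open>?W\<close> but may differ
    as total functions; their difference vanishes near \<open>p\<close> and is discarded by
    \<open>null\<close>.\<close>
  have "T X = T (\<lambda>q. ?Y q + (X q - ?Y q))" by simp
  also have "\<dots> = T ?Y + T (\<lambda>q. X q - ?Y q)" by (rule add[OF W Y Z])
  also have "T (\<lambda>q. X q - ?Y q) = 0" by (rule null) (use eq in simp)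
  finally show ?thesis using sum[OF finite_Basis] by simp
qed

lemma tensorial_eq:
  fixes T :: "'a vfield \<Rightarrow> 'c tvec"
  assumes add: "\<And>W X Y. openin (mtop M) W \<Longrightarrow> p \<in> W \<Longrightarrow> W \<subseteq> W0 \<Longrightarrow> X \<in> vector_fields M W \<Longrightarrow>
      Y \<in> vector_fields M W \<Longrightarrow> T (\<lambda>q. X q + Y q) = T X + T Y"
    and scale: "\<And>W X f. openin (mtop M) W \<Longrightarrow> p \<in> W \<Longrightarrow> W \<subseteq> W0 \<Longrightarrow> X \<in> vector_fields M W \<Longrightarrow>
      smooth_fun_on M W f \<Longrightarrow> T (\<lambda>q. f q \<cdot>\<^sub>v X q) = f p \<cdot>\<^sub>v T X"
    and X: "openin (mtop M) W" "p \<in> W" "W \<subseteq> W0" "X \<in> vector_fields M W"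
    and Y: "openin (mtop M) W'" "p \<in> W'" "W' \<subseteq> W0" "Y \<in> vector_fields M W'"
    and eq: "X p = Y p"
  shows "T X = T Y"
proof -
  have "p \<in> topspace (mtop M)" using X openin_subset by blast
  then obtain U \<psi> where c: "(U, \<psi>) \<in> atlas M" "p \<in> U" by (rule chart_at)
  show ?thesis
    using tensorial_expand[of p W0 T, OF add scale X c] tensorial_expand[of p W0 T, OF add scale Y c] eq by simp
qed

end


section \<open>Orthonormal bases and frames\<close>

locale riem_mfd = smooth_mfd M for M :: "('a, 'e::euclidean_space) manifold" +
  fixes g :: "'a metric_field"
  assumes metric: "riemannian_metric M g"
begin

section \<open>Inner product algebra in a tangent space\<close>

lemma metric_at:
  assumes "u \<in> tangent_space M p" "v \<in> tangent_space M p"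
  shows "g p u v = g p v u \<and>
    (\<forall>w\<in>tangent_space M p. g p (u + v) w = g p u w + g p v w) \<and>
    (\<forall>a. g p (a \<cdot>\<^sub>v u) v = a * g p u v) \<and> (u \<noteq> 0 \<longrightarrow> g p u u > 0)"
  by (rule metric[unfolded riemannian_metric_def, THEN conjunct1, THEN bspec, THEN bspec, THEN bspec,
        OF tangent_point[OF assms(1)] assms])

lemma metric_sym: "u \<in> tangent_space M p \<Longrightarrow> v \<in> tangent_space M p \<Longrightarrow> g p u v = g p v u"
  and metric_add_left: "u \<in> tangent_space M p \<Longrightarrow> v \<in> tangent_space M p \<Longrightarrow> w \<in> tangent_space M p \<Longrightarrow>
    g p (u + v) w = g p u w + g p v w"
  and metric_vscale_left: "u \<in> tangent_space M p \<Longrightarrow> v \<in> tangent_space M p \<Longrightarrow>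
    g p (a \<cdot>\<^sub>v u) v = a * g p u v"
  and metric_pos: "u \<in> tangent_space M p \<Longrightarrow> u \<noteq> 0 \<Longrightarrow> g p u u > 0"
  using metric_at by blast+

lemma metric_smooth:
  "openin (mtop M) W \<Longrightarrow> X \<in> vector_fields M W \<Longrightarrow> Y \<in> vector_fields M W \<Longrightarrow>
    smooth_fun_on M W (\<lambda>p. g p (X p) (Y p))"
  using metric[unfolded riemannian_metric_def, THEN conjunct2, rule_format] by simp

lemma metric_zero_left: "v \<in> tangent_space M p \<Longrightarrow> g p 0 v = 0"
  using metric_vscale_left[of v p v 0] by simp

lemma metric_sum_left:
  "v \<in> tangent_space M p \<Longrightarrow> (\<And>i. i \<in> I \<Longrightarrow> V i \<in> tangent_space M p) \<Longrightarrow>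
    g p (\<Sum>i\<in>I. V i) v = (\<Sum>i\<in>I. g p (V i) v)"
  by (induction I rule: infinite_finite_induct)
    (simp_all add: metric_zero_left metric_add_left tangent_sum tangent_point)

lemma metric_diff_left:
  assumes "u \<in> tangent_space M p" "v \<in> tangent_space M p" "w \<in> tangent_space M p"
  shows "g p (u - v) w = g p u w - g p v w"
  using metric_add_left[OF tangent_diff[OF assms(1,2)] assms(2,3)] by simp

lemma metric_add_right:
  "u \<in> tangent_space M p \<Longrightarrow> v \<in> tangent_space M p \<Longrightarrow> w \<in> tangent_space M p \<Longrightarrow>
    g p w (u + v) = g p w u + g p w v"
  by (simp add: metric_sym[of w] metric_add_left tangent_add)

lemma metric_vscale_right:
  "u \<in> tangent_space M p \<Longrightarrow> v \<in> tangent_space M p \<Longrightarrow> g p v (a \<cdot>\<^sub>v u) = a * g p v u"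
  by (simp add: metric_sym[of v] metric_vscale_left tangent_vscale)

lemma metric_zero_right: "v \<in> tangent_space M p \<Longrightarrow> g p v 0 = 0"
  by (metis metric_sym metric_zero_left tangent_point tangent_zero)

lemma metric_sum_right:
  "v \<in> tangent_space M p \<Longrightarrow> (\<And>i. i \<in> I \<Longrightarrow> V i \<in> tangent_space M p) \<Longrightarrow>
    g p v (\<Sum>i\<in>I. V i) = (\<Sum>i\<in>I. g p v (V i))"
  by (simp add: metric_sym[of v] metric_sum_left tangent_sum tangent_point)

lemma metric_nonneg: "u \<in> tangent_space M p \<Longrightarrow> g p u u \<ge> 0"
  by (metis metric_pos metric_zero_left less_eq_real_def)

lemma metric_eq_0: "u \<in> tangent_space M p \<Longrightarrow> g p u u = 0 \<Longrightarrow> u = 0"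
  by (metis metric_pos less_irrefl)

section \<open>Orthonormal bases, traces and local frames\<close>

lemma orthonormal_sum:
  fixes k :: nat
  assumes "\<And>i. i < k \<Longrightarrow> e i \<in> tangent_space M p"
    and "\<And>i j. i < k \<Longrightarrow> j < k \<Longrightarrow> g p (e i) (e j) = (if i = j then 1 else 0)" and "j < k"
  shows "g p (\<Sum>i<k. a i \<cdot>\<^sub>v e i) (e j) = a j"
proof -
  have "g p (\<Sum>i<k. a i \<cdot>\<^sub>v e i) (e j) = (\<Sum>i<k. g p (a i \<cdot>\<^sub>v e i) (e j))"
    by (rule metric_sum_left) (use assms in \<open>auto intro: tangent_vscale\<close>)
  also have "\<dots> = (\<Sum>i<k. if i = j then a i else 0)"
    by (rule sum.cong) (use assms in \<open>auto simp: metric_vscale_left\<close>)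
  finally show ?thesis using assms(3) by simp
qed

text \<open>\<open>orthonormal_basis_at\<close> asks only for orthonormality of
  \<open>mdim M\<close> vectors, so spanning must be derived: in coordinates they define a linear
  endomorphism \<open>K\<close> of the model space, injective by orthonormality and therefore
  surjective.\<close>

lemma orthonormal_basis_expand:
  assumes e: "orthonormal_basis_at M g p e" and v: "v \<in> tangent_space M p"
  shows "v = (\<Sum>i<mdim M. g p v (e i) \<cdot>\<^sub>v e i)"
proof -
  let ?m = "DIM('e)"
  have m: "mdim M = ?m" by (simp add: mdim_def)
  have et: "e i \<in> tangent_space M p" if "i < ?m" for i
    using e that by (simp add: orthonormal_basis_at_def m)
  have on: "g p (e i) (e j) = (if i = j then 1 else 0)" if "i < ?m" "j < ?m" for i j
    using e that by (simp add: orthonormal_basis_at_def m)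
  obtain U \<psi> where c: "(U, \<psi>) \<in> atlas M" "p \<in> U" using chart_at[OF tangent_point[OF v]] .
  obtain \<beta> where \<beta>: "bij_betw \<beta> {..<?m} (Basis :: 'e set)"
    using ex_bij_betw_nat_finite[of "Basis :: 'e set"] by (auto simp: lessThan_atLeast0)
  define K where "K = (\<lambda>x. \<Sum>i<?m. (x \<bullet> \<beta> i) *\<^sub>R coord \<psi> (e i))"
  have cK: "chart_vec M (U, \<psi>) p (K x) = (\<Sum>i<?m. (x \<bullet> \<beta> i) \<cdot>\<^sub>v e i)" for x
    unfolding K_def chart_vec_sum[OF c] by (rule sum.cong) (simp_all add: chart_vec_coord[OF c] et)
  have "linear K"
    by (rule linearI)
      (simp_all add: K_def inner_add_left scaleR_add_left sum.distrib scaleR_sum_right)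
  moreover have "inj K"
  proof (subst linear_injective_0[OF \<open>linear K\<close>], safe)
    fix x assume "K x = 0"
    then have "(\<Sum>i<?m. (x \<bullet> \<beta> i) \<cdot>\<^sub>v e i) = 0"
      using cK[of x] by (simp add: chart_vec_linear(3)[OF c])
    then have "x \<bullet> \<beta> j = 0" if "j < ?m" for j
      using orthonormal_sum[of ?m e p j "\<lambda>i. x \<bullet> \<beta> i"] et on that by (simp add: metric_zero_left)
    then have "x \<bullet> b = 0" if "b \<in> Basis" for b
      using that bij_betw_imp_surj_on[OF \<beta>] by (metis imageE lessThan_iff)
    then show "x = 0" by (rule euclidean_all_zero_iff[THEN iffD1, rule_format])
  qed
  ultimately have "surj K" by (rule linear_inj_imp_surj)
  then obtain x where "coord \<psi> v = K x" by blast
  then have vx: "v = (\<Sum>i<?m. (x \<bullet> \<beta> i) \<cdot>\<^sub>v e i)"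
    using cK[of x] chart_vec_coord[OF c v] by simp
  have "g p v (e j) = x \<bullet> \<beta> j" if "j < ?m" for j
    unfolding vx by (rule orthonormal_sum[of ?m e p j]) (use et on that in auto)
  then show ?thesis unfolding m by (subst vx) simp
qed

text \<open>The change of basis is an orthogonal matrix, so mixed terms cancel and the diagonal ones
  survive. The form takes values in tangent vectors because both the tension field and the Ricci
  transform are traces of this kind.\<close>

lemma trace_independent:
  fixes \<beta> :: "'a tvec \<Rightarrow> 'a tvec \<Rightarrow> 'c tvec"
  assumes e: "orthonormal_basis_at M g p e" and e': "orthonormal_basis_at M g p e'"
    and p: "p \<in> topspace (mtop M)"
    and add1: "\<And>u v w. u \<in> tangent_space M p \<Longrightarrow> v \<in> tangent_space M p \<Longrightarrow> w \<in> tangent_space M p \<Longrightarrow>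
      \<beta> (u + v) w = \<beta> u w + \<beta> v w"
    and scale1: "\<And>a u w. u \<in> tangent_space M p \<Longrightarrow> w \<in> tangent_space M p \<Longrightarrow> \<beta> (a \<cdot>\<^sub>v u) w = a \<cdot>\<^sub>v \<beta> u w"
    and add2: "\<And>u v w. u \<in> tangent_space M p \<Longrightarrow> v \<in> tangent_space M p \<Longrightarrow> w \<in> tangent_space M p \<Longrightarrow>
      \<beta> w (u + v) = \<beta> w u + \<beta> w v"
    and scale2: "\<And>a u w. u \<in> tangent_space M p \<Longrightarrow> w \<in> tangent_space M p \<Longrightarrow> \<beta> w (a \<cdot>\<^sub>v u) = a \<cdot>\<^sub>v \<beta> w u"
  shows "(\<Sum>i<mdim M. \<beta> (e i) (e i)) = (\<Sum>i<mdim M. \<beta> (e' i) (e' i))"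
proof -
  let ?m = "mdim M"
  have et: "e i \<in> tangent_space M p" and et': "e' i \<in> tangent_space M p" if "i < ?m" for i
    using e e' that by (auto simp: orthonormal_basis_at_def)
  have sum1: "\<beta> (\<Sum>j<n. a j \<cdot>\<^sub>v e j) w = (\<Sum>j<n. a j \<cdot>\<^sub>v \<beta> (e j) w)"
    if "w \<in> tangent_space M p" "n \<le> ?m" for n :: nat and a w
    using that(2)
  proof (induction n)
    case 0
    have "\<beta> 0 w = 0" using scale1[of 0 w 0] that tangent_zero[OF p] by simp
    then show ?case by (simp only: lessThan_0 sum.empty)
  next
    case (Suc n)
    then show ?case
      using that unfolding sum.lessThan_Suc
      by (subst add1) (auto simp: scale1 et intro!: tangent_vscale tangent_sum p)
  qed
  have sum2: "\<beta> w (\<Sum>j<n. a j \<cdot>\<^sub>v e j) = (\<Sum>j<n. a j \<cdot>\<^sub>v \<beta> w (e j))"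
    if "w \<in> tangent_space M p" "n \<le> ?m" for n :: nat and a w
    using that(2)
  proof (induction n)
    case 0
    have "\<beta> w 0 = 0" using scale2[of 0 w 0] that tangent_zero[OF p] by simp
    then show ?case by (simp only: lessThan_0 sum.empty)
  next
    case (Suc n)
    then show ?case
      using that unfolding sum.lessThan_Suc
      by (subst add2) (auto simp: scale2 et intro!: tangent_vscale tangent_sum p)
  qed
  define a where "a = (\<lambda>i j. g p (e' i) (e j))"
  have exp: "e' i = (\<Sum>j<?m. a i j \<cdot>\<^sub>v e j)" if "i < ?m" for i
    unfolding a_def using orthonormal_basis_expand[OF e et'[OF that]] .
  \<comment> \<open>Orthonormality of the columns of \<open>a\<close> results from expanding
    \<open>e j\<close> in the other basis \<open>e'\<close> and pairing with
    \<open>e k\<close>.\<close>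
  have orth: "(\<Sum>i<?m. a i j * a i k) = (if j = k then 1 else 0)" if "j < ?m" "k < ?m" for j k
  proof -
    have "(\<Sum>i<?m. a i j * a i k) = (\<Sum>i<?m. g p (g p (e j) (e' i) \<cdot>\<^sub>v e' i) (e k))"
      by (rule sum.cong) (simp_all add: a_def metric_vscale_left metric_sym[OF et'] et et' that)
    also have "\<dots> = g p (\<Sum>i<?m. g p (e j) (e' i) \<cdot>\<^sub>v e' i) (e k)"
      by (rule metric_sum_left[symmetric]) (simp_all add: et et' that tangent_vscale)
    also have "\<dots> = g p (e j) (e k)"
      using orthonormal_basis_expand[OF e' et[OF that(1)]] by simp
    finally show ?thesis using e that by (simp add: orthonormal_basis_at_def)
  qed
  have "\<beta> (e' i) (e' i) = (\<Sum>j<?m. \<Sum>k<?m. (a i j * a i k) \<cdot>\<^sub>v \<beta> (e j) (e k))" if "i < ?m" for i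
  proof -
    have "\<beta> (e' i) (e' i) = \<beta> (\<Sum>j<?m. a i j \<cdot>\<^sub>v e j) (e' i)" using exp[OF that] by simp
    also have "\<dots> = (\<Sum>j<?m. a i j \<cdot>\<^sub>v \<beta> (e j) (e' i))" by (rule sum1) (simp_all add: et' that)
    also have "\<dots> = (\<Sum>j<?m. a i j \<cdot>\<^sub>v (\<Sum>k<?m. a i k \<cdot>\<^sub>v \<beta> (e j) (e k)))"
      using exp[OF that] by (intro sum.cong refl) (simp add: sum2 et)
    finally show ?thesis by (simp add: vscale_sum)
  qed
  then have "(\<Sum>i<?m. \<beta> (e' i) (e' i)) =
      (\<Sum>i<?m. \<Sum>j<?m. \<Sum>k<?m. (a i j * a i k) \<cdot>\<^sub>v \<beta> (e j) (e k))"
    by simp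
  also have "\<dots> = (\<Sum>j<?m. \<Sum>i<?m. \<Sum>k<?m. (a i j * a i k) \<cdot>\<^sub>v \<beta> (e j) (e k))"
    by (rule sum.swap)
  also have "\<dots> = (\<Sum>j<?m. \<Sum>k<?m. \<Sum>i<?m. (a i j * a i k) \<cdot>\<^sub>v \<beta> (e j) (e k))"
    by (rule sum.cong[OF refl], rule sum.swap)
  also have "\<dots> = (\<Sum>j<?m. \<Sum>k<?m. (if j = k then 1 else 0) \<cdot>\<^sub>v \<beta> (e j) (e k))"
    by (intro sum.cong refl) (simp add: orth flip: vscale_sum_left)
  also have "\<dots> = (\<Sum>j<?m. \<Sum>k<?m. if j = k then \<beta> (e j) (e k) else 0)"
    by (intro sum.cong refl) simp
  also have "\<dots> = (\<Sum>j<?m. \<beta> (e j) (e j))" by simp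
  finally show ?thesis by simp
qed

text \<open>Gram-Schmidt for fields, one at a time. Fewer vectors than the dimension cannot span, so
  some coordinate field differs at \<open>p\<close> from its projection onto the earlier fields; the
  residual stays nonzero nearby and can be normalised.\<close>

lemma orthonormal_fields_exist:
  assumes p: "p \<in> topspace (mtop M)" and "k \<le> DIM('e)"
  shows "\<exists>W E. openin (mtop M) W \<and> p \<in> W \<and> (\<forall>i<k. E i \<in> vector_fields M W) \<and>
    (\<forall>q\<in>W. \<forall>i<k. \<forall>j<k. g q (E i q) (E j q) = (if i = j then 1 else 0))"
  using assms(2)
proof (induction k)
  case 0
  then show ?case using p by auto
next
  case (Suc k)
  then have "k \<le> DIM('e)" by simp
  from Suc.IH[OF this] obtain W E where W: "openin (mtop M) W" "p \<in> W" and WE: "\<forall>i<k. E i \<in> vector_fields M W"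
    "\<forall>q\<in>W. \<forall>i<k. \<forall>j<k. g q (E i q) (E j q) = (if i = j then 1 else 0)"
    by (elim exE conjE)
  then have E: "\<And>i. i < k \<Longrightarrow> E i \<in> vector_fields M W"
    and on: "\<And>q i j. q \<in> W \<Longrightarrow> i < k \<Longrightarrow> j < k \<Longrightarrow> g q (E i q) (E j q) = (if i = j then 1 else 0)"
    by simp_all
  obtain U \<psi> where c: "(U, \<psi>) \<in> atlas M" "p \<in> U" using chart_at[OF p] .
  let ?F = "\<lambda>b q. chart_vec M (U, \<psi>) q b"
  let ?P = "\<lambda>b q. \<Sum>i<k. g q (?F b q) (E i q) \<cdot>\<^sub>v E i q"
  have Ep: "E i p \<in> tangent_space M p" if "i < k" for i
    using vector_fields_tangent[OF E[OF that] W(2)] .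
  have "\<exists>b\<in>Basis. ?F b p \<noteq> ?P b p"
  proof (rule ccontr)
    assume "\<not> ?thesis"
    then have eq: "?F b p = ?P b p" if "b \<in> Basis" for b using that by blast
    \<comment> \<open>If every coordinate vector were equal to its projection, \<open>k\<close>
      vectors would span the model space.\<close>
    let ?S = "(\<lambda>i. coord \<psi> (E i p)) ` {..<k}"
    have "b \<in> span ?S" if "b \<in> Basis" for b
    proof -
      have "?P b p = chart_vec M (U, \<psi>) p (\<Sum>i<k. g p (?F b p) (E i p) *\<^sub>R coord \<psi> (E i p))"
        unfolding chart_vec_sum[OF c] by (rule sum.cong) (simp_all add: chart_vec_coord[OF c] Ep)
      with eq[OF that] have "?F b p = chart_vec M (U, \<psi>) p (\<Sum>i<k. g p (?F b p) (E i p) *\<^sub>R coord \<psi> (E i p))"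
        by (rule trans)
      from arg_cong[of _ _ "coord \<psi>", OF this]
      have "b = (\<Sum>i<k. g p (?F b p) (E i p) *\<^sub>R coord \<psi> (E i p))"
        unfolding coord_chart_vec[OF c] .
      also have "\<dots> \<in> span ?S" by (intro span_sum span_scale span_base) simp
      finally show ?thesis .
    qed
    then have "(UNIV :: 'e set) \<subseteq> span ?S"
      using span_minimal[of Basis "span ?S"] span_Basis by blast
    then have "dim (UNIV :: 'e set) \<le> card ?S" by (intro dim_le_card) auto
    also have "\<dots> \<le> k" using card_image_le[of "{..<k}" "\<lambda>i. coord \<psi> (E i p)"] by simp
    finally show False using Suc.prems by (simp add: dim_UNIV)
  qed
  then obtain b where b: "?F b p \<noteq> ?P b p" by blast
  let ?V = "W \<inter> U"
  have V: "openin (mtop M) ?V" "p \<in> ?V" using W c chart_open by auto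
  have F: "?F b \<in> vector_fields M ?V"
    by (rule vector_fields_subset[OF chart_field[OF c(1)]]) simp
  have EV: "E i \<in> vector_fields M ?V" if "i < k" for i
    by (rule vector_fields_subset[OF E[OF that]]) simp
  define Y where "Y = (\<lambda>q. ?F b q - ?P b q)"
  have PV: "?P b \<in> vector_fields M ?V"
    using F EV by (intro vector_fields_sum vector_fields_vscale metric_smooth V) auto
  have Y: "Y \<in> vector_fields M ?V"
    unfolding Y_def by (rule vector_fields_diff[OF F PV])
  have YE: "g q (Y q) (E j q) = 0" if "q \<in> ?V" "j < k" for q j
  proof -
    have "g q (?P b q) (E j q) = g q (?F b q) (E j q)"
      by (rule orthonormal_sum)
        (use that vector_fields_tangent[OF EV] on in auto)
    then show ?thesis
      unfolding Y_def using that
      by (simp add: metric_diff_left vector_fields_tangent[OF F] vector_fields_tangent[OF PV]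
          vector_fields_tangent[OF EV])
  qed
  define r where "r = (\<lambda>q. g q (Y q) (Y q))"
  have r: "smooth_fun_on M ?V r" unfolding r_def by (intro metric_smooth V Y)
  \<comment> \<open>Away from the zeros of the residual, the factor
    \<open>r q powr (- 1 / 2)\<close> is smooth.\<close>
  let ?W = "{q \<in> ?V. r q > 0}"
  have W': "openin (mtop M) ?W" using openin_positive[OF V(1) r] .
  have "Y p \<noteq> 0" using b by (simp add: Y_def)
  then have pW: "p \<in> ?W"
    unfolding r_def using V(2) by (simp add: metric_pos vector_fields_tangent[OF Y V(2)])
  have "smooth_fun_on M ?W (\<lambda>q. r q powr (- 1 / 2))"
    by (rule smooth_fun_on_compose[OF W' smooth_fun_on_subset[OF r] open_greaterThan _ smooth_on_powr]) auto
  then have N: "(\<lambda>q. (r q powr (- 1 / 2)) \<cdot>\<^sub>v Y q) \<in> vector_fields M ?W"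
    by (intro vector_fields_vscale vector_fields_subset[OF Y]) auto
  define E' where "E' = E(k := (\<lambda>q. (r q powr (- 1 / 2)) \<cdot>\<^sub>v Y q))"
  have "\<forall>i<Suc k. E' i \<in> vector_fields M ?W"
    using N vector_fields_subset[OF E, of _ ?W] by (auto simp: E'_def less_Suc_eq)
  moreover have "g q (E' i q) (E' j q) = (if i = j then 1 else 0)"
    if q: "q \<in> ?W" and ij: "i < Suc k" "j < Suc k" for q i j
  proof -
    have qV: "q \<in> ?V" "r q > 0" using q by auto
    have Yq: "Y q \<in> tangent_space M q" using vector_fields_tangent[OF Y qV(1)] .
    have Eq: "E i q \<in> tangent_space M q" if "i < k" for i
      using vector_fields_tangent[OF EV[OF that] qV(1)] .
    have "(r q powr (- 1 / 2)) * ((r q powr (- 1 / 2)) * r q) = 1"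
    proof -
      have "(r q powr (- 1 / 2)) * (r q powr (- 1 / 2)) = inverse (r q)"
        unfolding powr_add[symmetric] using qV(2) by (simp add: powr_minus)
      then show ?thesis using qV(2) by (simp flip: mult.assoc)
    qed
    moreover have "g q (Y q) (Y q) = r q" by (simp add: r_def)
    ultimately have kk: "g q (E' k q) (E' k q) = 1"
      by (simp add: E'_def metric_vscale_left metric_vscale_right tangent_vscale Yq)
    have ki: "g q (E' k q) (E i q) = 0" if "i < k" for i
      using that qV by (simp add: E'_def metric_vscale_left Yq Eq YE)
    have ik: "g q (E i q) (E' k q) = 0" if "i < k" for i
      using that ki by (subst metric_sym) (simp_all add: E'_def tangent_vscale Yq Eq)
    show ?thesis
      using ij kk ki ik on[of q i j] qV(1) by (cases "i = k"; cases "j = k") (auto simp: E'_def)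
  qed
  ultimately show ?case using W' pW by blast
qed

lemma frame_near_frame:
  assumes "p \<in> topspace (mtop M)"
  obtains W where "openin (mtop M) W" "p \<in> W" "orthonormal_frame_on M g W (frame_near M g p)"
proof -
  obtain W E where WE: "openin (mtop M) W" "p \<in> W" "\<forall>i<DIM('e). E i \<in> vector_fields M W"
    "\<forall>q\<in>W. \<forall>i<DIM('e). \<forall>j<DIM('e). g q (E i q) (E j q) = (if i = j then 1 else 0)"
    using orthonormal_fields_exist[OF assms, of "DIM('e)"] by auto
  have "orthonormal_frame_on M g W E"
    using WE vector_fields_tangent by (auto simp: orthonormal_frame_on_def orthonormal_basis_at_def mdim_def)
  with WE have "\<exists>E W. openin (mtop M) W \<and> p \<in> W \<and> orthonormal_frame_on M g W E" by blast
  then have "\<exists>W. openin (mtop M) W \<and> p \<in> W \<and> orthonormal_frame_on M g W (frame_near M g p)"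
    unfolding frame_near_def by (rule someI_ex)
  then show ?thesis using that by blast
qed

text \<open>Any orthonormal basis certifies the choice made by \<open>basis_at\<close>; in
  \<open>ricci_tension\<close> the certificate is the adapted basis.\<close>

lemma orthonormal_basis_basis_at:
  "orthonormal_basis_at M g p e \<Longrightarrow> orthonormal_basis_at M g p (basis_at M g p)"
  unfolding basis_at_def by (rule someI[of "orthonormal_basis_at M g p"])

end


section \<open>Connections\<close>

text \<open>Stating the closure properties of \<open>\<Gamma>\<close> abstractly lets the same
  calculus serve the Levi-Civita connections, acting on vector fields, and the induced connection,
  acting on sections along the map.\<close>

locale connection = smooth_mfd M for M :: "('a, 'e::euclidean_space) manifold" +
  fixes \<Gamma> :: "'a set \<Rightarrow> ('a \<Rightarrow> 'b tvec) set" and D :: "'a vfield \<Rightarrow> ('a \<Rightarrow> 'b tvec) \<Rightarrow> 'a \<Rightarrow> 'b tvec"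
  assumes connection: "is_connection M \<Gamma> D"
    and section_subset: "V \<in> \<Gamma> W \<Longrightarrow> W' \<subseteq> W \<Longrightarrow> V \<in> \<Gamma> W'"
    and section_zero: "openin (mtop M) W \<Longrightarrow> (\<And>q. q \<in> W \<Longrightarrow> V q = 0) \<Longrightarrow> V \<in> \<Gamma> W"
    and section_add: "openin (mtop M) W \<Longrightarrow> V \<in> \<Gamma> W \<Longrightarrow> V' \<in> \<Gamma> W \<Longrightarrow> (\<lambda>q. V q + V' q) \<in> \<Gamma> W"
    and section_vscale: "openin (mtop M) W \<Longrightarrow> smooth_fun_on M W f \<Longrightarrow> V \<in> \<Gamma> W \<Longrightarrow>
      (\<lambda>q. f q \<cdot>\<^sub>v V q) \<in> \<Gamma> W"
begin

lemma conn_at: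
  assumes "openin (mtop M) W" "X \<in> vector_fields M W" "V \<in> \<Gamma> W"
  shows "D X V \<in> \<Gamma> W \<and>
    (\<forall>X'\<in>vector_fields M W. \<forall>p\<in>W. D (\<lambda>q. X q + X' q) V p = D X V p + D X' V p) \<and>
    (\<forall>V'\<in>\<Gamma> W. \<forall>p\<in>W. D X (\<lambda>q. V q + V' q) p = D X V p + D X V' p) \<and>
    (\<forall>f. smooth_fun_on M W f \<longrightarrow> (\<forall>p\<in>W.
      D (\<lambda>q. f q \<cdot>\<^sub>v X q) V p = f p \<cdot>\<^sub>v D X V p \<and>
      D X (\<lambda>q. f q \<cdot>\<^sub>v V q) p = X p f \<cdot>\<^sub>v V p + f p \<cdot>\<^sub>v D X V p))"
  by (rule connection[unfolded is_connection_def, THEN spec, THEN mp, THEN bspec, THEN bspec, OF assms])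

lemma conn_section: "openin (mtop M) W \<Longrightarrow> X \<in> vector_fields M W \<Longrightarrow> V \<in> \<Gamma> W \<Longrightarrow> D X V \<in> \<Gamma> W"
  and conn_add_field: "openin (mtop M) W \<Longrightarrow> p \<in> W \<Longrightarrow> X \<in> vector_fields M W \<Longrightarrow>
    X' \<in> vector_fields M W \<Longrightarrow> V \<in> \<Gamma> W \<Longrightarrow> D (\<lambda>q. X q + X' q) V p = D X V p + D X' V p"
  and conn_vscale_field: "openin (mtop M) W \<Longrightarrow> p \<in> W \<Longrightarrow> X \<in> vector_fields M W \<Longrightarrow>
    smooth_fun_on M W f \<Longrightarrow> V \<in> \<Gamma> W \<Longrightarrow> D (\<lambda>q. f q \<cdot>\<^sub>v X q) V p = f p \<cdot>\<^sub>v D X V p"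
  and conn_add_section: "openin (mtop M) W \<Longrightarrow> p \<in> W \<Longrightarrow> X \<in> vector_fields M W \<Longrightarrow>
    V \<in> \<Gamma> W \<Longrightarrow> V' \<in> \<Gamma> W \<Longrightarrow> D X (\<lambda>q. V q + V' q) p = D X V p + D X V' p"
  and conn_vscale_section: "openin (mtop M) W \<Longrightarrow> p \<in> W \<Longrightarrow> X \<in> vector_fields M W \<Longrightarrow>
    smooth_fun_on M W f \<Longrightarrow> V \<in> \<Gamma> W \<Longrightarrow>
    D X (\<lambda>q. f q \<cdot>\<^sub>v V q) p = X p f \<cdot>\<^sub>v V p + f p \<cdot>\<^sub>v D X V p"
  using conn_at by simp_all

text \<open>Scaling by a function that vanishes on \<open>W\<close> and is \<open>1\<close> elsewhere fixes a section that vanishes on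
  \<open>W\<close>, hence the derivative of the latter is \<open>0\<close>; the same trick gives \<open>null\<close> in
  \<open>tensorial_expand\<close>.\<close>

lemma conn_cong_section:
  assumes W: "openin (mtop M) W" "p \<in> W" and X: "X \<in> vector_fields M W" and V: "V \<in> \<Gamma> W"
    and eq: "\<And>q. q \<in> W \<Longrightarrow> V q = V' q"
  shows "D X V' p = D X V p"
proof -
  let ?Z = "\<lambda>q. V' q - V q" and ?\<chi> = "\<lambda>q. if q \<in> W then 0 else 1 :: real"
  have \<chi>: "smooth_fun_on M W ?\<chi>"
    by (subst smooth_fun_on_cong[OF W(1), of _ "\<lambda>q. 0"]) (auto intro: smooth_fun_on_const)
  have Z: "?Z \<in> \<Gamma> W" using eq by (intro section_zero W) simp
  have "(\<lambda>q. ?\<chi> q \<cdot>\<^sub>v ?Z q) = ?Z" using eq by auto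
  then have "D X ?Z p = X p ?\<chi> \<cdot>\<^sub>v ?Z p + ?\<chi> p \<cdot>\<^sub>v D X ?Z p"
    using conn_vscale_section[OF W X \<chi> Z] by simp
  also have "\<dots> = 0" using eq[OF W(2)] W(2) by simp
  finally have "D X ?Z p = 0" .
  moreover have "D X (\<lambda>q. V q + ?Z q) p = D X V p + D X ?Z p"
    by (rule conn_add_section[OF W X V Z])
  ultimately show ?thesis by simp
qed

text \<open>The direction enters linearly over functions, so only its value at \<open>p\<close>
  counts. This permits exchanging a local field for a global one with the same value.\<close>

lemma conn_tensorial:
  assumes W: "openin (mtop M) W" "p \<in> W" "X \<in> vector_fields M W"
    and W': "openin (mtop M) W'" "p \<in> W'" "X' \<in> vector_fields M W'"
    and W0: "W \<subseteq> W0" "W' \<subseteq> W0" "V \<in> \<Gamma> W0" and eq: "X p = X' p"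
  shows "D X V p = D X' V p"
  by (rule tensorial_eq[of p W0 "\<lambda>X. D X V p", OF _ _ W(1,2) W0(1) W(3) W'(1,2) W0(2) W'(3) eq])
    (use W0(3) section_subset in \<open>auto intro: conn_add_field conn_vscale_field\<close>)

lemma section_sum:
  "openin (mtop M) W \<Longrightarrow> (\<And>i. i \<in> I \<Longrightarrow> V i \<in> \<Gamma> W) \<Longrightarrow> (\<lambda>q. \<Sum>i\<in>I. V i q) \<in> \<Gamma> W"
  by (induction I rule: infinite_finite_induct) (simp_all add: section_add section_zero)

lemma conn_sum_section:
  assumes W: "openin (mtop M) W" "p \<in> W" and X: "X \<in> vector_fields M W" and "finite I"
    and "\<And>i. i \<in> I \<Longrightarrow> smooth_fun_on M W (f i)" "\<And>i. i \<in> I \<Longrightarrow> V i \<in> \<Gamma> W"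
  shows "D X (\<lambda>q. \<Sum>i\<in>I. f i q \<cdot>\<^sub>v V i q) p =
    (\<Sum>i\<in>I. X p (f i) \<cdot>\<^sub>v V i p + f i p \<cdot>\<^sub>v D X (V i) p)"
  using assms(4-)
proof (induction I)
  case empty
  have Z: "(\<lambda>q. 0) \<in> \<Gamma> W" by (rule section_zero[OF W(1)]) simp
  have "D X (\<lambda>q. 0 + 0) p = D X (\<lambda>q. 0) p + D X (\<lambda>q. 0) p"
    by (rule conn_add_section[OF W X Z Z])
  then have "D X (\<lambda>q. 0) p = 0" by simp
  then show ?case by (simp only: sum.empty)
next
  case (insert i I)
  have "D X (\<lambda>q. f i q \<cdot>\<^sub>v V i q + (\<Sum>i\<in>I. f i q \<cdot>\<^sub>v V i q)) p =
      D X (\<lambda>q. f i q \<cdot>\<^sub>v V i q) p + D X (\<lambda>q. \<Sum>i\<in>I. f i q \<cdot>\<^sub>v V i q) p"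
    by (rule conn_add_section[OF W X]) (use insert.prems in \<open>auto intro!: section_vscale section_sum W\<close>)
  also have "D X (\<lambda>q. f i q \<cdot>\<^sub>v V i q) p = X p (f i) \<cdot>\<^sub>v V i p + f i p \<cdot>\<^sub>v D X (V i) p"
    by (rule conn_vscale_section[OF W X]) (use insert.prems in auto)
  also have "D X (\<lambda>q. \<Sum>i\<in>I. f i q \<cdot>\<^sub>v V i q) p =
      (\<Sum>i\<in>I. X p (f i) \<cdot>\<^sub>v V i p + f i p \<cdot>\<^sub>v D X (V i) p)"
    by (rule insert.IH) (use insert.prems in auto)
  finally show ?case
    unfolding sum.insert[OF insert.hyps] .
qed

end

section \<open>The Levi-Civita connection and its curvature\<close>

locale levi_civita_mfd = riem_mfd M g
  for M :: "('a, 'e::euclidean_space) manifold" and g :: "'a metric_field" +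
  fixes D :: "'a vfield \<Rightarrow> 'a vfield \<Rightarrow> 'a vfield"
  assumes levi_civita: "levi_civita M g D"

sublocale levi_civita_mfd \<subseteq> connection M "vector_fields M" D
  by unfold_locales
    (use levi_civita in \<open>auto simp: levi_civita_def intro: vector_fields_subset vector_fields_zero
      vector_fields_add vector_fields_vscale\<close>)

context levi_civita_mfd
begin

lemma levi_civita_at:
  assumes "openin (mtop M) W" "X \<in> vector_fields M W" "Y \<in> vector_fields M W" "y \<in> W"
  shows "D X Y y - D Y X y = bracket M X Y y \<and> (\<forall>Z\<in>vector_fields M W.
    X y (\<lambda>q. g q (Y q) (Z q)) = g y (D X Y y) (Z y) + g y (Y y) (D X Z y))"
  by (rule levi_civita[unfolded levi_civita_def, THEN conjunct2, THEN spec, THEN mp,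
        THEN bspec, THEN bspec, THEN bspec, OF assms])

lemma bracket_eq:
  "openin (mtop M) W \<Longrightarrow> p \<in> W \<Longrightarrow> X \<in> vector_fields M W \<Longrightarrow> Y \<in> vector_fields M W \<Longrightarrow>
    bracket M X Y p = D X Y p - D Y X p"
  using levi_civita_at[of W X Y p] by simp

text \<open>Torsion-freeness writes the bracket as a difference of covariant derivatives, which are
  smooth fields; no second derivatives have to be computed.\<close>

lemma bracket_field:
  assumes W: "openin (mtop M) W" and X: "X \<in> vector_fields M W" and Y: "Y \<in> vector_fields M W"
  shows "bracket M X Y \<in> vector_fields M W"
  using vector_fields_diff[OF conn_section[OF W X Y] conn_section[OF W Y X]]
  by (rule vector_fields_cong) (simp add: bracket_eq[OF W _ X Y])

text \<open>Tensoriality is established in the second and third slots, over which the traces run; in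
  the traces compared below the first slot holds the tension field. The bracket is handled by
  torsion-freeness.\<close>

lemma curvature_add_second:
  assumes W: "openin (mtop M) W" "p \<in> W" and U: "U \<in> vector_fields M W"
    and V: "V \<in> vector_fields M W" "V' \<in> vector_fields M W" and Z: "Z \<in> vector_fields M W"
  shows "curvature M D U (\<lambda>q. V q + V' q) Z p = curvature M D U V Z p + curvature M D U V' Z p"
proof -
  note f = conn_section[OF W(1)] vector_fields_add bracket_field[OF W(1)] U V Z
  have "D U (D (\<lambda>q. V q + V' q) Z) p = D U (\<lambda>q. D V Z q + D V' Z q) p"
    by (rule conn_cong_section[OF W U]) (simp_all add: f conn_add_field[OF W(1)])
  also have "\<dots> = D U (D V Z) p + D U (D V' Z) p"
    by (rule conn_add_section[OF W]) (intro f)+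
  finally have 1: "D U (D (\<lambda>q. V q + V' q) Z) p = D U (D V Z) p + D U (D V' Z) p" .
  have 2: "D (\<lambda>q. V q + V' q) (D U Z) p = D V (D U Z) p + D V' (D U Z) p"
    by (rule conn_add_field[OF W]) (intro f)+
  have "D (bracket M U (\<lambda>q. V q + V' q)) Z p = D (\<lambda>q. bracket M U V q + bracket M U V' q) Z p"
    by (rule conn_tensorial[OF W _ W _ subset_refl subset_refl Z])
      (simp_all add: f bracket_eq[OF W] conn_add_section[OF W] conn_add_field[OF W])
  also have "\<dots> = D (bracket M U V) Z p + D (bracket M U V') Z p"
    by (rule conn_add_field[OF W]) (intro f)+
  finally show ?thesis unfolding curvature_def 1 2 by simp
qed

text \<open>The derivative \<open>U p k\<close> arises twice, from differentiating the product of
  \<open>k\<close> and \<open>D V Z\<close>, and from \<open>[U, k V] = (U k) V + k [U, V]\<close>;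
  the two contributions cancel.\<close>

lemma curvature_vscale_second:
  assumes W: "openin (mtop M) W" "p \<in> W" and U: "U \<in> vector_fields M W"
    and V: "V \<in> vector_fields M W" and Z: "Z \<in> vector_fields M W" and k: "smooth_fun_on M W k"
  shows "curvature M D U (\<lambda>q. k q \<cdot>\<^sub>v V q) Z p = k p \<cdot>\<^sub>v curvature M D U V Z p"
proof -
  have Uk: "smooth_fun_on M W (\<lambda>q. U q k)" by (rule vector_fields_smooth[OF U W(1) subset_refl k])
  note f = conn_section[OF W(1)] vector_fields_add vector_fields_vscale bracket_field[OF W(1)] U V Z k Uk
  have "D U (D (\<lambda>q. k q \<cdot>\<^sub>v V q) Z) p = D U (\<lambda>q. k q \<cdot>\<^sub>v D V Z q) p"
    by (rule conn_cong_section[OF W U]) (simp_all add: f conn_vscale_field[OF W(1)])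
  also have "\<dots> = U p k \<cdot>\<^sub>v D V Z p + k p \<cdot>\<^sub>v D U (D V Z) p"
    by (rule conn_vscale_section[OF W]) (intro f)+
  finally have 1: "D U (D (\<lambda>q. k q \<cdot>\<^sub>v V q) Z) p = U p k \<cdot>\<^sub>v D V Z p + k p \<cdot>\<^sub>v D U (D V Z) p" .
  have 2: "D (\<lambda>q. k q \<cdot>\<^sub>v V q) (D U Z) p = k p \<cdot>\<^sub>v D V (D U Z) p"
    by (rule conn_vscale_field[OF W]) (intro f)+
  have "D (bracket M U (\<lambda>q. k q \<cdot>\<^sub>v V q)) Z p =
      D (\<lambda>q. U q k \<cdot>\<^sub>v V q + k q \<cdot>\<^sub>v bracket M U V q) Z p"
    by (rule conn_tensorial[OF W _ W _ subset_refl subset_refl Z])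
      (simp_all add: f bracket_eq[OF W] conn_vscale_section[OF W] conn_vscale_field[OF W] vscale_algebra)
  also have "\<dots> = D (\<lambda>q. U q k \<cdot>\<^sub>v V q) Z p + D (\<lambda>q. k q \<cdot>\<^sub>v bracket M U V q) Z p"
    by (rule conn_add_field[OF W]) (intro f)+
  also have "\<dots> = U p k \<cdot>\<^sub>v D V Z p + k p \<cdot>\<^sub>v D (bracket M U V) Z p"
    by (simp add: conn_vscale_field[OF W] f)
  finally show ?thesis unfolding curvature_def 1 2 by (simp add: vscale_algebra)
qed

lemma curvature_add_third:
  assumes W: "openin (mtop M) W" "p \<in> W" and U: "U \<in> vector_fields M W"
    and V: "V \<in> vector_fields M W" and Z: "Z \<in> vector_fields M W" "Z' \<in> vector_fields M W"
  shows "curvature M D U V (\<lambda>q. Z q + Z' q) p = curvature M D U V Z p + curvature M D U V Z' p"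
proof -
  note f = conn_section[OF W(1)] vector_fields_add bracket_field[OF W(1)] Z
  have second: "D X (D Y (\<lambda>q. Z q + Z' q)) p = D X (D Y Z) p + D X (D Y Z') p"
    if X: "X \<in> vector_fields M W" and Y: "Y \<in> vector_fields M W" for X Y
  proof -
    have "D X (D Y (\<lambda>q. Z q + Z' q)) p = D X (\<lambda>q. D Y Z q + D Y Z' q) p"
      by (rule conn_cong_section[OF W X]) (simp_all add: f Y conn_add_section[OF W(1)])
    also have "\<dots> = D X (D Y Z) p + D X (D Y Z') p"
      by (rule conn_add_section[OF W X]) (intro f Y)+
    finally show ?thesis .
  qed
  have "D (bracket M U V) (\<lambda>q. Z q + Z' q) p = D (bracket M U V) Z p + D (bracket M U V) Z' p"
    by (rule conn_add_section[OF W]) (intro f U V)+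
  then show ?thesis unfolding curvature_def second[OF U V] second[OF V U] by simp
qed

text \<open>The first derivatives of \<open>k\<close> occur symmetrically in the two iterated
  derivatives and cancel. The second derivatives leave \<open>bracket M U V p k\<close>, which is
  what the bracket term subtracts.\<close>

lemma curvature_vscale_third:
  assumes W: "openin (mtop M) W" "p \<in> W" and U: "U \<in> vector_fields M W"
    and V: "V \<in> vector_fields M W" and Z: "Z \<in> vector_fields M W" and k: "smooth_fun_on M W k"
  shows "curvature M D U V (\<lambda>q. k q \<cdot>\<^sub>v Z q) p = k p \<cdot>\<^sub>v curvature M D U V Z p"
proof -
  note f = conn_section[OF W(1)] vector_fields_add vector_fields_vscale bracket_field[OF W(1)] Z k
  have second: "D X (D Y (\<lambda>q. k q \<cdot>\<^sub>v Z q)) p = X p (\<lambda>q. Y q k) \<cdot>\<^sub>v Z p + Y p k \<cdot>\<^sub>v D X Z p +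
      (X p k \<cdot>\<^sub>v D Y Z p + k p \<cdot>\<^sub>v D X (D Y Z) p)"
    if X: "X \<in> vector_fields M W" and Y: "Y \<in> vector_fields M W" for X Y
  proof -
    have Yk: "smooth_fun_on M W (\<lambda>q. Y q k)" by (rule vector_fields_smooth[OF Y W(1) subset_refl k])
    have "D X (D Y (\<lambda>q. k q \<cdot>\<^sub>v Z q)) p = D X (\<lambda>q. Y q k \<cdot>\<^sub>v Z q + k q \<cdot>\<^sub>v D Y Z q) p"
      by (rule conn_cong_section[OF W X]) (simp_all add: f Y Yk conn_vscale_section[OF W(1)])
    also have "\<dots> = D X (\<lambda>q. Y q k \<cdot>\<^sub>v Z q) p + D X (\<lambda>q. k q \<cdot>\<^sub>v D Y Z q) p"
      by (rule conn_add_section[OF W X]) (intro f Y Yk)+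
    also have "D X (\<lambda>q. Y q k \<cdot>\<^sub>v Z q) p = X p (\<lambda>q. Y q k) \<cdot>\<^sub>v Z p + Y p k \<cdot>\<^sub>v D X Z p"
      by (rule conn_vscale_section[OF W X Yk Z])
    also have "D X (\<lambda>q. k q \<cdot>\<^sub>v D Y Z q) p = X p k \<cdot>\<^sub>v D Y Z p + k p \<cdot>\<^sub>v D X (D Y Z) p"
      by (rule conn_vscale_section[OF W X k conn_section[OF W(1) Y Z]])
    finally show ?thesis .
  qed
  have br: "bracket M U V p k = U p (\<lambda>q. V q k) - V p (\<lambda>q. U q k)"
    using smooth_nearI[OF W k] by (simp add: bracket_def)
  have third: "D (bracket M U V) (\<lambda>q. k q \<cdot>\<^sub>v Z q) p =
      bracket M U V p k \<cdot>\<^sub>v Z p + k p \<cdot>\<^sub>v D (bracket M U V) Z p"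
    by (rule conn_vscale_section[OF W bracket_field[OF W(1) U V] k Z])
  show ?thesis
    unfolding curvature_def second[OF U V] second[OF V U] third br vscale_algebra by simp
qed

lemma curvature_field:
  assumes W: "openin (mtop M) W" "p \<in> W" and "U \<in> vector_fields M W" "V \<in> vector_fields M W"
    "Z \<in> vector_fields M W"
  shows "curvature M D U V Z p \<in> tangent_space M p"
  unfolding curvature_def
  by (intro tangent_diff vector_fields_tangent[OF _ W(2)] conn_section bracket_field W(1) assms(3-))

lemma curvature_at_extend:
  assumes u: "u \<in> tangent_space M p" and w: "w \<in> tangent_space M p"
  obtains W where "openin (mtop M) W" "p \<in> W" "extension M p u \<in> vector_fields M W"
    "extension M p w \<in> vector_fields M W" "extension M p u p = u" "extension M p w p = w"
proof -
  obtain W1 where 1: "openin (mtop M) W1" "p \<in> W1" "extension M p u \<in> vector_fields M W1" "extension M p u p = u"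
    using extension_field[OF u] .
  obtain W2 where 2: "openin (mtop M) W2" "p \<in> W2" "extension M p w \<in> vector_fields M W2" "extension M p w p = w"
    using extension_field[OF w] .
  show ?thesis
    by (rule that[of "W1 \<inter> W2"])
      (use 1 2 in \<open>auto intro: openin_Int vector_fields_subset[of _ W1] vector_fields_subset[of _ W2]\<close>)
qed

text \<open>Frees the second slot from the extension chosen in \<open>curvature_at\<close>.
  \<open>W0\<close> is a domain on which the two remaining chosen extensions are smooth.\<close>

lemma curvature_at_second:
  assumes u: "u \<in> tangent_space M p" and w: "w \<in> tangent_space M p"
    and V: "openin (mtop M) W" "p \<in> W" "V \<in> vector_fields M W" and v: "V p = v"
  shows "curvature_at M D p u v w = curvature M D (extension M p u) V (extension M p w) p"
proof -
  obtain W0 where W0: "openin (mtop M) W0" "p \<in> W0" "extension M p u \<in> vector_fields M W0"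
    "extension M p w \<in> vector_fields M W0" using curvature_at_extend[OF u w] .
  have vt: "v \<in> tangent_space M p" using vector_fields_tangent[OF V(3,2)] v by simp
  obtain W' where W': "openin (mtop M) W'" "p \<in> W'" "extension M p v \<in> vector_fields M W'" "extension M p v p = v"
    using extension_field[OF vt] .
  show ?thesis
    unfolding curvature_at_def
  proof (rule tensorial_eq[where p = p and ?W0.0 = W0 and W = "W' \<inter> W0" and W' = "W \<inter> W0"
        and T = "\<lambda>V. curvature M D (extension M p u) V (extension M p w) p"])
    fix W1 X Y assume "openin (mtop M) W1" "p \<in> W1" "W1 \<subseteq> W0" "X \<in> vector_fields M W1" "Y \<in> vector_fields M W1"
    then show "curvature M D (extension M p u) (\<lambda>q. X q + Y q) (extension M p w) p =
        curvature M D (extension M p u) X (extension M p w) p + curvature M D (extension M p u) Y (extension M p w) p"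
      using W0(3,4) by (intro curvature_add_second[where W = W1]) (auto intro: vector_fields_subset)
  next
    fix W1 X k assume "openin (mtop M) W1" "p \<in> W1" "W1 \<subseteq> W0" "X \<in> vector_fields M W1" "smooth_fun_on M W1 k"
    then show "curvature M D (extension M p u) (\<lambda>q. k q \<cdot>\<^sub>v X q) (extension M p w) p =
        k p \<cdot>\<^sub>v curvature M D (extension M p u) X (extension M p w) p"
      using W0(3,4) by (intro curvature_vscale_second[where W = W1]) (auto intro: vector_fields_subset)
  qed (use W0 W' V v in \<open>auto intro: vector_fields_subset\<close>)
qed

lemma curvature_at_third:
  assumes u: "u \<in> tangent_space M p" and v: "v \<in> tangent_space M p"
    and Z: "openin (mtop M) W" "p \<in> W" "Z \<in> vector_fields M W" and w: "Z p = w"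
  shows "curvature_at M D p u v w = curvature M D (extension M p u) (extension M p v) Z p"
proof -
  obtain W0 where W0: "openin (mtop M) W0" "p \<in> W0" "extension M p u \<in> vector_fields M W0"
    "extension M p v \<in> vector_fields M W0" using curvature_at_extend[OF u v] .
  have wt: "w \<in> tangent_space M p" using vector_fields_tangent[OF Z(3,2)] w by simp
  obtain W' where W': "openin (mtop M) W'" "p \<in> W'" "extension M p w \<in> vector_fields M W'" "extension M p w p = w"
    using extension_field[OF wt] .
  show ?thesis
    unfolding curvature_at_def
  proof (rule tensorial_eq[where p = p and ?W0.0 = W0 and W = "W' \<inter> W0" and W' = "W \<inter> W0"
        and T = "\<lambda>Z. curvature M D (extension M p u) (extension M p v) Z p"])
    fix W1 X Y assume "openin (mtop M) W1" "p \<in> W1" "W1 \<subseteq> W0" "X \<in> vector_fields M W1" "Y \<in> vector_fields M W1"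
    then show "curvature M D (extension M p u) (extension M p v) (\<lambda>q. X q + Y q) p =
        curvature M D (extension M p u) (extension M p v) X p + curvature M D (extension M p u) (extension M p v) Y p"
      using W0(3,4) by (intro curvature_add_third[where W = W1]) (auto intro: vector_fields_subset)
  next
    fix W1 X k assume "openin (mtop M) W1" "p \<in> W1" "W1 \<subseteq> W0" "X \<in> vector_fields M W1" "smooth_fun_on M W1 k"
    then show "curvature M D (extension M p u) (extension M p v) (\<lambda>q. k q \<cdot>\<^sub>v X q) p =
        k p \<cdot>\<^sub>v curvature M D (extension M p u) (extension M p v) X p"
      using W0(3,4) by (intro curvature_vscale_third[where W = W1]) (auto intro: vector_fields_subset)
  qed (use W0 W' Z w in \<open>auto intro: vector_fields_subset\<close>)
qed

text \<open>The extension of a sum need not be the sum of the extensions, but both have the same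
  value at \<open>p\<close>. So the former may be replaced by the latter, to which linearity in
  fields applies.\<close>

lemma curvature_at_bilinear:
  assumes u: "u \<in> tangent_space M p" and v: "v \<in> tangent_space M p" and v': "v' \<in> tangent_space M p"
    and w: "w \<in> tangent_space M p"
  shows "curvature_at M D p u (v + v') w = curvature_at M D p u v w + curvature_at M D p u v' w"
    and "curvature_at M D p u (a \<cdot>\<^sub>v v) w = a \<cdot>\<^sub>v curvature_at M D p u v w"
    and "curvature_at M D p u w (v + v') = curvature_at M D p u w v + curvature_at M D p u w v'"
    and "curvature_at M D p u w (a \<cdot>\<^sub>v v) = a \<cdot>\<^sub>v curvature_at M D p u w v"
    and "curvature_at M D p u v w \<in> tangent_space M p"
proof -
  obtain W1 where W1: "openin (mtop M) W1" "p \<in> W1" "extension M p u \<in> vector_fields M W1"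
    "extension M p w \<in> vector_fields M W1" using curvature_at_extend[OF u w] .
  obtain W2 where W2: "openin (mtop M) W2" "p \<in> W2" "extension M p v \<in> vector_fields M W2"
    "extension M p v' \<in> vector_fields M W2" and vp: "extension M p v p = v" "extension M p v' p = v'"
    using curvature_at_extend[OF v v'] .
  let ?W = "W1 \<inter> W2"
  have W: "openin (mtop M) ?W" "p \<in> ?W" using W1 W2 by auto
  have ext: "extension M p u \<in> vector_fields M ?W" "extension M p w \<in> vector_fields M ?W"
    "extension M p v \<in> vector_fields M ?W" "extension M p v' \<in> vector_fields M ?W"
    using W1 W2 by (auto intro: vector_fields_subset[of _ W1] vector_fields_subset[of _ W2])
  have sum: "(\<lambda>q. extension M p v q + extension M p v' q) \<in> vector_fields M ?W"
    by (intro vector_fields_add ext)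
  have scale: "(\<lambda>q. a \<cdot>\<^sub>v extension M p v q) \<in> vector_fields M ?W"
    by (intro vector_fields_vscale ext smooth_fun_on_const)
  show "curvature_at M D p u (v + v') w = curvature_at M D p u v w + curvature_at M D p u v' w"
    using curvature_at_second[OF u w W sum, of "v + v'"] vp
      curvature_add_second[OF W ext(1,3,4,2)] by (simp add: curvature_at_def)
  show "curvature_at M D p u (a \<cdot>\<^sub>v v) w = a \<cdot>\<^sub>v curvature_at M D p u v w"
    using curvature_at_second[OF u w W scale, of "a \<cdot>\<^sub>v v"] vp
      curvature_vscale_second[OF W ext(1,3,2) smooth_fun_on_const] by (simp add: curvature_at_def)
  show "curvature_at M D p u w (v + v') = curvature_at M D p u w v + curvature_at M D p u w v'"
    using curvature_at_third[OF u w W sum, of "v + v'"] vp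
      curvature_add_third[OF W ext(1,2,3,4)] by (simp add: curvature_at_def)
  show "curvature_at M D p u w (a \<cdot>\<^sub>v v) = a \<cdot>\<^sub>v curvature_at M D p u w v"
    using curvature_at_third[OF u w W scale, of "a \<cdot>\<^sub>v v"] vp
      curvature_vscale_third[OF W ext(1,2,3) smooth_fun_on_const] by (simp add: curvature_at_def)
  show "curvature_at M D p u v w \<in> tangent_space M p"
    unfolding curvature_at_def by (rule curvature_field[OF W ext(1,3,2)])
qed

lemma curvature_at_vscale:
  assumes "u \<in> tangent_space M p" "v \<in> tangent_space M p" "w \<in> tangent_space M p"
  shows "curvature_at M D p u (a \<cdot>\<^sub>v v) w = a \<cdot>\<^sub>v curvature_at M D p u v w"
    and "curvature_at M D p u w (a \<cdot>\<^sub>v v) = a \<cdot>\<^sub>v curvature_at M D p u w v"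
    and curvature_at_tangent: "curvature_at M D p u v w \<in> tangent_space M p"
  using curvature_at_bilinear(2,4,5)[OF assms(1,2,2,3)] by blast+

lemma curvature_at_same:
  assumes u: "u \<in> tangent_space M p" and w: "w \<in> tangent_space M p"
  shows "curvature_at M D p u u w = 0"
proof -
  obtain W where W: "openin (mtop M) W" "p \<in> W" "extension M p u \<in> vector_fields M W"
    "extension M p w \<in> vector_fields M W" using curvature_at_extend[OF u w] .
  \<comment> \<open>Writing the zero field as a multiple by \<open>0\<close> makes the derivative
    along it vanish by linearity over functions.\<close>
  have "bracket M (extension M p u) (extension M p u) = (\<lambda>q. 0 \<cdot>\<^sub>v extension M p u q)"
    by (auto simp: bracket_def fun_eq_iff tvec_apply)
  then show ?thesis
    using conn_vscale_field[OF W(1-3) smooth_fun_on_const W(4), of 0]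
    by (simp add: curvature_at_def curvature_def)
qed

end

section \<open>Smooth maps, differentials and sections along a map\<close>

locale smooth_map_mfd = M: smooth_mfd M + N: smooth_mfd N
  for M :: "('a, 'e::euclidean_space) manifold" and N :: "('b, 'f::euclidean_space) manifold" +
  fixes \<phi> :: "'a \<Rightarrow> 'b"
  assumes smooth_map: "smooth_map M N \<phi>"
begin

lemma vimage_open:
  assumes "openin (mtop M) W" "openin (mtop N) W'"
  shows "openin (mtop M) (W \<inter> \<phi> -` W')"
proof -
  have "openin (mtop M) {q \<in> topspace (mtop M). \<phi> q \<in> W'}"
    using smooth_map assms(2) by (auto simp: smooth_map_def intro: openin_continuous_map_preimage)
  then have "openin (mtop M) (W \<inter> {q \<in> topspace (mtop M). \<phi> q \<in> W'})"
    using assms(1) by (rule openin_Int[rotated])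
  moreover have "W \<inter> {q \<in> topspace (mtop M). \<phi> q \<in> W'} = W \<inter> \<phi> -` W'"
    using openin_subset[OF assms(1)] by blast
  ultimately show ?thesis by simp
qed

lemma map_point: "p \<in> topspace (mtop M) \<Longrightarrow> \<phi> p \<in> topspace (mtop N)"
  using smooth_map by (auto simp: smooth_map_def continuous_map_def)

lemma map_in_charts:
  "(U, \<psi>) \<in> atlas M \<Longrightarrow> (V, \<theta>) \<in> atlas N \<Longrightarrow>
    smooth_on (\<psi> ` (U \<inter> \<phi> -` V)) (\<lambda>x. \<theta> (\<phi> (inv_into U \<psi> x)))"
  using smooth_map by (auto simp: smooth_map_def comp_def)

lemma smooth_fun_on_comp:
  assumes f: "openin (mtop N) W'" "smooth_fun_on N W' f" and W: "openin (mtop M) W" "\<phi> ` W \<subseteq> W'"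
  shows "smooth_fun_on M W (\<lambda>p. f (\<phi> p))"
proof (rule M.smooth_fun_on_local)
  fix p assume p: "p \<in> W"
  then have "\<phi> p \<in> topspace (mtop N)" using openin_subset[OF W(1)] map_point by blast
  then obtain V \<theta> where d: "(V, \<theta>) \<in> atlas N" "\<phi> p \<in> V" using N.chart_at by blast
  let ?W = "W \<inter> \<phi> -` V"
  have W1: "openin (mtop M) ?W" using vimage_open[OF W(1) N.chart_open[OF d(1)]] .
  have "smooth_fun_on M ?W (\<lambda>p. f (\<phi> p))"
  proof (rule M.smooth_fun_onI)
    fix U \<psi> assume c: "(U, \<psi>) \<in> atlas M"
    have op: "open (\<psi> ` (U \<inter> ?W))" using M.chart_image_open[OF c W1] .
    have t: "smooth_on (\<psi> ` (U \<inter> ?W)) (\<lambda>x. \<theta> (\<phi> (inv_into U \<psi> x)))"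
      by (rule smooth_on_subset[OF map_in_charts[OF c d(1)]]) auto
    have "(\<lambda>x. \<theta> (\<phi> (inv_into U \<psi> x))) ` \<psi> ` (U \<inter> ?W) \<subseteq> \<theta> ` (V \<inter> W')"
      using W(2) M.chart_inv[OF c] by auto
    from smooth_on_compose[OF op N.chart_image_open[OF d(1) f(1)] this t N.smooth_fun_onD[OF f(2) d(1)]]
    have "smooth_on (\<psi> ` (U \<inter> ?W)) (\<lambda>x. f (inv_into V \<theta> (\<theta> (\<phi> (inv_into U \<psi> x)))))" .
    then show "smooth_on (\<psi> ` (U \<inter> ?W)) (\<lambda>x. f (\<phi> (inv_into U \<psi> x)))"
      by (subst smooth_on_cong[OF op, of _ "\<lambda>x. f (inv_into V \<theta> (\<theta> (\<phi> (inv_into U \<psi> x))))"])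
        (use M.chart_inv[OF c] N.chart_inv[OF d(1)] in auto)
  qed
  then show "\<exists>W'. openin (mtop M) W' \<and> p \<in> W' \<and> smooth_fun_on M W' (\<lambda>p. f (\<phi> p))"
    using W1 p d(2) by (intro exI[of _ ?W]) simp
qed

lemma smooth_near_comp:
  assumes "smooth_near N (\<phi> p) f" "p \<in> topspace (mtop M)"
  shows "smooth_near M p (\<lambda>q. f (\<phi> q))"
proof -
  obtain W' where W': "openin (mtop N) W'" "\<phi> p \<in> W'" "smooth_fun_on N W' f"
    using assms(1) unfolding smooth_near_def by blast
  show ?thesis
    by (rule M.smooth_nearI[OF vimage_open[OF openin_topspace W'(1)]])
      (use W' assms(2) in \<open>auto intro!: smooth_fun_on_comp[OF W'(1,3)] vimage_open\<close>)
qed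

lemma differential_apply: "smooth_near N (\<phi> p) f \<Longrightarrow> differential N \<phi> p v f = v (\<lambda>q. f (\<phi> q))"
  by (simp add: differential_def comp_def)

lemma differential_linear:
  "differential N \<phi> p (u + v) = differential N \<phi> p u + differential N \<phi> p v"
  "differential N \<phi> p (u - v) = differential N \<phi> p u - differential N \<phi> p v"
  "differential N \<phi> p (a \<cdot>\<^sub>v v) = a \<cdot>\<^sub>v differential N \<phi> p v"
  "differential N \<phi> p 0 = 0"
  by (auto simp: fun_eq_iff differential_def tvec_apply)

text \<open>By the chain rule a chart vector goes to a chart vector of \<open>N\<close>, its
  components transformed by the Jacobian of the map in charts.\<close>

lemma differential_tangent:
  assumes v: "v \<in> tangent_space M p"
  shows "differential N \<phi> p v \<in> tangent_space N (\<phi> p)"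
proof -
  obtain U \<psi> \<xi> where c: "(U, \<psi>) \<in> atlas M" "p \<in> U" and ve: "v = chart_vec M (U, \<psi>) p \<xi>"
    using v by (rule M.tangentE)
  have p: "p \<in> topspace (mtop M)" using v by (rule M.tangent_point)
  obtain V \<theta> where d: "(V, \<theta>) \<in> atlas N" "\<phi> p \<in> V" using N.chart_at[OF map_point[OF p]] .
  let ?t = "\<lambda>x. \<theta> (\<phi> (inv_into U \<psi> x))"
  have dt: "?t differentiable (at (\<psi> p))"
    by (rule smooth_on_imp_differentiable[OF map_in_charts[OF c(1) d(1)]]) (use c d in auto)
  have tp: "?t (\<psi> p) = \<theta> (\<phi> p)" using c M.chart_inv by simp
  have "differential N \<phi> p v f =
      chart_vec N (V, \<theta>) (\<phi> p) (frechet_derivative ?t (at (\<psi> p)) \<xi>) f" for f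
  proof (cases "smooth_near N (\<phi> p) f")
    case True
    let ?F = "f \<circ> inv_into V \<theta>"
    have dF: "?F differentiable (at (?t (\<psi> p)))"
      unfolding tp by (rule N.smooth_near_differentiable[OF d True])
    have D: "((\<lambda>x. ?F (?t x)) has_derivative
        (\<lambda>v. frechet_derivative ?F (at (?t (\<psi> p))) (frechet_derivative ?t (at (\<psi> p)) v))) (at (\<psi> p))"
      using dt dF unfolding frechet_derivative_works by (rule has_derivative_compose)
    have "frechet_derivative ((\<lambda>q. f (\<phi> q)) \<circ> inv_into U \<psi>) (at (\<psi> p)) =
        frechet_derivative (\<lambda>x. ?F (?t x)) (at (\<psi> p))"
    proof (rule frechet_derivative_cong_open(2)[of "\<psi> ` (U \<inter> (U \<inter> \<phi> -` V))"])
      show "open (\<psi> ` (U \<inter> (U \<inter> \<phi> -` V)))"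
        by (intro M.chart_image_open c vimage_open M.chart_open[OF c(1)] N.chart_open[OF d(1)])
    qed (use c d M.chart_inv[OF c(1)] N.chart_inv[OF d(1)] in auto)
    then show ?thesis
      by (simp only: differential_apply[OF True] ve M.chart_vec_apply[OF smooth_near_comp[OF True p]]
          N.chart_vec_apply[OF True] frechet_derivative_eq[OF D] tp)
  qed (simp add: differential_def N.chart_vec_not_smooth)
  then have "differential N \<phi> p v =
      chart_vec N (V, \<theta>) (\<phi> p) (frechet_derivative ?t (at (\<psi> p)) \<xi>)" by blast
  then show ?thesis using N.chart_vec_in_tangent[OF d] by simp
qed

lemma sections_alongI:
  assumes "\<And>p. p \<in> W \<Longrightarrow> V p \<in> tangent_space N (\<phi> p)"
    and "\<And>W' f. openin (mtop N) W' \<Longrightarrow> smooth_fun_on N W' f \<Longrightarrow> smooth_fun_on M (W \<inter> \<phi> -` W') (\<lambda>p. V p f)"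
  shows "V \<in> sections_along M N \<phi> W"
  using assms by (simp add: sections_along_def)

lemma section_tangent: "V \<in> sections_along M N \<phi> W \<Longrightarrow> p \<in> W \<Longrightarrow> V p \<in> tangent_space N (\<phi> p)"
  and section_smooth: "V \<in> sections_along M N \<phi> W \<Longrightarrow> openin (mtop N) W' \<Longrightarrow> smooth_fun_on N W' f \<Longrightarrow>
    smooth_fun_on M (W \<inter> \<phi> -` W') (\<lambda>p. V p f)"
  by (simp_all add: sections_along_def)

lemma section_subset:
  assumes "V \<in> sections_along M N \<phi> W" "W' \<subseteq> W"
  shows "V \<in> sections_along M N \<phi> W'"
proof (rule sections_alongI)
  show "V p \<in> tangent_space N (\<phi> p)" if "p \<in> W'" for p
    using assms that by (blast intro: section_tangent)
  show "smooth_fun_on M (W' \<inter> \<phi> -` W1) (\<lambda>p. V p f)"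
    if "openin (mtop N) W1" "smooth_fun_on N W1 f" for W1 f
    by (rule M.smooth_fun_on_subset[OF section_smooth[OF assms(1) that]]) (use assms(2) in auto)
qed

lemma section_add:
  assumes W: "openin (mtop M) W" and V: "V \<in> sections_along M N \<phi> W" "V' \<in> sections_along M N \<phi> W"
  shows "(\<lambda>q. V q + V' q) \<in> sections_along M N \<phi> W"
proof (rule sections_alongI)
  show "V p + V' p \<in> tangent_space N (\<phi> p)" if "p \<in> W" for p
    using V that by (intro N.tangent_add section_tangent)
  show "smooth_fun_on M (W \<inter> \<phi> -` W') (\<lambda>p. (V p + V' p) f)"
    if W': "openin (mtop N) W'" "smooth_fun_on N W' f" for W' f
    unfolding tvec_apply
    by (rule M.smooth_fun_on_add[OF vimage_open[OF W W'(1)] section_smooth[OF V(1) W'] section_smooth[OF V(2) W']])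
qed

lemma section_vscale:
  assumes W: "openin (mtop M) W" and f: "smooth_fun_on M W f" and V: "V \<in> sections_along M N \<phi> W"
  shows "(\<lambda>q. f q \<cdot>\<^sub>v V q) \<in> sections_along M N \<phi> W"
proof (rule sections_alongI)
  show "f p \<cdot>\<^sub>v V p \<in> tangent_space N (\<phi> p)" if "p \<in> W" for p
    using V that by (intro N.tangent_vscale section_tangent)
  show "smooth_fun_on M (W \<inter> \<phi> -` W') (\<lambda>p. (f p \<cdot>\<^sub>v V p) k)"
    if W': "openin (mtop N) W'" "smooth_fun_on N W' k" for W' k
    unfolding tvec_apply
    by (rule M.smooth_fun_on_mult[OF vimage_open[OF W W'(1)] M.smooth_fun_on_subset[OF f] section_smooth[OF V W']]) simp
qed

lemma section_cong:
  assumes W: "openin (mtop M) W" and V: "V \<in> sections_along M N \<phi> W" and eq: "\<And>q. q \<in> W \<Longrightarrow> V q = V' q"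
  shows "V' \<in> sections_along M N \<phi> W"
proof (rule sections_alongI)
  show "V' p \<in> tangent_space N (\<phi> p)" if "p \<in> W" for p
    using section_tangent[OF V that] eq[OF that] by simp
  show "smooth_fun_on M (W \<inter> \<phi> -` W') (\<lambda>p. V' p f)"
    if W': "openin (mtop N) W'" "smooth_fun_on N W' f" for W' f
    by (subst M.smooth_fun_on_cong[of _ _ "\<lambda>p. V p f"])
      (use eq in \<open>auto intro!: vimage_open W W' section_smooth[OF V]\<close>)
qed

lemma section_zero:
  assumes W: "openin (mtop M) W" and "\<And>q. q \<in> W \<Longrightarrow> V q = 0"
  shows "V \<in> sections_along M N \<phi> W"
proof (rule section_cong[OF W])
  show "(\<lambda>q. 0) \<in> sections_along M N \<phi> W"
    by (rule sections_alongI)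
      (use openin_subset[OF W] in \<open>auto simp: tvec_apply intro: N.tangent_zero map_point M.smooth_fun_on_const\<close>)
qed (simp add: assms(2))

lemma pushforward_section:
  assumes W: "openin (mtop M) W" and X: "X \<in> vector_fields M W"
  shows "pushforward N \<phi> X \<in> sections_along M N \<phi> W"
proof (rule sections_alongI)
  show "pushforward N \<phi> X p \<in> tangent_space N (\<phi> p)" if "p \<in> W" for p
    unfolding pushforward_def by (rule differential_tangent[OF M.vector_fields_tangent[OF X that]])
  fix W' f assume W': "openin (mtop N) W'" "smooth_fun_on N W' f"
  have V: "openin (mtop M) (W \<inter> \<phi> -` W')" using vimage_open[OF W W'(1)] .
  have "smooth_fun_on M (W \<inter> \<phi> -` W') (\<lambda>p. X p (\<lambda>q. f (\<phi> q)))"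
    by (rule M.vector_fields_smooth[OF X V]) (auto intro!: smooth_fun_on_comp[OF W' V])
  then show "smooth_fun_on M (W \<inter> \<phi> -` W') (\<lambda>p. pushforward N \<phi> X p f)"
    by (subst M.smooth_fun_on_cong[OF V, of _ "\<lambda>p. X p (\<lambda>q. f (\<phi> q))"])
      (use W' in \<open>auto simp: pushforward_def differential_apply N.smooth_nearI\<close>)
qed

lemma pullback_section:
  assumes W: "openin (mtop M) W" and Y: "openin (mtop N) W'" "Y \<in> vector_fields N W'" and "\<phi> ` W \<subseteq> W'"
  shows "(\<lambda>q. Y (\<phi> q)) \<in> sections_along M N \<phi> W"
proof (rule sections_alongI)
  show "Y (\<phi> p) \<in> tangent_space N (\<phi> p)" if "p \<in> W" for p
    using assms that by (auto intro: N.vector_fields_tangent)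
  fix W1 f assume W1: "openin (mtop N) W1" "smooth_fun_on N W1 f"
  have V: "openin (mtop N) (W' \<inter> W1)" using Y(1) W1(1) by (rule openin_Int)
  have "smooth_fun_on N (W' \<inter> W1) (\<lambda>y. Y y f)"
    by (rule N.vector_fields_smooth[OF Y(2) V]) (auto intro: N.smooth_fun_on_subset[OF W1(2)])
  then show "smooth_fun_on M (W \<inter> \<phi> -` W1) (\<lambda>p. Y (\<phi> p) f)"
    by (rule smooth_fun_on_comp[OF V _ vimage_open[OF W W1(1)]]) (use assms(4) in auto)
qed

end

section \<open>The induced connection on the pulled-back tangent bundle\<close>

locale induced_conn = smooth_map_mfd M N \<phi> + N: levi_civita_mfd N h Dh
  for M :: "('a, 'e::euclidean_space) manifold" and N :: "('b, 'f::euclidean_space) manifold"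
    and \<phi> :: "'a \<Rightarrow> 'b" and h :: "'b metric_field"
    and Dh :: "'b vfield \<Rightarrow> 'b vfield \<Rightarrow> 'b vfield" +
  fixes D :: "'a vfield \<Rightarrow> ('a \<Rightarrow> 'b tvec) \<Rightarrow> 'a \<Rightarrow> 'b tvec"
  assumes induced: "induced_connection M N \<phi> Dh D"

sublocale induced_conn \<subseteq> D: connection M "sections_along M N \<phi>" D
  by unfold_locales
    (use induced in \<open>auto simp: induced_connection_def intro: section_subset section_zero
      section_add section_vscale\<close>)

context induced_conn
begin

lemma conn_pullback:
  assumes "openin (mtop M) W" "openin (mtop N) W'" "X \<in> vector_fields M W"
    "Y \<in> vector_fields N W'" "Z \<in> vector_fields N W'" "p \<in> W" "\<phi> p \<in> W'"
    "differential N \<phi> p (X p) = Z (\<phi> p)"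
  shows "D X (\<lambda>q. Y (\<phi> q)) p = Dh Z Y (\<phi> p)"
  using induced[unfolded induced_connection_def, THEN conjunct2, rule_format, of W W' X Y Z p] assms
  by (simp add: comp_def)

lemma section_expand:
  assumes "(V, \<theta>) \<in> atlas N" "\<phi> q \<in> V" "S \<in> sections_along M N \<phi> W" "q \<in> W"
  shows "S q = (\<Sum>b\<in>Basis. S q (\<lambda>y. \<theta> y \<bullet> b) \<cdot>\<^sub>v chart_vec N (V, \<theta>) (\<phi> q) b)"
  using N.tangent_expand[OF assms(1,2) section_tangent[OF assms(3,4)]] .

text \<open>The coordinate fields of \<open>N\<close> frame the pulled-back bundle, and on them
  \<open>induced_connection\<close> prescribes the derivative. The Leibniz rule then determines it
  on every section.\<close>

lemma conn_expand_section:
  assumes d: "(V, \<theta>) \<in> atlas N" "\<phi> p \<in> V"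
    and W: "openin (mtop M) W" "p \<in> W" and X: "X \<in> vector_fields M W"
    and S: "S \<in> sections_along M N \<phi> W"
    and Z: "Z \<in> vector_fields N V" "differential N \<phi> p (X p) = Z (\<phi> p)"
  shows "D X S p = (\<Sum>b\<in>Basis. X p (\<lambda>q. S q (\<lambda>y. \<theta> y \<bullet> b)) \<cdot>\<^sub>v chart_vec N (V, \<theta>) (\<phi> p) b +
    S p (\<lambda>y. \<theta> y \<bullet> b) \<cdot>\<^sub>v Dh Z (\<lambda>y. chart_vec N (V, \<theta>) y b) (\<phi> p))"
proof -
  let ?W = "W \<inter> \<phi> -` V" and ?F = "\<lambda>b y. chart_vec N (V, \<theta>) y b"
  have V: "openin (mtop N) V" using N.chart_open[OF d(1)] .
  have W1: "openin (mtop M) ?W" "p \<in> ?W" using vimage_open[OF W(1) V] W d by auto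
  have X1: "X \<in> vector_fields M ?W" by (rule M.vector_fields_subset[OF X]) simp
  have S1: "S \<in> sections_along M N \<phi> ?W" by (rule section_subset[OF S]) simp
  have F: "(\<lambda>q. ?F b (\<phi> q)) \<in> sections_along M N \<phi> ?W" for b
    by (rule pullback_section[OF W1(1) V N.chart_field[OF d(1)]]) auto
  have s: "smooth_fun_on M ?W (\<lambda>q. S q (\<lambda>y. \<theta> y \<bullet> b))" for b
    by (rule section_smooth[OF S V N.smooth_fun_on_coordinate[OF d(1)]])
  have "D X S p = D X (\<lambda>q. \<Sum>b\<in>Basis. S q (\<lambda>y. \<theta> y \<bullet> b) \<cdot>\<^sub>v ?F b (\<phi> q)) p"
    by (rule D.conn_cong_section[OF W1 X1 S1, symmetric]) (use section_expand[OF d(1) _ S] in auto)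
  also have "\<dots> = (\<Sum>b\<in>Basis. X p (\<lambda>q. S q (\<lambda>y. \<theta> y \<bullet> b)) \<cdot>\<^sub>v ?F b (\<phi> p) +
      S p (\<lambda>y. \<theta> y \<bullet> b) \<cdot>\<^sub>v D X (\<lambda>q. ?F b (\<phi> q)) p)"
    by (rule D.conn_sum_section[OF W1 X1 finite_Basis s F])
  also have "\<dots> = (\<Sum>b\<in>Basis. X p (\<lambda>q. S q (\<lambda>y. \<theta> y \<bullet> b)) \<cdot>\<^sub>v ?F b (\<phi> p) +
      S p (\<lambda>y. \<theta> y \<bullet> b) \<cdot>\<^sub>v Dh Z (?F b) (\<phi> p))"
    by (intro sum.cong refl) (simp add: conn_pullback[OF W1(1) V X1 N.chart_field[OF d(1)] Z(1) W1(2) d(2) Z(2)])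
  finally show ?thesis .
qed

text \<open>Metric compatibility is not part of \<open>induced_connection\<close> but inherited: on
  pulled-back coordinate fields it is the compatibility of \<open>Dh\<close> in the direction
  \<open>Z\<close>, and the Leibniz rule carries it to all sections.\<close>

lemma induced_metric:
  assumes W: "openin (mtop M) W" "p \<in> W" and X: "X \<in> vector_fields M W"
    and S: "S \<in> sections_along M N \<phi> W" and T: "T \<in> sections_along M N \<phi> W"
  shows "X p (\<lambda>q. h (\<phi> q) (S q) (T q)) = h (\<phi> p) (D X S p) (T p) + h (\<phi> p) (S p) (D X T p)"
    (is "?lhs = ?rhs")
proof -
  have "p \<in> topspace (mtop M)" using W openin_subset by blast
  then obtain V \<theta> where d: "(V, \<theta>) \<in> atlas N" "\<phi> p \<in> V" using N.chart_at[OF map_point] by blast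
  let ?W = "W \<inter> \<phi> -` V" and ?F = "\<lambda>b y. chart_vec N (V, \<theta>) y b" and ?B = "Basis :: 'f set"
  have V: "openin (mtop N) V" using N.chart_open[OF d(1)] .
  have W1: "openin (mtop M) ?W" "p \<in> ?W" using vimage_open[OF W(1) V] W d by auto
  have Xp: "X p \<in> tangent_space M p" using M.vector_fields_tangent[OF X W(2)] .
  have dXp: "differential N \<phi> p (X p) \<in> tangent_space N (\<phi> p)" using differential_tangent[OF Xp] .
  \<comment> \<open>Constant coefficients in the chart extend the image of \<open>X p\<close> to a
    field along which \<open>Dh\<close> can differentiate.\<close>
  define Z where "Z = (\<lambda>y. chart_vec N (V, \<theta>) y (coord \<theta> (differential N \<phi> p (X p))))"
  have Z: "Z \<in> vector_fields N V" "differential N \<phi> p (X p) = Z (\<phi> p)"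
    unfolding Z_def using N.chart_field[OF d(1)] N.chart_vec_coord[OF d dXp] by simp_all
  have F: "?F b \<in> vector_fields N V" for b using N.chart_field[OF d(1)] .
  define s where "s = (\<lambda>b q. S q (\<lambda>y. \<theta> y \<bullet> b))"
  define t where "t = (\<lambda>b q. T q (\<lambda>y. \<theta> y \<bullet> b))"
  define H where "H = (\<lambda>b c y. h y (?F b y) (?F c y))"
  define G where "G = (\<lambda>b. Dh Z (?F b) (\<phi> p))"
  define f where "f = (\<lambda>b. ?F b (\<phi> p))"
  have ft: "f b \<in> tangent_space N (\<phi> p)" for b
    unfolding f_def using N.vector_fields_tangent[OF F d(2)] .
  have Gt: "G b \<in> tangent_space N (\<phi> p)" for b
    unfolding G_def using N.vector_fields_tangent[OF N.conn_section[OF V Z(1) F] d(2)] .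
  have s: "smooth_near M p (s b)" for b
    unfolding s_def
    by (rule M.smooth_nearI[OF W1 section_smooth[OF S V N.smooth_fun_on_coordinate[OF d(1)]]])
  have t: "smooth_near M p (t b)" for b
    unfolding t_def
    by (rule M.smooth_nearI[OF W1 section_smooth[OF T V N.smooth_fun_on_coordinate[OF d(1)]]])
  have HN: "smooth_fun_on N V (H b c)" for b c
    unfolding H_def by (intro N.metric_smooth V F)
  have H: "smooth_near M p (\<lambda>q. H b c (\<phi> q))" for b c
    by (rule M.smooth_nearI[OF W1 smooth_fun_on_comp[OF V HN W1(1)]]) auto
  have XH: "X p (\<lambda>q. H b c (\<phi> q)) = h (\<phi> p) (G b) (f c) + h (\<phi> p) (f b) (G c)" for b c
  proof -
    have "X p (\<lambda>q. H b c (\<phi> q)) = Z (\<phi> p) (H b c)"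
      unfolding Z(2)[symmetric] by (rule differential_apply[OF N.smooth_nearI[OF V d(2) HN], symmetric])
    then show ?thesis
      using N.levi_civita_at[OF V Z(1) F d(2), of b, THEN conjunct2, THEN bspec, OF F[of c]]
      unfolding H_def G_def f_def by (rule trans)
  qed
  have exp: "h (\<phi> q) (S q) (T q) = (\<Sum>b\<in>?B. \<Sum>c\<in>?B. s b q * (t c q * H b c (\<phi> q)))" if "q \<in> ?W" for q
  proof -
    have q: "q \<in> W" "\<phi> q \<in> V" using that by auto
    have Fq: "?F b (\<phi> q) \<in> tangent_space N (\<phi> q)" for b using N.vector_fields_tangent[OF F q(2)] .
    have "h (\<phi> q) (S q) (T q) =
        h (\<phi> q) (\<Sum>b\<in>?B. s b q \<cdot>\<^sub>v ?F b (\<phi> q)) (\<Sum>c\<in>?B. t c q \<cdot>\<^sub>v ?F c (\<phi> q))"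
      unfolding s_def t_def
      using section_expand[OF d(1) q(2) S q(1)] section_expand[OF d(1) q(2) T q(1)] by simp
    also have "\<dots> = (\<Sum>b\<in>?B. h (\<phi> q) (s b q \<cdot>\<^sub>v ?F b (\<phi> q)) (\<Sum>c\<in>?B. t c q \<cdot>\<^sub>v ?F c (\<phi> q)))"
      by (rule N.metric_sum_left) (simp_all add: Fq N.tangent_vscale N.tangent_sum N.tangent_point[OF Fq])
    also have "\<dots> = (\<Sum>b\<in>?B. \<Sum>c\<in>?B. s b q * (t c q * H b c (\<phi> q)))"
      by (simp add: N.metric_sum_left N.metric_sum_right N.metric_vscale_left N.metric_vscale_right
          Fq N.tangent_vscale N.tangent_sum N.tangent_point[OF Fq] H_def sum_distrib_left
          mult.left_commute)
    finally show ?thesis .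
  qed
  have "?lhs = X p (\<lambda>q. \<Sum>b\<in>?B. \<Sum>c\<in>?B. s b q * (t c q * H b c (\<phi> q)))"
    by (rule M.tangent_apply_cong[OF Xp W1 exp])
  also have "\<dots> = (\<Sum>b\<in>?B. \<Sum>c\<in>?B. X p (\<lambda>q. s b q * (t c q * H b c (\<phi> q))))"
    by (simp add: M.tangent_apply_sum[OF Xp] M.smooth_near_sum M.tangent_point[OF Xp]
        M.smooth_near_mult s t H)
  also have "\<dots> = (\<Sum>b\<in>?B. \<Sum>c\<in>?B. s b p * (t c p * (h (\<phi> p) (G b) (f c) + h (\<phi> p) (f b) (G c)) +
      X p (t c) * h (\<phi> p) (f b) (f c)) + X p (s b) * (t c p * h (\<phi> p) (f b) (f c)))"
    by (simp add: M.tangent_apply_mult[OF Xp] M.smooth_near_mult s t H XH)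
      (simp add: H_def f_def)
  \<comment> \<open>The terms are grouped by which of the two sections is differentiated; the
    compatibility of \<open>Dh\<close> contributes one term to each group.\<close>
  also have "\<dots> = (\<Sum>b\<in>?B. \<Sum>c\<in>?B. X p (s b) * (t c p * h (\<phi> p) (f b) (f c)) +
        s b p * (t c p * h (\<phi> p) (G b) (f c))) +
      (\<Sum>b\<in>?B. \<Sum>c\<in>?B. s b p * (X p (t c) * h (\<phi> p) (f b) (f c)) +
        s b p * (t c p * h (\<phi> p) (f b) (G c)))"
    unfolding sum.distrib[symmetric] by (intro sum.cong refl) (simp add: algebra_simps)
  also have "(\<Sum>b\<in>?B. \<Sum>c\<in>?B. X p (s b) * (t c p * h (\<phi> p) (f b) (f c)) +
        s b p * (t c p * h (\<phi> p) (G b) (f c))) = h (\<phi> p) (D X S p) (T p)"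
  proof -
    have DS: "D X S p = (\<Sum>b\<in>?B. X p (s b) \<cdot>\<^sub>v f b + s b p \<cdot>\<^sub>v G b)"
      unfolding s_def f_def G_def by (rule conn_expand_section[OF d W X S Z])
    have Tp: "T p = (\<Sum>c\<in>?B. t c p \<cdot>\<^sub>v f c)"
      unfolding t_def f_def by (rule section_expand[OF d T W(2)])
    show ?thesis
      unfolding DS Tp
      by (subst sum.swap, simp add: N.metric_sum_left N.metric_sum_right N.metric_vscale_left N.metric_vscale_right
          N.metric_add_left ft Gt N.tangent_add N.tangent_vscale N.tangent_sum N.tangent_point[OF ft]
          sum_distrib_left distrib_left mult.left_commute)
  qed
  also have "(\<Sum>b\<in>?B. \<Sum>c\<in>?B. s b p * (X p (t c) * h (\<phi> p) (f b) (f c)) +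
        s b p * (t c p * h (\<phi> p) (f b) (G c))) = h (\<phi> p) (S p) (D X T p)"
  proof -
    have DT: "D X T p = (\<Sum>b\<in>?B. X p (t b) \<cdot>\<^sub>v f b + t b p \<cdot>\<^sub>v G b)"
      unfolding t_def f_def G_def by (rule conn_expand_section[OF d W X T Z])
    have Sp: "S p = (\<Sum>c\<in>?B. s c p \<cdot>\<^sub>v f c)"
      unfolding s_def f_def by (rule section_expand[OF d S W(2)])
    show ?thesis
      unfolding DT Sp
      by (subst sum.swap, simp add: N.metric_sum_left N.metric_sum_right N.metric_vscale_left N.metric_vscale_right
          N.metric_add_right ft Gt N.tangent_add N.tangent_vscale N.tangent_sum N.tangent_point[OF ft]
          sum_distrib_left distrib_left sum.distrib mult.left_commute)
  qed
  finally show ?thesis .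
qed

text \<open>The bracket is compared with the covariant derivatives on coordinate functions only, where it
  involves no second derivatives; that it is a tangent vector at all comes from the Levi-Civita
  connection.\<close>

lemma induced_torsion_free:
  assumes W: "openin (mtop M) W" "p \<in> W"
    and X: "X \<in> vector_fields M W" and Y: "Y \<in> vector_fields M W"
    and br: "bracket M X Y p \<in> tangent_space M p"
  shows "D X (pushforward N \<phi> Y) p - D Y (pushforward N \<phi> X) p = differential N \<phi> p (bracket M X Y p)"
proof -
  have p: "p \<in> topspace (mtop M)" using W openin_subset by blast
  then obtain V \<theta> where d: "(V, \<theta>) \<in> atlas N" "\<phi> p \<in> V" using N.chart_at[OF map_point] by blast
  let ?W = "W \<inter> \<phi> -` V" and ?F = "\<lambda>b y. chart_vec N (V, \<theta>) y b" and ?B = "Basis :: 'f set"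
  have V: "openin (mtop N) V" using N.chart_open[OF d(1)] .
  have W1: "openin (mtop M) ?W" "p \<in> ?W" using vimage_open[OF W(1) V] W d by auto
  let ?f = "\<lambda>b q. \<theta> (\<phi> q) \<bullet> b"
  let ?Z = "\<lambda>X y. chart_vec N (V, \<theta>) y (coord \<theta> (differential N \<phi> p (X p)))"
  have Z: "?Z X \<in> vector_fields N V" for X using N.chart_field[OF d(1)] .
  have F: "?F b \<in> vector_fields N V" for b using N.chart_field[OF d(1)] .
  \<comment> \<open>A part with second derivatives of the map in coordinates and a Christoffel part.
    Antisymmetrised, the first gives the components of the bracket; the second cancels because
    fields with constant coefficients commute.\<close>
  have expand: "D X (pushforward N \<phi> Y) p =
      (\<Sum>b\<in>?B. X p (\<lambda>q. Y q (?f b)) \<cdot>\<^sub>v ?F b (\<phi> p)) + Dh (?Z X) (?Z Y) (\<phi> p)"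
    if X: "X \<in> vector_fields M W" and Y: "Y \<in> vector_fields M W" for X Y
  proof -
    have Xp: "X p \<in> tangent_space M p" using M.vector_fields_tangent[OF X W(2)] .
    have Yp: "Y p \<in> tangent_space M p" using M.vector_fields_tangent[OF Y W(2)] .
    have ZX: "differential N \<phi> p (X p) = ?Z X (\<phi> p)"
      using N.chart_vec_coord[OF d differential_tangent[OF Xp]] by simp
    have c: "pushforward N \<phi> Y q (\<lambda>y. \<theta> y \<bullet> b) = Y q (?f b)" if "q \<in> ?W" for q b
      unfolding pushforward_def
      by (rule differential_apply[OF N.smooth_near_coordinate[OF d(1)]]) (use that in auto)
    have Xc: "X p (\<lambda>q. pushforward N \<phi> Y q (\<lambda>y. \<theta> y \<bullet> b)) = X p (\<lambda>q. Y q (?f b))" for b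
      by (rule M.tangent_apply_cong[OF Xp W1 c])
    have "?Z Y y = (\<Sum>b\<in>?B. Y p (?f b) \<cdot>\<^sub>v ?F b y)" if "y \<in> V" for y
      using N.chart_vec_sum[OF d(1) that, of _ "\<lambda>b. b"] c[OF W1(2)]
      unfolding coord_def pushforward_def by simp
    then have "Dh (?Z X) (?Z Y) (\<phi> p) = Dh (?Z X) (\<lambda>y. \<Sum>b\<in>?B. Y p (?f b) \<cdot>\<^sub>v ?F b y) (\<phi> p)"
      by (rule N.conn_cong_section[OF V d(2) Z Z, symmetric])
    also have "\<dots> = (\<Sum>b\<in>?B. ?Z X (\<phi> p) (\<lambda>y. Y p (?f b)) \<cdot>\<^sub>v ?F b (\<phi> p) + Y p (?f b) \<cdot>\<^sub>v Dh (?Z X) (?F b) (\<phi> p))"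
      by (rule N.conn_sum_section[OF V d(2) Z finite_Basis N.smooth_fun_on_const F])
    also have "\<dots> = (\<Sum>b\<in>?B. Y p (?f b) \<cdot>\<^sub>v Dh (?Z X) (?F b) (\<phi> p))"
      by (simp add: N.tangent_apply_const[OF N.vector_fields_tangent[OF Z d(2)]])
    finally have DZ: "Dh (?Z X) (?Z Y) (\<phi> p) = (\<Sum>b\<in>?B. Y p (?f b) \<cdot>\<^sub>v Dh (?Z X) (?F b) (\<phi> p))" .
    show ?thesis
      unfolding conn_expand_section[OF d W X pushforward_section[OF W(1) Y], of "?Z X", OF Z[of X] ZX] DZ Xc c[OF W1(2)] sum.distrib ..
  qed
  have "bracket N (?Z X) (?Z Y) (\<phi> p) = 0"
  proof (rule N.tangent_eqI[OF d])
    have "Dh (?Z X) (?Z Y) (\<phi> p) - Dh (?Z Y) (?Z X) (\<phi> p) \<in> tangent_space N (\<phi> p)"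
      by (intro N.tangent_diff N.vector_fields_tangent[OF N.conn_section[OF V Z Z] d(2)])
    then show "bracket N (?Z X) (?Z Y) (\<phi> p) \<in> tangent_space N (\<phi> p)"
      using N.levi_civita_at[OF V Z Z d(2)] by simp
    show "0 \<in> tangent_space N (\<phi> p)" using N.tangent_zero[OF map_point[OF p]] .
    fix b
    have "?Z X (\<phi> p) (\<lambda>q. ?Z Y q (\<lambda>y. \<theta> y \<bullet> b)) = 0" for X Y
    proof -
      have "?Z X (\<phi> p) (\<lambda>q. ?Z Y q (\<lambda>y. \<theta> y \<bullet> b)) =
          ?Z X (\<phi> p) (\<lambda>q. coord \<theta> (differential N \<phi> p (Y p)) \<bullet> b)"
        by (rule N.tangent_apply_cong[OF N.vector_fields_tangent[OF Z d(2)] V d(2)])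
          (rule N.chart_vec_coordinate[OF d(1)])
      then show ?thesis
        using N.tangent_apply_const[OF N.vector_fields_tangent[OF Z d(2)]] by simp
    qed
    then show "bracket N (?Z X) (?Z Y) (\<phi> p) (\<lambda>y. \<theta> y \<bullet> b) = 0 (\<lambda>y. \<theta> y \<bullet> b)"
      by (simp add: bracket_def)
  qed
  then have Dh0: "Dh (?Z X) (?Z Y) (\<phi> p) = Dh (?Z Y) (?Z X) (\<phi> p)"
    using N.levi_civita_at[OF V Z Z d(2), of X Y, THEN conjunct1] by (simp only: right_minus_eq)
  have fb: "smooth_near M p (?f b)" for b
    using smooth_near_comp[OF N.smooth_near_coordinate[OF d] p] .
  have "differential N \<phi> p (bracket M X Y p) =
      (\<Sum>b\<in>?B. differential N \<phi> p (bracket M X Y p) (\<lambda>y. \<theta> y \<bullet> b) \<cdot>\<^sub>v ?F b (\<phi> p))"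
    by (rule N.tangent_expand[OF d differential_tangent[OF br]])
  also have "\<dots> = (\<Sum>b\<in>?B. X p (\<lambda>q. Y q (?f b)) \<cdot>\<^sub>v ?F b (\<phi> p) - Y p (\<lambda>q. X q (?f b)) \<cdot>\<^sub>v ?F b (\<phi> p))"
    by (simp add: differential_apply[OF N.smooth_near_coordinate[OF d]] bracket_def fb vscale_algebra)
  finally show ?thesis
    unfolding expand[OF X Y] expand[OF Y X] Dh0 sum_subtractf by simp
qed

end


section \<open>The hypersurface argument\<close>

locale isometric_immersion_mfd = induced_conn M N \<phi> h Dh D + M: levi_civita_mfd M g Dg
  for M :: "('a, 'e::euclidean_space) manifold" and N :: "('b, 'f::euclidean_space) manifold"
    and \<phi> :: "'a \<Rightarrow> 'b" and h :: "'b metric_field"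
    and Dh :: "'b vfield \<Rightarrow> 'b vfield \<Rightarrow> 'b vfield"
    and D :: "'a vfield \<Rightarrow> ('a \<Rightarrow> 'b tvec) \<Rightarrow> 'a \<Rightarrow> 'b tvec"
    and g :: "'a metric_field" and Dg :: "'a vfield \<Rightarrow> 'a vfield \<Rightarrow> 'a vfield" +
  assumes isometric: "isometric_immersion M g N h \<phi>"
begin

section \<open>The second fundamental form and the tension field\<close>

abbreviation sff :: "'a vfield \<Rightarrow> 'a vfield \<Rightarrow> 'a \<Rightarrow> 'b tvec" where
  "sff \<equiv> second_fundamental_form N \<phi> Dg D"

abbreviation \<tau> :: "'a \<Rightarrow> 'b tvec" where
  "\<tau> \<equiv> tension M g N \<phi> Dg D"

lemma isometric_at:
  assumes "u \<in> tangent_space M p" "v \<in> tangent_space M p"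
  shows "h (\<phi> p) (differential N \<phi> p u) (differential N \<phi> p v) = g p u v"
  using isometric M.tangent_point[OF assms(1)] assms by (simp add: isometric_immersion_def)

lemma sff_section:
  assumes W: "openin (mtop M) W" and X: "X \<in> vector_fields M W" and Y: "Y \<in> vector_fields M W"
  shows "sff X Y \<in> sections_along M N \<phi> W"
proof -
  have "(\<lambda>p. D X (pushforward N \<phi> Y) p + (-1) \<cdot>\<^sub>v pushforward N \<phi> (Dg X Y) p) \<in> sections_along M N \<phi> W"
    by (rule section_add[OF W D.conn_section[OF W X pushforward_section[OF W Y]]
          section_vscale[OF W M.smooth_fun_on_const pushforward_section[OF W M.conn_section[OF W X Y]]]])
  then show ?thesis
    by (rule section_cong[OF W]) (auto simp: second_fundamental_form_def fun_eq_iff tvec_apply)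
qed

text \<open>Antisymmetrising either term of the second fundamental form gives the image of the
  bracket, by torsion-freeness of the induced and of the Levi-Civita connection; the two images
  cancel.\<close>

lemma sff_symmetric:
  assumes W: "openin (mtop M) W" "p \<in> W" and X: "X \<in> vector_fields M W" and Y: "Y \<in> vector_fields M W"
  shows "sff X Y p = sff Y X p"
proof -
  have "D X (pushforward N \<phi> Y) p - D Y (pushforward N \<phi> X) p =
      differential N \<phi> p (Dg X Y p - Dg Y X p)"
    using induced_torsion_free[OF W X Y M.vector_fields_tangent[OF M.bracket_field[OF W(1) X Y] W(2)]]
    by (simp add: M.bracket_eq[OF W X Y])
  then show ?thesis
    by (simp add: second_fundamental_form_def pushforward_def differential_linear algebra_simps)
qed

text \<open>A trilinear form that is symmetric in its first two and antisymmetric in its last two arguments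
  vanishes; this replaces the Koszul formula.\<close>

lemma sff_normal:
  assumes W: "openin (mtop M) W" "p \<in> W" and X: "X \<in> vector_fields M W"
    and Y: "Y \<in> vector_fields M W" and Z: "Z \<in> vector_fields M W"
  shows "h (\<phi> p) (sff X Y p) (differential N \<phi> p (Z p)) = 0"
proof -
  define S where "S = (\<lambda>X Y Z. h (\<phi> p) (sff X Y p) (differential N \<phi> p (Z p)))"
  have sym: "S X Y Z = S Y X Z" if "X \<in> vector_fields M W" "Y \<in> vector_fields M W" for X Y Z
    unfolding S_def using sff_symmetric[OF W that] by simp
  \<comment> \<open>Since the map is isometric, compatibility of \<open>D\<close> with
    \<open>h\<close> and of \<open>Dg\<close> with \<open>g\<close> differentiate the same function.
    Their difference is \<open>S X Y Z + S X Z Y = 0\<close>.\<close>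
  have anti: "S X Y Z = - S X Z Y"
    if X: "X \<in> vector_fields M W" and Y: "Y \<in> vector_fields M W" and Z: "Z \<in> vector_fields M W" for X Y Z
  proof -
    note t = M.vector_fields_tangent[OF _ W(2)]
    have XY: "Dg X Y p \<in> tangent_space M p" and XZ: "Dg X Z p \<in> tangent_space M p"
      using t M.conn_section[OF W(1) X] Y Z by auto
    have DY: "D X (pushforward N \<phi> Y) p \<in> tangent_space N (\<phi> p)"
      and DZ: "D X (pushforward N \<phi> Z) p \<in> tangent_space N (\<phi> p)"
      using section_tangent[OF D.conn_section[OF W(1) X pushforward_section[OF W(1)]] W(2)] Y Z by auto
    have "h (\<phi> p) (D X (pushforward N \<phi> Y) p) (differential N \<phi> p (Z p)) +
        h (\<phi> p) (differential N \<phi> p (Y p)) (D X (pushforward N \<phi> Z) p) =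
        X p (\<lambda>q. h (\<phi> q) (pushforward N \<phi> Y q) (pushforward N \<phi> Z q))"
      using induced_metric[OF W X pushforward_section[OF W(1) Y] pushforward_section[OF W(1) Z]]
      by (simp add: pushforward_def)
    also have "\<dots> = X p (\<lambda>q. g q (Y q) (Z q))"
      by (rule M.tangent_apply_cong[OF t[OF X] W])
        (simp add: pushforward_def isometric_at M.vector_fields_tangent[OF Y] M.vector_fields_tangent[OF Z])
    also have "\<dots> = g p (Dg X Y p) (Z p) + g p (Y p) (Dg X Z p)"
      using M.levi_civita_at[OF W(1) X Y W(2)] Z by blast
    also have "\<dots> = h (\<phi> p) (differential N \<phi> p (Dg X Y p)) (differential N \<phi> p (Z p)) +
        h (\<phi> p) (differential N \<phi> p (Y p)) (differential N \<phi> p (Dg X Z p))"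
      by (simp add: isometric_at XY XZ t Y Z)
    finally show ?thesis
      unfolding S_def second_fundamental_form_def pushforward_def[of _ _ "Dg X Y"] pushforward_def[of _ _ "Dg X Z"]
      using N.metric_sym[OF DZ differential_tangent[OF t[OF Y]]]
        N.metric_sym[OF differential_tangent[OF XZ] differential_tangent[OF t[OF Y]]]
      by (simp add: N.metric_diff_left DY DZ differential_tangent XY XZ t Y Z)
  qed
  \<comment> \<open>Six transpositions, alternately of the last two and of the first two arguments,
    return to the start after three sign changes.\<close>
  have "S X Y Z = - S X Y Z"
    using anti[OF X Y Z] sym[OF X Z] anti[OF Z X Y] sym[OF Z Y] anti[OF Y Z X] sym[OF Y X] by simp
  then show ?thesis unfolding S_def by simp
qed

lemma sff_add_left:
  assumes W: "openin (mtop M) W" "p \<in> W" and X: "X \<in> vector_fields M W" "X' \<in> vector_fields M W"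
    and Y: "Y \<in> vector_fields M W"
  shows "sff (\<lambda>q. X q + X' q) Y p = sff X Y p + sff X' Y p"
  using D.conn_add_field[OF W X pushforward_section[OF W(1) Y]] M.conn_add_field[OF W X Y]
  by (simp add: second_fundamental_form_def pushforward_def differential_linear)

lemma sff_vscale_left:
  assumes W: "openin (mtop M) W" "p \<in> W" and X: "X \<in> vector_fields M W"
    and Y: "Y \<in> vector_fields M W" and k: "smooth_fun_on M W k"
  shows "sff (\<lambda>q. k q \<cdot>\<^sub>v X q) Y p = k p \<cdot>\<^sub>v sff X Y p"
  using D.conn_vscale_field[OF W X k pushforward_section[OF W(1) Y]] M.conn_vscale_field[OF W X k Y]
  by (simp add: second_fundamental_form_def pushforward_def differential_linear vscale_algebra)

lemma sff_eq_left:
  assumes W: "openin (mtop M) W" "p \<in> W" "X \<in> vector_fields M W"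
    and W': "openin (mtop M) W'" "p \<in> W'" "X' \<in> vector_fields M W'"
    and W0: "openin (mtop M) W0" "p \<in> W0" "Y \<in> vector_fields M W0" and eq: "X p = X' p"
  shows "sff X Y p = sff X' Y p"
proof (rule M.tensorial_eq[where p = p and ?W0.0 = W0 and W = "W \<inter> W0" and W' = "W' \<inter> W0"
      and T = "\<lambda>X. sff X Y p"])
  fix W1 X X' assume "openin (mtop M) W1" "p \<in> W1" "W1 \<subseteq> W0" "X \<in> vector_fields M W1" "X' \<in> vector_fields M W1"
  then show "sff (\<lambda>q. X q + X' q) Y p = sff X Y p + sff X' Y p"
    using W0(3) by (intro sff_add_left[where W = W1]) (auto intro: M.vector_fields_subset)
next
  fix W1 X k assume "openin (mtop M) W1" "p \<in> W1" "W1 \<subseteq> W0" "X \<in> vector_fields M W1" "smooth_fun_on M W1 k"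
  then show "sff (\<lambda>q. k q \<cdot>\<^sub>v X q) Y p = k p \<cdot>\<^sub>v sff X Y p"
    using W0(3) by (intro sff_vscale_left[where W = W1]) (auto intro: M.vector_fields_subset)
qed (use W W' W0 eq in \<open>auto intro: M.vector_fields_subset\<close>)

text \<open>In the second argument a field is differentiated, so pointwise dependence is not evident
  there; symmetry moves it to the first argument.\<close>

lemma sff_eq:
  assumes W: "openin (mtop M) W" "p \<in> W" "X \<in> vector_fields M W" "Y \<in> vector_fields M W"
    and W': "openin (mtop M) W'" "p \<in> W'" "X' \<in> vector_fields M W'" "Y' \<in> vector_fields M W'"
    and eq: "X p = X' p" "Y p = Y' p"
  shows "sff X Y p = sff X' Y' p"
proof -
  have WW: "openin (mtop M) (W \<inter> W')" "p \<in> W \<inter> W'" using W W' by auto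
  have Y: "Y \<in> vector_fields M (W \<inter> W')" and X': "X' \<in> vector_fields M (W \<inter> W')"
    using W W' by (auto intro: M.vector_fields_subset)
  have "sff X Y p = sff X' Y p" by (rule sff_eq_left[OF W(1-3) W'(1-3) W(1,2,4) eq(1)])
  also have "\<dots> = sff Y X' p" by (rule sff_symmetric[OF WW X' Y])
  also have "\<dots> = sff Y' X' p" by (rule sff_eq_left[OF W(1,2,4) W'(1,2,4) W'(1-3) eq(2)])
  also have "\<dots> = sff X' Y' p" by (rule sff_symmetric[OF W'(1,2,4,3)])
  finally show ?thesis .
qed

text \<open>\<open>tension\<close> picks a frame anew at every point, which hides how it varies.
  Independence of the trace expresses it through one frame on all of \<open>W\<close>, where
  smoothness becomes visible.\<close>

lemma tension_eq:
  assumes W: "openin (mtop M) W" "p \<in> W" and E: "orthonormal_frame_on M g W E"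
  shows "\<tau> p = (\<Sum>i<mdim M. sff (E i) (E i) p)"
proof -
  have p: "p \<in> topspace (mtop M)" using W openin_subset by blast
  obtain W' where W': "openin (mtop M) W'" "p \<in> W'" and F: "orthonormal_frame_on M g W' (frame_near M g p)"
    using M.frame_near_frame[OF p] .
  let ?F = "frame_near M g p" and ?x = "extension M p"
  \<comment> \<open>The second fundamental form as a bilinear form on tangent vectors at
    \<open>p\<close>; by \<open>sff_eq\<close> the chosen extensions do not affect it.\<close>
  let ?\<beta> = "\<lambda>u v. sff (?x u) (?x v) p"
  have at: "sff X Y p = ?\<beta> (X p) (Y p)"
    if W: "openin (mtop M) W" "p \<in> W" "X \<in> vector_fields M W" "Y \<in> vector_fields M W" for W X Y
  proof -
    obtain W1 where "openin (mtop M) W1" "p \<in> W1" "?x (X p) \<in> vector_fields M W1"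
      "?x (Y p) \<in> vector_fields M W1" "?x (X p) p = X p" "?x (Y p) p = Y p"
      using M.curvature_at_extend[OF M.vector_fields_tangent[OF W(3,2)] M.vector_fields_tangent[OF W(4,2)]] .
    then show ?thesis by (intro sff_eq[OF W]) simp_all
  qed
  have ext: "\<exists>W. openin (mtop M) W \<and> p \<in> W \<and> ?x u \<in> vector_fields M W \<and> ?x v \<in> vector_fields M W \<and>
      ?x w \<in> vector_fields M W \<and> ?x u p = u \<and> ?x v p = v \<and> ?x w p = w"
    if uvw: "u \<in> tangent_space M p" "v \<in> tangent_space M p" "w \<in> tangent_space M p" for u v w
  proof -
    obtain W1 where 1: "openin (mtop M) W1" "p \<in> W1" "?x u \<in> vector_fields M W1"
      "?x v \<in> vector_fields M W1" "?x u p = u" "?x v p = v" using M.curvature_at_extend[OF uvw(1,2)] .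
    obtain W2 where 2: "openin (mtop M) W2" "p \<in> W2" "?x w \<in> vector_fields M W2" "?x w p = w"
      using M.extension_field[OF uvw(3)] .
    show ?thesis
      by (rule exI[of _ "W1 \<inter> W2"])
        (use 1 2 in \<open>auto intro: M.vector_fields_subset[of _ W1] M.vector_fields_subset[of _ W2]\<close>)
  qed
  have add1: "?\<beta> (u + v) w = ?\<beta> u w + ?\<beta> v w"
    if uvw: "u \<in> tangent_space M p" "v \<in> tangent_space M p" "w \<in> tangent_space M p" for u v w
  proof -
    obtain W1 where 1: "openin (mtop M) W1" "p \<in> W1" "?x u \<in> vector_fields M W1"
      "?x v \<in> vector_fields M W1" "?x w \<in> vector_fields M W1" "?x u p = u" "?x v p = v" "?x w p = w"
      using ext[OF uvw] by blast
    show ?thesis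
      using at[OF 1(1,2) M.vector_fields_add[OF 1(3,4)] 1(5)] sff_add_left[OF 1(1-5)] 1(6-8) by simp
  qed
  have scale1: "?\<beta> (a \<cdot>\<^sub>v u) w = a \<cdot>\<^sub>v ?\<beta> u w"
    if uw: "u \<in> tangent_space M p" "w \<in> tangent_space M p" for a u w
  proof -
    obtain W1 where 1: "openin (mtop M) W1" "p \<in> W1" "?x u \<in> vector_fields M W1"
      "?x w \<in> vector_fields M W1" "?x u p = u" "?x w p = w"
      using ext[OF uw uw(2)] by blast
    show ?thesis
      using at[OF 1(1,2) M.vector_fields_vscale[OF 1(3) M.smooth_fun_on_const] 1(4), of a]
        sff_vscale_left[OF 1(1-4) M.smooth_fun_on_const, of a] 1(5,6) by simp
  qed
  have sym: "?\<beta> u w = ?\<beta> w u" if uw: "u \<in> tangent_space M p" "w \<in> tangent_space M p" for u w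
  proof -
    obtain W1 where 1: "openin (mtop M) W1" "p \<in> W1" "?x u \<in> vector_fields M W1"
      "?x w \<in> vector_fields M W1" using ext[OF uw uw(2)] by blast
    show ?thesis by (rule sff_symmetric[OF 1])
  qed
  have "\<tau> p = (\<Sum>i<mdim M. sff (?F i) (?F i) p)" by (simp add: tension_def Let_def)
  also have "\<dots> = (\<Sum>i<mdim M. ?\<beta> (?F i p) (?F i p))"
    by (intro sum.cong refl at[OF W']) (use F in \<open>auto simp: orthonormal_frame_on_def\<close>)
  also have "\<dots> = (\<Sum>i<mdim M. ?\<beta> (E i p) (E i p))"
  proof (rule M.trace_independent[OF _ _ p, where \<beta> = ?\<beta>])
    show "orthonormal_basis_at M g p (\<lambda>i. ?F i p)" "orthonormal_basis_at M g p (\<lambda>i. E i p)"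
      using F E W W' by (auto simp: orthonormal_frame_on_def)
    show "?\<beta> (u + v) w = ?\<beta> u w + ?\<beta> v w"
      if "u \<in> tangent_space M p" "v \<in> tangent_space M p" "w \<in> tangent_space M p" for u v w
      using add1[OF that] .
    show "?\<beta> (a \<cdot>\<^sub>v u) w = a \<cdot>\<^sub>v ?\<beta> u w"
      if "u \<in> tangent_space M p" "w \<in> tangent_space M p" for a u w
      using scale1[OF that] .
    show "?\<beta> w (u + v) = ?\<beta> w u + ?\<beta> w v"
      if "u \<in> tangent_space M p" "v \<in> tangent_space M p" "w \<in> tangent_space M p" for u v w
      using add1[OF that] that by (simp add: sym[of w] M.tangent_add)
    show "?\<beta> w (a \<cdot>\<^sub>v u) = a \<cdot>\<^sub>v ?\<beta> w u"
      if "u \<in> tangent_space M p" "w \<in> tangent_space M p" for a u w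
      using scale1[OF that] that by (simp add: sym[of w] M.tangent_vscale)
  qed
  also have "\<dots> = (\<Sum>i<mdim M. sff (E i) (E i) p)"
    by (intro sum.cong refl at[OF W, symmetric]) (use E in \<open>auto simp: orthonormal_frame_on_def\<close>)
  finally show ?thesis .
qed

lemma tension_section:
  assumes W: "openin (mtop M) W" and E: "orthonormal_frame_on M g W E"
  shows "\<tau> \<in> sections_along M N \<phi> W"
proof (rule section_cong[OF W])
  show "(\<lambda>p. \<Sum>i<mdim M. sff (E i) (E i) p) \<in> sections_along M N \<phi> W"
    using E by (intro D.section_sum W sff_section) (auto simp: orthonormal_frame_on_def)
qed (simp add: tension_eq[OF W _ E])

lemma tension_normal:
  assumes v: "v \<in> tangent_space M p"
  shows "h (\<phi> p) (\<tau> p) (differential N \<phi> p v) = 0"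
proof -
  have p: "p \<in> topspace (mtop M)" using M.tangent_point[OF v] .
  obtain W where W: "openin (mtop M) W" "p \<in> W" and E: "orthonormal_frame_on M g W (frame_near M g p)"
    using M.frame_near_frame[OF p] .
  \<comment> \<open>A global field restricts to the frame domain \<open>W\<close>, whatever that
    domain is.\<close>
  obtain X where X: "X \<in> vector_fields M (topspace (mtop M))" "X p = v"
    using M.global_vector_field_through[OF v] .
  have XW: "X \<in> vector_fields M W" using M.vector_fields_subset[OF X(1) openin_subset[OF W(1)]] .
  let ?E = "frame_near M g p"
  have Ei: "?E i \<in> vector_fields M W" if "i < mdim M" for i
    using E that by (simp add: orthonormal_frame_on_def)
  have "h (\<phi> p) (\<tau> p) (differential N \<phi> p v) =
      (\<Sum>i<mdim M. h (\<phi> p) (sff (?E i) (?E i) p) (differential N \<phi> p v))"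
    unfolding tension_eq[OF W E]
    by (rule N.metric_sum_left[OF differential_tangent[OF v]])
      (use section_tangent[OF sff_section[OF W(1) Ei Ei] W(2)] in auto)
  also have "\<dots> = 0"
    by (intro sum.neutral ballI) (use sff_normal[OF W Ei Ei XW] X(2) in auto)
  finally show ?thesis .
qed

text \<open>\<open>normal_part\<close> is a definite description, so its vanishing carries
  information only once the decomposition is known to exist and to be unique. Orthogonal projection
  onto the image of an orthonormal basis gives existence; a vector both normal and tangential has
  length zero, which gives uniqueness.\<close>

lemma normal_part_eq_0:
  assumes p: "p \<in> topspace (mtop M)" and w: "w \<in> tangent_space N (\<phi> p)"
    and 0: "normal_part M N h \<phi> p w = 0"
  obtains v where "v \<in> tangent_space M p" "w = differential N \<phi> p v"
proof -
  let ?d = "differential N \<phi> p"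
  let ?P = "\<lambda>z. z \<in> normal_space M N h \<phi> p \<and> (\<exists>v\<in>tangent_space M p. w = ?d v + z)"
  obtain W where W: "openin (mtop M) W" "p \<in> W" and E: "orthonormal_frame_on M g W (frame_near M g p)"
    using M.frame_near_frame[OF p] .
  define e where "e = (\<lambda>i. frame_near M g p i p)"
  have e: "orthonormal_basis_at M g p e"
    using E W(2) by (simp add: orthonormal_frame_on_def e_def)
  have et: "e i \<in> tangent_space M p" if "i < mdim M" for i
    using e that by (simp add: orthonormal_basis_at_def)
  define v where "v = (\<Sum>i<mdim M. h (\<phi> p) w (?d (e i)) \<cdot>\<^sub>v e i)"
  have v: "v \<in> tangent_space M p"
    unfolding v_def by (intro M.tangent_sum p M.tangent_vscale et) simp
  have ve: "g p v (e j) = h (\<phi> p) w (?d (e j))" if "j < mdim M" for j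
    unfolding v_def by (rule M.orthonormal_sum) (use e that in \<open>auto simp: orthonormal_basis_at_def\<close>)
  have "h (\<phi> p) (w - ?d v) (?d u) = 0" if u: "u \<in> tangent_space M p" for u
  proof -
    have dsum: "?d (\<Sum>i<n. a i \<cdot>\<^sub>v e i) = (\<Sum>i<n. a i \<cdot>\<^sub>v ?d (e i))" for a and n :: nat
      by (induction n) (simp_all only: lessThan_0 sum.empty sum.lessThan_Suc differential_linear)
    have "?d u = (\<Sum>i<mdim M. g p u (e i) \<cdot>\<^sub>v ?d (e i))"
      using M.orthonormal_basis_expand[OF e u] dsum by metis
    then have "h (\<phi> p) (w - ?d v) (?d u) = h (\<phi> p) (w - ?d v) (\<Sum>i<mdim M. g p u (e i) \<cdot>\<^sub>v ?d (e i))"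
      by (rule arg_cong)
    also have "\<dots> = (\<Sum>i<mdim M. h (\<phi> p) (w - ?d v) (g p u (e i) \<cdot>\<^sub>v ?d (e i)))"
      by (rule N.metric_sum_right) (auto intro!: N.tangent_vscale N.tangent_diff w v et differential_tangent)
    also have "\<dots> = (\<Sum>i<mdim M. g p u (e i) * h (\<phi> p) (w - ?d v) (?d (e i)))"
      by (intro sum.cong refl N.metric_vscale_right) (auto intro!: N.tangent_diff w v et differential_tangent)
    also have "\<dots> = 0"
      by (intro sum.neutral ballI)
        (simp add: N.metric_diff_left w v et differential_tangent isometric_at ve)
    finally show ?thesis .
  qed
  then have P: "?P (w - ?d v)"
    using v w by (auto simp: normal_space_def N.tangent_diff differential_tangent)
  have uniq: "z = z'" if z: "?P z" and z': "?P z'" for z z'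
  proof -
    obtain u u' where u: "u \<in> tangent_space M p" "w = ?d u + z" and u': "u' \<in> tangent_space M p" "w = ?d u' + z'"
      using z z' by blast
    have zt: "z \<in> tangent_space N (\<phi> p)" "z' \<in> tangent_space N (\<phi> p)"
      using z z' by (auto simp: normal_space_def)
    have ut: "u' - u \<in> tangent_space M p" using u u' by (intro M.tangent_diff)
    have "?d u + z = ?d u' + z'" using u(2) u'(2) by (rule trans[OF sym])
    then have eq: "z - z' = ?d (u' - u)"
      by (simp add: differential_linear algebra_simps)
    have "h (\<phi> p) (z - z') (z - z') = h (\<phi> p) z (?d (u' - u)) - h (\<phi> p) z' (?d (u' - u))"
      unfolding eq[symmetric] by (simp add: N.metric_diff_left zt N.tangent_diff)
    also have "\<dots> = 0" using z z' ut by (auto simp: normal_space_def)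
    finally have "z - z' = 0" by (rule N.metric_eq_0[OF N.tangent_diff[OF zt]])
    then show ?thesis by simp
  qed
  have "normal_part M N h \<phi> p w = w - ?d v"
    unfolding normal_part_def by (rule the_equality[where P = ?P, OF P uniq[OF _ P]])
  then have "w = ?d v" using 0 by simp
  then show ?thesis using that v by blast
qed

end

section \<open>Hypersurfaces with parallel tension field\<close>

locale hypersurface = isometric_immersion_mfd M N \<phi> h Dh D g Dg
  for M :: "('a, 'e::euclidean_space) manifold" and N :: "('b, 'f::euclidean_space) manifold"
    and \<phi> :: "'a \<Rightarrow> 'b" and h :: "'b metric_field"
    and Dh :: "'b vfield \<Rightarrow> 'b vfield \<Rightarrow> 'b vfield"
    and D :: "'a vfield \<Rightarrow> ('a \<Rightarrow> 'b tvec) \<Rightarrow> 'a \<Rightarrow> 'b tvec"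
    and g :: "'a metric_field" and Dg :: "'a vfield \<Rightarrow> 'a vfield \<Rightarrow> 'a vfield" +
  assumes codim: "mdim N = Suc (mdim M)"
    and parallel: "\<And>X p. X \<in> vector_fields M (topspace (mtop M)) \<Longrightarrow> p \<in> topspace (mtop M) \<Longrightarrow>
      normal_connection M N h \<phi> D X (tension M g N \<phi> Dg D) p = 0"
begin

text \<open>A global field with the value \<open>X p\<close> has the same derivative of the tension
  field at \<open>p\<close>, so \<open>parallel\<close> applies and makes this derivative
  tangential, hence orthogonal to the normal tension field.\<close>

lemma conn_tension_normal:
  assumes W: "openin (mtop M) W" "p \<in> W" and X: "X \<in> vector_fields M W"
    and \<tau>: "\<tau> \<in> sections_along M N \<phi> W"
  shows "h (\<phi> p) (D X \<tau> p) (\<tau> p) = 0"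
proof -
  have p: "p \<in> topspace (mtop M)" using W openin_subset by blast
  obtain X' where X': "X' \<in> vector_fields M (topspace (mtop M))" "X' p = X p"
    using M.global_vector_field_through[OF M.vector_fields_tangent[OF X W(2)]] .
  have X'W: "X' \<in> vector_fields M W" using M.vector_fields_subset[OF X'(1) openin_subset[OF W(1)]] .
  have Dt: "D X \<tau> p \<in> tangent_space N (\<phi> p)"
    using section_tangent[OF D.conn_section[OF W(1) X \<tau>] W(2)] .
  have "D X' \<tau> p = D X \<tau> p"
    by (rule D.conn_tensorial[OF W X'W W X subset_refl subset_refl \<tau> X'(2)])
  then have "normal_part M N h \<phi> p (D X \<tau> p) = 0"
    using parallel[OF X'(1) p] by (simp add: normal_connection_def)
  then obtain v where v: "v \<in> tangent_space M p" "D X \<tau> p = differential N \<phi> p v"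
    using normal_part_eq_0[OF p Dt] by blast
  have \<tau>p: "\<tau> p \<in> tangent_space N (\<phi> p)" using section_tangent[OF \<tau> W(2)] .
  show ?thesis
    unfolding v(2) using tension_normal[OF v(1)] N.metric_sym[OF \<tau>p differential_tangent[OF v(1)]] by simp
qed

lemma ricci_tension:
  assumes p: "p \<in> topspace (mtop M)" and e: "orthonormal_basis_at M g p e"
    and \<tau>p: "\<tau> p \<in> tangent_space N (\<phi> p)" "\<tau> p \<noteq> 0"
  shows "ricci_transform N h Dh (\<phi> p) (\<tau> p) =
    (\<Sum>i<mdim M. curvature_at N Dh (\<phi> p) (\<tau> p) (differential N \<phi> p (e i)) (differential N \<phi> p (e i)))"
proof -
  let ?R = "curvature_at N Dh (\<phi> p) (\<tau> p)" and ?d = "differential N \<phi> p"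
  define c where "c = inverse (sqrt (h (\<phi> p) (\<tau> p) (\<tau> p)))"
  \<comment> \<open>As \<open>mdim N = Suc (mdim M)\<close>, exactly the index \<open>mdim M\<close>
    remains for the normal direction; \<open>c\<close> scales the tension field to unit
    length.\<close>
  define e' where "e' = (\<lambda>i. if i < mdim M then ?d (e i) else c \<cdot>\<^sub>v \<tau> p)"
  have et: "e i \<in> tangent_space M p" if "i < mdim M" for i
    using e that by (simp add: orthonormal_basis_at_def)
  have "h (\<phi> p) (\<tau> p) (\<tau> p) > 0" using N.metric_pos[OF \<tau>p] .
  then have cc: "c * (c * h (\<phi> p) (\<tau> p) (\<tau> p)) = 1"
    unfolding c_def by (simp add: field_simps)
  have n0: "h (\<phi> p) (?d (e i)) (\<tau> p) = 0" if "i < mdim M" for i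
    using tension_normal[OF et[OF that]] N.metric_sym[OF \<tau>p(1) differential_tangent[OF et[OF that]]] by simp
  have e': "orthonormal_basis_at N h (\<phi> p) e'"
    unfolding orthonormal_basis_at_def codim
    using e
    by (auto simp: e'_def less_Suc_eq orthonormal_basis_at_def differential_tangent et \<tau>p N.tangent_vscale
        isometric_at N.metric_vscale_left N.metric_vscale_right tension_normal n0 cc)
  have "ricci_transform N h Dh (\<phi> p) (\<tau> p) = (\<Sum>i<mdim N. ?R (e' i) (e' i))"
    unfolding ricci_transform_def
  proof (rule N.trace_independent[OF N.orthonormal_basis_basis_at[OF e'] e' map_point[OF p], where \<beta> = ?R])
    fix u v w a assume u: "u \<in> tangent_space N (\<phi> p)" and w: "w \<in> tangent_space N (\<phi> p)"
    show "?R (a \<cdot>\<^sub>v u) w = a \<cdot>\<^sub>v ?R u w" "?R w (a \<cdot>\<^sub>v u) = a \<cdot>\<^sub>v ?R w u"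
      by (rule N.curvature_at_vscale(1)[OF \<tau>p(1) u w], rule N.curvature_at_vscale(2)[OF \<tau>p(1) u w])
    assume v: "v \<in> tangent_space N (\<phi> p)"
    show "?R (u + v) w = ?R u w + ?R v w" "?R w (u + v) = ?R w u + ?R w v"
      by (rule N.curvature_at_bilinear(1)[OF \<tau>p(1) u v w], rule N.curvature_at_bilinear(3)[OF \<tau>p(1) u v w])
  qed
  \<comment> \<open>The extra summand is \<open>c * c\<close> times the curvature with the tension
    field in all three slots, which vanishes by \<open>curvature_at_same\<close>.\<close>
  also have "\<dots> = (\<Sum>i<mdim M. ?R (?d (e i)) (?d (e i))) + ?R (c \<cdot>\<^sub>v \<tau> p) (c \<cdot>\<^sub>v \<tau> p)"
    unfolding codim by (simp add: e'_def)
  finally show ?thesis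
    using \<tau>p(1) by (simp add: N.curvature_at_vscale N.curvature_at_same N.tangent_vscale)
qed

lemma tension_eq_0:
  assumes p: "p \<in> topspace (mtop M)"
    and ricci: "nonpositive_ricci N h Dh" and biharmonic: "bitension M g N \<phi> Dg Dh D p = 0"
  shows "\<tau> p = 0"
proof (rule ccontr)
  assume nz: "\<tau> p \<noteq> 0"
  let ?E = "frame_near M g p" and ?m = "mdim M" and ?h = "h (\<phi> p)"
  obtain W where W: "openin (mtop M) W" "p \<in> W" and E: "orthonormal_frame_on M g W ?E"
    using M.frame_near_frame[OF p] .
  have Ei: "?E i \<in> vector_fields M W" if "i < ?m" for i
    using E that by (simp add: orthonormal_frame_on_def)
  have \<tau>: "\<tau> \<in> sections_along M N \<phi> W" by (rule tension_section[OF W(1) E])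
  have \<tau>p: "\<tau> p \<in> tangent_space N (\<phi> p)" using section_tangent[OF \<tau> W(2)] .
  have D\<tau>: "D X \<tau> \<in> sections_along M N \<phi> W" if "X \<in> vector_fields M W" for X
    using D.conn_section[OF W(1) that \<tau>] .
  have st: "S p \<in> tangent_space N (\<phi> p)" if "S \<in> sections_along M N \<phi> W" for S
    using section_tangent[OF that W(2)] .
  \<comment> \<open>\<open>A i\<close> is the summand inside the negated sum of
    \<open>rough_laplacian\<close>. Together with the minus sign in \<open>hA\<close>, the Laplacian
    pairs with the tension field to a sum of squares.\<close>
  define A where "A = (\<lambda>i. D (?E i) (D (?E i) \<tau>) p - D (Dg (?E i) (?E i)) \<tau> p)"
  define C where "C = (\<lambda>i. curvature_at N Dh (\<phi> p) (\<tau> p)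
    (differential N \<phi> p (?E i p)) (differential N \<phi> p (?E i p)))"
  have hA: "?h (A i) (\<tau> p) = - ?h (D (?E i) \<tau> p) (D (?E i) \<tau> p)" and At: "A i \<in> tangent_space N (\<phi> p)"
    if i: "i < ?m" for i
  proof -
    let ?X = "?E i"
    have DD: "D ?X (D ?X \<tau>) p \<in> tangent_space N (\<phi> p)"
      by (rule st[OF D.conn_section[OF W(1) Ei[OF i] D\<tau>[OF Ei[OF i]]]])
    have GX: "Dg ?X ?X \<in> vector_fields M W" by (rule M.conn_section[OF W(1) Ei[OF i] Ei[OF i]])
    show "A i \<in> tangent_space N (\<phi> p)"
      unfolding A_def by (rule N.tangent_diff[OF DD st[OF D\<tau>[OF GX]]])
    have "?h (D ?X (D ?X \<tau>) p) (\<tau> p) + ?h (D ?X \<tau> p) (D ?X \<tau> p) =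
        ?X p (\<lambda>q. h (\<phi> q) (D ?X \<tau> q) (\<tau> q))"
      by (rule induced_metric[OF W Ei[OF i] D\<tau>[OF Ei[OF i]] \<tau>, symmetric])
    \<comment> \<open>The pairing vanishes on all of \<open>W\<close>, not merely at
      \<open>p\<close>, which is what permits differentiating it.\<close>
    also have "\<dots> = ?X p (\<lambda>q. 0)"
      by (rule M.tangent_apply_cong[OF M.vector_fields_tangent[OF Ei[OF i] W(2)] W])
        (rule conn_tension_normal[OF W(1) _ Ei[OF i] \<tau>])
    also have "\<dots> = 0" by (rule M.tangent_apply_const[OF M.vector_fields_tangent[OF Ei[OF i] W(2)]])
    \<comment> \<open>The correction term in \<open>A i\<close> is also a derivative of the tension
      field along a smooth field, so it is orthogonal to the tension field and drops out.\<close>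
    finally show "?h (A i) (\<tau> p) = - ?h (D ?X \<tau> p) (D ?X \<tau> p)"
      unfolding A_def N.metric_diff_left[OF DD st[OF D\<tau>[OF GX]] \<tau>p]
        conn_tension_normal[OF W GX \<tau>] by simp
  qed
  have Et: "?E i p \<in> tangent_space M p" if "i < ?m" for i
    using M.vector_fields_tangent[OF Ei[OF that] W(2)] .
  have Ct: "C i \<in> tangent_space N (\<phi> p)" if "i < ?m" for i
    unfolding C_def by (intro N.curvature_at_tangent \<tau>p differential_tangent Et that)
  have sA: "(\<Sum>i<?m. A i) \<in> tangent_space N (\<phi> p)" and sC: "(\<Sum>i<?m. C i) \<in> tangent_space N (\<phi> p)"
    by (auto intro!: N.tangent_sum map_point p At Ct)
  have hsA: "?h (\<Sum>i<?m. A i) (\<tau> p) = (\<Sum>i<?m. ?h (A i) (\<tau> p))"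
    by (rule N.metric_sum_left[OF \<tau>p]) (auto intro: At)
  have "- (\<Sum>i<?m. A i) - (\<Sum>i<?m. C i) = 0"
    using biharmonic unfolding bitension_def rough_laplacian_def Let_def pushforward_def A_def C_def .
  then have "(\<Sum>i<?m. A i) + (\<Sum>i<?m. C i) = 0"
    unfolding right_minus_eq neg_eq_iff_add_eq_0 .
  then have "?h ((\<Sum>i<?m. A i) + (\<Sum>i<?m. C i)) (\<tau> p) = 0"
    by (simp only: N.metric_zero_left[OF \<tau>p])
  then have "(\<Sum>i<?m. ?h (A i) (\<tau> p)) + ?h (\<Sum>i<?m. C i) (\<tau> p) = 0"
    unfolding N.metric_add_left[OF sA sC \<tau>p] hsA .
  then have "(\<Sum>i<?m. ?h (D (?E i) \<tau> p) (D (?E i) \<tau> p)) = ?h (\<Sum>i<?m. C i) (\<tau> p)"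
    by (simp add: hA sum_negf)
  moreover have "(\<Sum>i<?m. C i) = ricci_transform N h Dh (\<phi> p) (\<tau> p)"
    unfolding C_def
    by (rule ricci_tension[OF p _ \<tau>p nz, symmetric]) (use E W(2) in \<open>simp add: orthonormal_frame_on_def\<close>)
  moreover have "?h (ricci_transform N h Dh (\<phi> p) (\<tau> p)) (\<tau> p) \<le> 0"
    using ricci map_point[OF p] \<tau>p by (simp add: nonpositive_ricci_def)
  ultimately have le: "(\<Sum>i<?m. ?h (D (?E i) \<tau> p) (D (?E i) \<tau> p)) \<le> 0" by simp
  have nn: "?h (D (?E i) \<tau> p) (D (?E i) \<tau> p) \<ge> 0" if "i < ?m" for i
    by (rule N.metric_nonneg[OF st[OF D\<tau>[OF Ei[OF that]]]])
  have "(\<Sum>i<?m. ?h (D (?E i) \<tau> p) (D (?E i) \<tau> p)) = 0"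
    using le nn by (intro antisym sum_nonneg) auto
  then have "?h (D (?E i) \<tau> p) (D (?E i) \<tau> p) = 0" if "i < ?m" for i
    using nn that by (subst (asm) sum_nonneg_eq_0_iff) auto
  \<comment> \<open>Obtained at \<open>p\<close> only, where it is used inside a product rule
    evaluated at \<open>p\<close>.\<close>
  then have D0: "D (?E i) \<tau> p = 0" if "i < ?m" for i
    using N.metric_eq_0[OF st[OF D\<tau>[OF Ei[OF that]]]] that by blast
  have "?h (sff (?E i) (?E i) p) (\<tau> p) = 0" if i: "i < ?m" for i
  proof -
    let ?X = "?E i"
    have dX: "pushforward N \<phi> ?X \<in> sections_along M N \<phi> W" by (rule pushforward_section[OF W(1) Ei[OF i]])
    have GX: "Dg ?X ?X p \<in> tangent_space M p"
      using M.vector_fields_tangent[OF M.conn_section[OF W(1) Ei[OF i] Ei[OF i]] W(2)] .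
    have n: "h (\<phi> q) (differential N \<phi> q v) (\<tau> q) = 0" if "q \<in> W" "v \<in> tangent_space M q" for q v
      using tension_normal[OF that(2)] N.metric_sym[OF section_tangent[OF \<tau> that(1)] differential_tangent[OF that(2)]]
      by simp
    have "?h (D ?X (pushforward N \<phi> ?X) p) (\<tau> p) + ?h (pushforward N \<phi> ?X p) (D ?X \<tau> p) =
        ?X p (\<lambda>q. h (\<phi> q) (pushforward N \<phi> ?X q) (\<tau> q))"
      by (rule induced_metric[OF W Ei[OF i] dX \<tau>, symmetric])
    also have "\<dots> = ?X p (\<lambda>q. 0)"
      by (rule M.tangent_apply_cong[OF Et[OF i] W])
        (simp add: pushforward_def n M.vector_fields_tangent[OF Ei[OF i]])
    also have "\<dots> = 0" by (rule M.tangent_apply_const[OF Et[OF i]])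
    finally have "?h (D ?X (pushforward N \<phi> ?X) p) (\<tau> p) = 0"
      using D0[OF i] N.metric_zero_right[OF st[OF dX]] by simp
    \<comment> \<open>\<open>sff\<close> differs from the derivative just paired by a tangential
      vector, which is orthogonal to the tension field.\<close>
    then show ?thesis
      unfolding second_fundamental_form_def pushforward_def[of _ _ "Dg ?X ?X"]
      using N.metric_diff_left[OF st[OF D.conn_section[OF W(1) Ei[OF i] dX]] differential_tangent[OF GX] \<tau>p]
        n[OF W(2) GX] by simp
  qed
  then have "(\<Sum>i<?m. ?h (sff (?E i) (?E i) p) (\<tau> p)) = 0" by simp
  moreover have "?h (\<tau> p) (\<tau> p) = (\<Sum>i<?m. ?h (sff (?E i) (?E i) p) (\<tau> p))"
    by (subst (1) tension_eq[OF W E], rule N.metric_sum_left[OF \<tau>p])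
      (use st[OF sff_section[OF W(1) Ei Ei]] in auto)
  ultimately show False using N.metric_pos[OF \<tau>p nz] by simp
qed

end

theorem theorem3p7:
  fixes M :: "('a, 'e::euclidean_space) manifold" and g :: "'a metric_field"
    and N :: "('b, 'f::euclidean_space) manifold" and h :: "'b metric_field"
    and \<phi> :: "'a \<Rightarrow> 'b"
    and nabla :: "'a vfield \<Rightarrow> 'a vfield \<Rightarrow> 'a vfield"
    and nabla_h :: "'b vfield \<Rightarrow> 'b vfield \<Rightarrow> 'b vfield"
    and nabla_bar :: "'a vfield \<Rightarrow> ('a \<Rightarrow> 'b tvec) \<Rightarrow> 'a \<Rightarrow> 'b tvec"
  assumes "riemannian_manifold M g" and "riemannian_manifold N h"
    and "levi_civita M g nabla" and "levi_civita N h nabla_h"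
    and "isometric_immersion M g N h \<phi>"
    and "induced_connection M N \<phi> nabla_h nabla_bar"
    and "nonpositive_ricci N h nabla_h"
    and "mdim M + 1 = mdim N"
    and "\<forall>X\<in>vector_fields M (topspace (mtop M)). \<forall>p\<in>topspace (mtop M).
           normal_connection M N h \<phi> nabla_bar X (tension M g N \<phi> nabla nabla_bar) p = 0"
    and "biharmonic M g N \<phi> nabla nabla_h nabla_bar"
  shows "harmonic M g N \<phi> nabla nabla_bar"
proof -
  interpret hypersurface M N \<phi> h nabla_h nabla_bar g nabla
    by unfold_locales
      (use assms in \<open>auto simp: riemannian_manifold_def isometric_immersion_def\<close>)
  show ?thesis
    unfolding harmonic_def using tension_eq_0 assms(7,10) by (auto simp: biharmonic_def)
qed

end
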